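(* Let $G$ be an uncountable locally compact abelian Polish group. Then there is no Erdős–Sierpiński mapping $F\colon G\to G$ that preserves addition; that is, there is no Erdős–Sierpiński mapping $F\colon G\to G$ such that $F(x+y)=F(x)+F(y)$ for all $x,y\in G$.
   Context: For a locally compact abelian Polish group $G$ (written additively), $\mathcal{M}$ denotes the ideal of meager subsets of $G$ and $\mathcal{N}$ denotes the ideal of null subsets of $G$ with respect to Haar measure. A bijection $F\colon G\to G$ is called an Erdős–Sierpiński mapping if for every $X\subseteq G$: $X\in\mathcal{N}\Leftrightarrow F[X]\in\mathcal{M}$ and $X\in\mathcal{M}\Leftrightarrow F[X]\in\mathcal{N}$, where $F[X]$ is the image of $X$ under $F$. *)

theory Defs
  imports "HOL-Analysis.Analysis"
begin

definition nowhere_dense :: "'a::topological_space set \<Rightarrow> bool" where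
  "nowhere_dense A \<longleftrightarrow> interior (closure A) = {}"

definition meager_sets :: "'a::topological_space set set" where
  "meager_sets =
     {X. \<exists>A :: nat \<Rightarrow> 'a set. (\<forall>n. nowhere_dense (A n)) \<and> X = (\<Union>n. A n)}"

(* No regularity condition is imposed: on a locally compact second countable
   Hausdorff space, every Borel measure that is finite on compact sets is regular. *)
definition haar_measure :: "'a::topological_ab_group_add measure \<Rightarrow> bool" where
  "haar_measure \<mu> \<longleftrightarrow>
     sets \<mu> = sets borel \<and>
     emeasure \<mu> UNIV \<noteq> 0 \<and>
     (\<forall>K. compact K \<longrightarrow> emeasure \<mu> K < \<infinity>) \<and>
     (\<forall>g. \<forall>A \<in> sets borel. emeasure \<mu> ((+) g ` A) = emeasure \<mu> A)"

(* The completion makes every subset of a Borel set of measure zero null. Haar measure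
   exists and is unique up to a positive factor, so the choice of \<mu> is immaterial. *)
definition haar_null_sets :: "'a::topological_ab_group_add set set" where
  "haar_null_sets = {X. \<exists>\<mu>. haar_measure \<mu> \<and> X \<in> null_sets (completion \<mu>)}"

definition erdos_sierpinski_mapping :: "('a::topological_ab_group_add \<Rightarrow> 'a) \<Rightarrow> bool" where
  "erdos_sierpinski_mapping F \<longleftrightarrow>
     bij F \<and>
     (\<forall>X. (X \<in> haar_null_sets \<longleftrightarrow> F ` X \<in> meager_sets) \<and>
          (X \<in> meager_sets \<longleftrightarrow> F ` X \<in> haar_null_sets))"

end

theory Submission
  imports Defs "HOL-Real_Asymp.Real_Asymp"
begin

text \<open>An ideal of subsets of an abelian group \<^emph>\<open>absorbs finitely many translates\<close> if every member \<open>X\<close> has a member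
\<open>Y\<close> such that for each finite set \<open>T\<close> a single \<open>t\<close> satisfies \<open>t + s + X \<subseteq> Y\<close> for all \<open>s \<in> T\<close>. The property mentions
only the group and the ideal, so an additive Erdos-Sierpinski mapping, being a group automorphism that carries the
null sets onto the meager sets, would transport it from one ideal to the other. The theorem holds because
the meager ideal has the property (\<open>meager_absorbs_translates\<close>) and the null ideal does not
(\<open>null_sets_not_absorbing\<close>).

For a meager \<open>X\<close> covered by compact nowhere dense sets \<open>C n\<close>, take for \<open>Y\<close> the complement of the limit superior of finite unions
of tiny balls around the first \<open>n\<close> points of a dense sequence. The balls of stage \<open>n\<close> must miss \<open>t + s + C n\<close> for all
\<open>s \<in> T\<close>; this excludes finitely many nowhere dense sets of values \<open>t\<close>. By compactness the size of the balls can be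
fixed in advance, independently of \<open>T\<close> (\<open>uniform_avoidance_translates\<close>), and \<open>t\<close> is a limit of nested choices.

For measure, let \<open>X\<close> be the limit superior of open sets \<open>U n\<close> of summable measure. If \<open>Y\<close> is null, choose a
self-supporting compact \<open>K\<close> disjoint from \<open>Y\<close>. Whenever \<open>X \<subseteq> c + Y\<close>, the translate \<open>c + K\<close> misses \<open>X\<close>, and by Baire's theorem
in \<open>K\<close> some relatively open piece \<open>K'\<close> of \<open>K\<close> has \<open>c + K'\<close> disjoint from \<open>U n\<close> for all large \<open>n\<close>. Hence the set of these \<open>c\<close> is a
countable union of sets \<open>D\<close> with \<open>D + K'\<close> disjoint from \<open>U n\<close> for all large \<open>n\<close>. The sets \<open>U n\<close> are built so that this forces \<open>D\<close>
to be thin: for a neighbourhood \<open>R\<close> of zero, \<open>D + R\<close> has measure at most a small multiple of \<open>(\<mu> R) powr (1/q)\<close>, with a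
fixed \<open>q\<close> (\<open>thinness_forcing_set\<close>). For random \<open>s\<^sub>1, \<dots>, s\<^sub>q\<close> the intersection of the sets \<open>D + R - s\<^sub>i\<close> then
has measure below \<open>\<mu> R\<close>, so it contains no translate of \<open>R\<close>, and no translate of \<open>{s\<^sub>1, \<dots>, s\<^sub>q}\<close> fits into \<open>D\<close>
(\<open>generic_translates\<close>).

The set \<open>U n\<close> is a union of translates of one small ball, centred at points that hit every sum \<open>S + L\<close> of two moderately large finite
sets after rounding to a net. To find such centres the net must not be too fine compared with the measure of the
ball. This needs balls of small measure and polynomially bounded doubling, which exist in every group
under consideration (\<open>polynomial_doubling_seminorm\<close>): the seminorm is the distance in square mean between translates of a function that is
itself an average of translates, and random sampling bounds its metric entropy by a power of the radius.\<close>

section \<open>Topological groups\<close>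

lemma open_vimage_uminus_plus:
  fixes S :: "'a::topological_ab_group_add set"
  assumes "open S"
  shows "open {x. a + x \<in> S}" "open {x. a - x \<in> S}" "open {x. x - a \<in> S}"
proof -
  have *: "open {x. f x \<in> S}" if "continuous_on UNIV f" for f :: "'a \<Rightarrow> 'a"
    using open_vimage[OF assms that] by (simp add: vimage_def)
  show "open {x. a + x \<in> S}" "open {x. a - x \<in> S}" "open {x. x - a \<in> S}"
    by (rule *, intro continuous_intros)+
qed

lemma zero_neighbourhood_sum:
  fixes N :: "'a::topological_ab_group_add set"
  assumes "open N" "0 \<in> N"
  shows "\<exists>V. open V \<and> 0 \<in> V \<and> (\<forall>a\<in>V. - a \<in> V) \<and> (\<forall>a\<in>V. \<forall>b\<in>V. a + b \<in> N)"
proof -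
  have "continuous_on UNIV (\<lambda>p::'a\<times>'a. fst p + snd p)" by (intro continuous_intros)
  then have "open ((\<lambda>p. fst p + snd p) -` N)" using assms open_vimage by blast
  moreover have "(0,0) \<in> (\<lambda>p. fst p + snd p) -` N" using assms by simp
  ultimately obtain A B where AB: "open A" "open B" "(0,0) \<in> A \<times> B" "A \<times> B \<subseteq> (\<lambda>p. fst p + snd p) -` N"
    by (rule open_prod_elim)
  let ?V = "A \<inter> B \<inter> {x. 0 - x \<in> A \<inter> B}"
  have "open ?V" using AB by (intro open_Int open_vimage_uminus_plus) auto
  moreover have "0 \<in> ?V" "\<forall>a\<in>?V. - a \<in> ?V" using AB by auto
  moreover have "a + b \<in> N" if "a \<in> ?V" "b \<in> ?V" for a b
  proof -
    have "(a, b) \<in> A \<times> B" using that by simp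
    then show ?thesis using AB(4) by auto
  qed
  ultimately show ?thesis by (intro exI[of _ ?V]) blast
qed

lemma zero_neighbourhood_sum4:
  fixes N :: "'a::topological_ab_group_add set"
  assumes "open N" "0 \<in> N"
  shows "\<exists>V. open V \<and> 0 \<in> V \<and> (\<forall>a\<in>V. - a \<in> V) \<and> V \<subseteq> N \<and> (\<forall>a\<in>V. \<forall>b\<in>V. a + b \<in> N) \<and>
    (\<forall>a\<in>V. \<forall>b\<in>V. \<forall>c\<in>V. \<forall>d\<in>V. a + b + c + d \<in> N)"
proof -
  obtain V where V: "open V" "0 \<in> V" "\<forall>a\<in>V. \<forall>b\<in>V. a + b \<in> N"
    using zero_neighbourhood_sum[OF assms] by blast
  obtain W where W: "open W" "0 \<in> W" "\<forall>a\<in>W. -a \<in> W" "\<forall>a\<in>W. \<forall>b\<in>W. a + b \<in> V"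
    using zero_neighbourhood_sum[OF V(1,2)] by blast
  have sub: "a \<in> V" if "a \<in> W" for a using W(4)[rule_format, OF that W(2)] by simp
  have sub2: "a \<in> N" if "a \<in> V" for a using V(3)[rule_format, OF that V(2)] by simp
  have "a + b + c + d \<in> N" if "a \<in> W" "b \<in> W" "c \<in> W" "d \<in> W" for a b c d
    using V(3)[rule_format, of "a+b" "c+d"] W(4) that by (simp add: add.assoc)
  then show ?thesis using sub sub2 V(3) W(1-3)
    by (intro exI[of _ W] conjI ballI subsetI) (simp_all only:)
qed

lemma compact_minus_image:
  fixes K L :: "'a::topological_ab_group_add set"
  assumes "compact K" "compact L"
  shows "compact {k - l | k l. k \<in> K \<and> l \<in> L}" "compact {k + l | k l. k \<in> K \<and> l \<in> L}"
proof -
  have *: "compact (f ` (K \<times> L))" if "continuous_on UNIV f" for f :: "'a \<times> 'a \<Rightarrow> 'a"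
    by (intro compact_continuous_image compact_Times assms continuous_on_subset[OF that]) auto
  have "compact ((\<lambda>p. fst p - snd p) ` (K \<times> L))" "compact ((\<lambda>p. fst p + snd p) ` (K \<times> L))"
    by (rule *, intro continuous_intros)+
  moreover have "(\<lambda>p. f (fst p) (snd p)) ` (K \<times> L) = {f k l | k l. k \<in> K \<and> l \<in> L}"
    for f :: "'a \<Rightarrow> 'a \<Rightarrow> 'a" by (auto simp: image_def)
  ultimately show "compact {k - l | k l. k \<in> K \<and> l \<in> L}" "compact {k + l | k l. k \<in> K \<and> l \<in> L}" by simp_all
qed

lemma zero_neighbourhood_in_compact:
  assumes "locally_compact_space (euclidean :: 'a::topological_ab_group_add topology)"
  obtains U K where "open U" "compact K" "(0::'a) \<in> U" "U \<subseteq> K"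
proof -
  have "\<exists>U K. open U \<and> compact K \<and> (0::'a) \<in> U \<and> U \<subseteq> K"
    using assms unfolding locally_compact_space_def by auto
  then show ?thesis using that by blast
qed

lemma compact_exhaustion:
  assumes "locally_compact_space (euclidean :: 'a::{polish_space, topological_ab_group_add} topology)"
  shows "\<exists>C :: nat \<Rightarrow> 'a set. (\<forall>n. compact (C n) \<and> 0 \<in> C n) \<and> incseq C \<and> (\<Union>n. C n) = UNIV"
proof -
  let ?F = "{U :: 'a set. open U \<and> (\<exists>K. compact K \<and> U \<subseteq> K)}"
  obtain F' where F': "F' \<subseteq> ?F" "countable F'" "\<Union>F' = \<Union>?F" using Lindelof[of ?F] by auto
  have "\<And>x. \<exists>U K. open U \<and> compact K \<and> (x::'a) \<in> U \<and> U \<subseteq> K"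
    using assms unfolding locally_compact_space_def by auto
  then have "\<Union>?F = UNIV" by blast
  have ne: "F' \<noteq> {}" using F' \<open>\<Union>?F = UNIV\<close> by auto
  have "\<forall>n. \<exists>K. compact K \<and> from_nat_into F' n \<subseteq> K" using from_nat_into[OF ne] F'(1) by blast
  then obtain K where "\<forall>n. compact (K n) \<and> from_nat_into F' n \<subseteq> K n" by (rule choice[THEN exE])
  then have K: "compact (K n)" "from_nat_into F' n \<subseteq> K n" for n by auto
  let ?C = "\<lambda>n. insert 0 (\<Union>i\<le>n. K i)"
  show ?thesis
  proof (intro exI[of _ ?C] conjI allI)
    have "x \<in> (\<Union>n. ?C n)" for x
    proof -
      have "x \<in> \<Union>F'" using F' \<open>\<Union>?F = UNIV\<close> by auto
      then obtain n where "x \<in> from_nat_into F' n" using from_nat_into_surj[OF F'(2)] by blast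
      then have "x \<in> ?C n" using K(2)[of n] by auto
      then show ?thesis by blast
    qed
    then show "(\<Union>n. ?C n) = UNIV" by blast
    show "incseq ?C" by (rule incseq_SucI) (auto simp: atMost_Suc)
    show "compact (?C n)" "0 \<in> ?C n" for n using K(1) by (auto intro!: compact_UN compact_insert)
  qed
qed

section \<open>Meager sets absorb finitely many translates\<close>

lemma meager_sets_iff: "X \<in> meager_sets \<longleftrightarrow> (\<exists>A :: nat \<Rightarrow> _. (\<forall>n. nowhere_dense (A n)) \<and> X \<subseteq> (\<Union>n. A n))"
proof
  assume "\<exists>A :: nat \<Rightarrow> _. (\<forall>n. nowhere_dense (A n)) \<and> X \<subseteq> (\<Union>n. A n)"
  then obtain A :: "nat \<Rightarrow> _" where A: "\<And>n. nowhere_dense (A n)" "X \<subseteq> (\<Union>n. A n)" by blast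
  have "nowhere_dense (A n \<inter> X)" for n
    using A(1)[of n] interior_mono[OF closure_mono[of "A n \<inter> X" "A n"]] by (auto simp: nowhere_dense_def)
  moreover have "X = (\<Union>n. A n \<inter> X)" using A(2) by auto
  ultimately show "X \<in> meager_sets" unfolding meager_sets_def
    by (intro CollectI exI[of _ "\<lambda>n. A n \<inter> X"]) auto
qed (unfold meager_sets_def, blast)

lemma interior_finite_Union_closed:
  assumes "finite F" "\<And>S. S \<in> F \<Longrightarrow> closed S \<and> interior S = {}"
  shows "interior (\<Union>F) = {}"
  using assms
proof (induction F)
  case (insert S F)
  then show ?case using interior_closed_Un_empty_interior[of S "\<Union>F"] by auto
qed auto

lemma meager_subset_compacts:
  fixes X :: "'a::{polish_space, topological_ab_group_add} set"
  assumes lc: "locally_compact_space (euclidean :: 'a topology)" and X: "X \<in> meager_sets"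
  shows "\<exists>C :: nat \<Rightarrow> 'a set. (\<forall>n. compact (C n) \<and> interior (C n) = {}) \<and> incseq C \<and> X \<subseteq> (\<Union>n. C n)"
proof -
  obtain A :: "nat \<Rightarrow> _" where A: "\<And>n. nowhere_dense (A n)" "X \<subseteq> (\<Union>n. A n)" using X unfolding meager_sets_iff by blast
  obtain Q :: "nat \<Rightarrow> 'a set" where Q: "\<forall>n. compact (Q n) \<and> 0 \<in> Q n" "(\<Union>n. Q n) = UNIV"
    using compact_exhaustion[OF lc] by (elim exE conjE) (rule that)
  let ?D = "\<lambda>p. closure (A (fst (prod_decode p))) \<inter> Q (snd (prod_decode p))"
  have D: "compact (?D p)" "interior (?D p) = {}" for p
    using Q A(1) by (auto simp: nowhere_dense_def)
  show ?thesis
  proof (intro exI[of _ "\<lambda>n. \<Union>p\<le>n. ?D p"] conjI allI)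
    show "compact (\<Union>p\<le>n. ?D p)" for n using D by (intro compact_UN) auto
    show "interior (\<Union>p\<le>n. ?D p) = {}" for n
      by (rule interior_finite_Union_closed) (use D in \<open>auto intro: compact_imp_closed\<close>)
    show "incseq (\<lambda>n. \<Union>p\<le>n. ?D p)" by (rule incseq_SucI) (auto simp: atMost_Suc)
    show "X \<subseteq> (\<Union>n. \<Union>p\<le>n. ?D p)"
    proof
      fix x assume "x \<in> X"
      then obtain n m where "x \<in> A n" "x \<in> Q m" using A(2) Q(2) by blast
      then have "x \<in> ?D (prod_encode (n,m))" using closure_subset by auto
      then show "x \<in> (\<Union>n. \<Union>p\<le>n. ?D p)" by blast
    qed
  qed
qed

text \<open>The point is that \<open>N'\<close> does not depend on \<open>s\<close>. After shrinking \<open>N\<close> to a set \<open>M\<close> inside a compact \<open>K\<close>, the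
translates of \<open>E\<close> that meet \<open>M\<close> have their \<open>s\<close> in the compact set \<open>K - E\<close>. A choice of \<open>y\<close> that works for one \<open>s\<close> works
with some room for all nearby values, so finitely many choices suffice; for all other \<open>s\<close> the centre \<open>y = 0\<close> works.\<close>

lemma uniform_avoidance_one_translate:
  fixes E N :: "'a::{polish_space, topological_ab_group_add} set"
  assumes lc: "locally_compact_space (euclidean :: 'a topology)"
    and E: "compact E" "interior E = {}" and N: "open N" "0 \<in> N"
  shows "\<exists>N'. open N' \<and> 0 \<in> N' \<and> N' \<subseteq> N \<and>
    (\<forall>s. \<exists>y. (\<forall>a\<in>N'. y + a \<in> N) \<and> (\<forall>a\<in>N'. \<forall>b\<in>N'. y + a + b - s \<notin> E))"
proof -
  obtain U K where UK: "open U" "compact K" "(0::'a) \<in> U" "U \<subseteq> K" using zero_neighbourhood_in_compact[OF lc] .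
  define M where "M = N \<inter> U"
  have M: "open M" "0 \<in> M" "M \<subseteq> N" "M \<subseteq> K" using UK N by (auto simp: M_def)
  define S where "S = {k - l | k l. k \<in> K \<and> l \<in> E}"
  have "compact S" unfolding S_def by (rule compact_minus_image(1)[OF UK(2) E(1)])
  have "\<exists>V y. open V \<and> 0 \<in> V \<and> (\<forall>a\<in>V. y + a \<in> M) \<and>
      (\<forall>a\<in>V. \<forall>b\<in>V. \<forall>c\<in>V. y + a + b - (s + c) \<notin> E)" for s
  proof -
    have "open {x. s + x \<in> M}" using open_vimage_uminus_plus M by auto
    moreover have "-s \<in> {x. s + x \<in> M}" using M by simp
    ultimately have "\<not> {x. s + x \<in> M} \<subseteq> E" using E(2) by (metis emptyE interiorI)
    then obtain z where z: "s + z \<in> M" "z \<notin> E" by auto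
    have "open {x. (s+z) + x \<in> M}" "open {x. z + x \<in> - E}"
      using open_vimage_uminus_plus(1)[OF M(1)]
        open_vimage_uminus_plus(1)[OF open_Compl[OF compact_imp_closed[OF E(1)]]] by blast+
    then have "open ({x. (s+z) + x \<in> M} \<inter> {x. z + x \<in> - E})" by (rule open_Int)
    moreover have "0 \<in> {x. (s+z) + x \<in> M} \<inter> {x. z + x \<in> - E}" using z by simp
    ultimately obtain V where V: "open V" "0 \<in> V" "\<forall>a\<in>V. -a \<in> V"
      "V \<subseteq> {x. (s+z) + x \<in> M} \<inter> {x. z + x \<in> - E}"
      "\<forall>a\<in>V. \<forall>b\<in>V. \<forall>c\<in>V. \<forall>d\<in>V. a + b + c + d \<in> {x. (s+z) + x \<in> M} \<inter> {x. z + x \<in> - E}"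
      using zero_neighbourhood_sum4[of "{x. (s+z) + x \<in> M} \<inter> {x. z + x \<in> - E}"] by blast
    have "(s+z) + a + b - (s + c) \<notin> E" if "a \<in> V" "b \<in> V" "c \<in> V" for a b c
      using V(5)[rule_format, of a b "-c" 0] V(2,3) that by (simp add: algebra_simps)
    moreover have "\<forall>a\<in>V. (s+z) + a \<in> M" using V(4) by blast
    ultimately show ?thesis using V(1,2) by (intro exI[of _ V] exI[of _ "s+z"]) blast
  qed
  then obtain V y where V: "\<And>s. open (V s)" "\<And>s. 0 \<in> V s" "\<And>s a. a \<in> V s \<Longrightarrow> y s + a \<in> M"
    "\<And>s a b c. a \<in> V s \<Longrightarrow> b \<in> V s \<Longrightarrow> c \<in> V s \<Longrightarrow> y s + a + b - (s + c) \<notin> E" by metis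
  have "open {x. x - s \<in> V s}" for s by (rule open_vimage_uminus_plus(3)[OF V(1)])
  moreover have "S \<subseteq> (\<Union>s\<in>S. {x. x - s \<in> V s})" using V(2) by auto
  ultimately obtain I where I: "I \<subseteq> S" "finite I" "S \<subseteq> (\<Union>s\<in>I. {x. x - s \<in> V s})"
    by (rule compactE_image[OF \<open>compact S\<close>, of S])
  obtain V0 where V0: "open V0" "0 \<in> V0" "\<forall>a\<in>V0. \<forall>b\<in>V0. a + b \<in> M"
    using zero_neighbourhood_sum[OF M(1,2)] by blast
  have V0M: "a \<in> M" if "a \<in> V0" for a using V0(3)[rule_format, OF that V0(2)] by simp
  define N' where "N' = V0 \<inter> (\<Inter>s\<in>I. V s)"
  show ?thesis
  proof (intro exI[of _ N'] conjI allI)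
    show "open N'" unfolding N'_def using V0(1) V(1) I(2) by (intro open_Int open_INT) auto
    show "0 \<in> N'" "N' \<subseteq> N" using V0(2) V(2) V0M M(3) by (auto simp: N'_def)
    fix s
    show "\<exists>y. (\<forall>a\<in>N'. y + a \<in> N) \<and> (\<forall>a\<in>N'. \<forall>b\<in>N'. y + a + b - s \<notin> E)"
    proof (cases "s \<in> S")
      case True
      then obtain r where r: "r \<in> I" "s - r \<in> V r" using I by blast
      have "y r + a + b - s \<notin> E" if "a \<in> N'" "b \<in> N'" for a b
        using V(4)[of a r b "s - r"] r that by (auto simp: N'_def)
      moreover have "y r + a \<in> N" if "a \<in> N'" for a using V(3)[of a r] that r M(3) by (auto simp: N'_def)
      ultimately show ?thesis by blast
    next
      case False
      have "a + b - s \<notin> E" if "a \<in> N'" "b \<in> N'" for a b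
      proof
        assume "a + b - s \<in> E"
        moreover have "a + b \<in> K" using that V0(3)[rule_format, of a b] M(4) by (auto simp: N'_def)
        ultimately have "s \<in> S" unfolding S_def by (intro CollectI exI[of _ "a+b"] exI[of _ "a+b-s"]) auto
        then show False using False by simp
      qed
      then show ?thesis using V0M M(3) by (intro exI[of _ 0]) (auto simp: N'_def)
    qed
  qed
qed

text \<open>Only the number of translates enters into the size of \<open>N'\<close>, not the translates themselves. This is what allows the
meager set absorbing all translates to be fixed before the finite set of translations is known.\<close>

lemma uniform_avoidance_translates:
  fixes E N :: "'a::{polish_space, topological_ab_group_add} set"
  assumes lc: "locally_compact_space (euclidean :: 'a topology)"
    and E: "compact E" "interior E = {}" and N: "open N" "0 \<in> N"
  shows "\<exists>N'. open N' \<and> 0 \<in> N' \<and> N' \<subseteq> N \<and>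
    (\<forall>ss. length ss \<le> n \<longrightarrow>
       (\<exists>y. (\<forall>a\<in>N'. y + a \<in> N) \<and> (\<forall>s\<in>set ss. \<forall>a\<in>N'. \<forall>b\<in>N'. y + a + b - s \<notin> E)))"
proof (induction n)
  case 0
  then show ?case using N by (intro exI[of _ N]) (auto intro: exI[of _ 0])
next
  case (Suc n)
  then obtain N1 where N1: "open N1" "0 \<in> N1" "N1 \<subseteq> N"
    and y1: "\<And>ss. length ss \<le> n \<Longrightarrow>
       \<exists>y. (\<forall>a\<in>N1. y + a \<in> N) \<and> (\<forall>s\<in>set ss. \<forall>a\<in>N1. \<forall>b\<in>N1. y + a + b - s \<notin> E)" by blast
  obtain N2 where N2: "open N2" "0 \<in> N2" "N2 \<subseteq> N1"
    and y2: "\<And>s. \<exists>y. (\<forall>a\<in>N2. y + a \<in> N1) \<and> (\<forall>a\<in>N2. \<forall>b\<in>N2. y + a + b - s \<notin> E)"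
    using uniform_avoidance_one_translate[OF lc E N1(1,2)] by (elim exE conjE) blast
  have avoid: "\<exists>y. (\<forall>a\<in>N2. y + a \<in> N) \<and> (\<forall>s\<in>set ss. \<forall>a\<in>N2. \<forall>b\<in>N2. y + a + b - s \<notin> E)"
    if "length ss \<le> Suc n" for ss
  proof (cases ss)
    case Nil
    then show ?thesis using N1 N2 by (intro exI[of _ 0]) auto
  next
    case (Cons s ss')
    then obtain y where y: "\<forall>a\<in>N1. y + a \<in> N" "\<forall>s\<in>set ss'. \<forall>a\<in>N1. \<forall>b\<in>N1. y + a + b - s \<notin> E"
      using y1[of ss'] \<open>length ss \<le> Suc n\<close> by auto
    obtain z where z: "\<forall>a\<in>N2. z + a \<in> N1" "\<forall>a\<in>N2. \<forall>b\<in>N2. z + a + b - (s - y) \<notin> E"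
      using y2 by blast
    have "y + z + a + b - r \<notin> E" if "r \<in> set ss" "a \<in> N2" "b \<in> N2" for r a b
    proof (cases "r = s")
      case True
      then show ?thesis using z(2) that by (force simp: algebra_simps)
    next
      case False
      then have "y + (z + a) + b - r \<notin> E" using y(2) z(1) that Cons N2 by auto
      then show ?thesis by (simp add: algebra_simps)
    qed
    moreover have "y + z + a \<in> N" if "a \<in> N2" for a
      using y(1) z(1) that by (simp add: add.assoc)
    ultimately show ?thesis by blast
  qed
  show ?case
  proof (intro exI[of _ N2] conjI allI impI)
    show "N2 \<subseteq> N" using N1(3) N2(3) by (rule subset_trans[rotated])
  qed (fact N2(1,2) avoid)+
qed

text \<open>The neighbourhoods \<open>N n\<close> depend on \<open>X\<close> alone, and so does \<open>Y\<close>. Given a finite \<open>T\<close>, stage \<open>n\<close> can handle lists of length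
at most \<open>n\<close>, so all of \<open>T\<close> is treated from some stage onwards; finitely many stages do not matter because \<open>Y\<close> is the complement of a
limit superior.\<close>

theorem meager_absorbs_translates:
  fixes X :: "'a::{polish_space, topological_ab_group_add} set"
  assumes lc: "locally_compact_space (euclidean :: 'a topology)" and X: "X \<in> meager_sets"
  shows "\<exists>Y\<in>meager_sets. \<forall>T. finite T \<longrightarrow> (\<exists>t. \<forall>s\<in>T. \<forall>x\<in>X. t + s + x \<in> Y)"
proof -
  obtain C where C0: "\<forall>n::nat. compact (C n) \<and> interior (C n) = {}" and C: "incseq C" "X \<subseteq> (\<Union>n. C n)"
    using meager_subset_compacts[OF lc X] by (elim exE conjE) (rule that)
  obtain D :: "'a set" where D: "countable D" "\<And>S. open S \<Longrightarrow> S \<noteq> {} \<Longrightarrow> \<exists>d\<in>D. d \<in> S"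
    using countable_dense_exists by blast
  define p where "p = from_nat_into D"
  have "D \<noteq> {}" using D(2)[of UNIV] by auto
  then have p: "\<exists>i. p i \<in> S" if "open S" "S \<noteq> {}" for S
    using D(2)[OF that] from_nat_into_surj[OF D(1)] unfolding p_def by metis
  define E where "E n = (\<Union>i\<le>n. (\<lambda>x. p i - x) ` C n)" for n
  have ptC: "compact ((\<lambda>x. c - x) ` C n)" "interior ((\<lambda>x. c - x) ` C n) = {}" for c n
  proof -
    show "compact ((\<lambda>x. c - x) ` C n)" by (intro compact_continuous_image continuous_intros C0[rule_format, THEN conjunct1])
    have "S = {}" if S: "open S" "S \<subseteq> (\<lambda>x. c - x) ` C n" for S
    proof -
      have "open {x. c - x \<in> S}" using open_vimage_uminus_plus S by blast
      moreover have "{x. c - x \<in> S} \<subseteq> C n" using S(2) by fastforce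
      ultimately have e: "{x. c - x \<in> S} = {}" using C0 interior_maximal[of "{x. c - x \<in> S}" "C n"] by simp
      have "c - s \<in> {x. c - x \<in> S}" if "s \<in> S" for s using that by simp
      then show ?thesis using e by blast
    qed
    then show "interior ((\<lambda>x. c - x) ` C n) = {}" using interior_subset open_interior by blast
  qed
  have E: "compact (E n)" "interior (E n) = {}" for n
  proof -
    show "compact (E n)" unfolding E_def using ptC by (intro compact_UN) auto
    show "interior (E n) = {}" unfolding E_def
      by (rule interior_finite_Union_closed) (use ptC in \<open>auto intro: compact_imp_closed\<close>)
  qed
  obtain U K where UK: "open U" "compact K" "(0::'a) \<in> U" "U \<subseteq> K" using zero_neighbourhood_in_compact[OF lc] .
  define good :: "nat \<Rightarrow> 'a set \<Rightarrow> 'a set \<Rightarrow> bool" where "good n M M' \<longleftrightarrow> (\<forall>ss. length ss \<le> n \<longrightarrow>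
       (\<exists>y. (\<forall>a\<in>closure M'. y + a \<in> M) \<and> (\<forall>s\<in>set ss. \<forall>a\<in>closure M'. \<forall>b\<in>M'. y + a + b - s \<notin> E n)))"
    for n M M'
  have "\<exists>N. \<forall>n. (open (N n) \<and> 0 \<in> N n \<and> N n \<subseteq> U) \<and> (closure (N (Suc n)) \<subseteq> N n \<and> good n (N n) (N (Suc n)))"
  proof (rule dependent_nat_choice)
    show "\<exists>x. open x \<and> 0 \<in> x \<and> x \<subseteq> U" using UK by blast
  next
    fix M n assume M: "open M \<and> 0 \<in> M \<and> M \<subseteq> U"
    then obtain N' where N': "open N'" "0 \<in> N'" "N' \<subseteq> M" "\<And>ss. length ss \<le> n \<Longrightarrow>
       (\<exists>y. (\<forall>a\<in>N'. y + a \<in> M) \<and> (\<forall>s\<in>set ss. \<forall>a\<in>N'. \<forall>b\<in>N'. y + a + b - s \<notin> E n))"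
      using uniform_avoidance_translates[OF lc E, of M n n] by blast
    obtain e where e: "e > 0" "cball 0 e \<subseteq> N'" using N' open_contains_cball by metis
    have cl: "closure (ball 0 e) \<subseteq> N'" using e closure_minimal[OF ball_subset_cball closed_cball] by blast
    have "good n M (ball 0 e)" unfolding good_def
      using N'(4) cl closure_subset[of "ball 0 e"] by (meson subset_iff)
    then show "\<exists>y. (open y \<and> 0 \<in> y \<and> y \<subseteq> U) \<and> closure y \<subseteq> M \<and> good n M y"
      using e(1) cl N'(3) M closure_subset[of "ball (0::'a) e"] by (intro exI[of _ "ball 0 e"]) auto
  qed
  then obtain N where N: "N 0 \<subseteq> U" "\<And>n. open (N n)" "\<And>n. 0 \<in> N n" "\<And>n. closure (N (Suc n)) \<subseteq> N n"
      "\<And>n. good n (N n) (N (Suc n))" by blast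
  define Z where "Z n = {x. \<exists>i\<le>n. p i - x \<in> N (Suc n)}" for n
  have "open (Z n)" for n
  proof -
    have "Z n = (\<Union>i\<le>n. {x. p i - x \<in> N (Suc n)})" by (auto simp: Z_def)
    then show ?thesis using open_vimage_uminus_plus(2)[OF N(2)] by auto
  qed
  define Y where "Y = (\<Union>m. - (\<Union>n\<in>{m..}. Z n))"
  have "nowhere_dense (- (\<Union>n\<in>{m..}. Z n))" for m
  proof -
    have "closed (- (\<Union>n\<in>{m..}. Z n))" using \<open>\<And>n. open (Z n)\<close> by auto
    moreover have "interior (- (\<Union>n\<in>{m..}. Z n)) = {}"
    proof (rule ccontr)
      assume "interior (- (\<Union>n\<in>{m..}. Z n)) \<noteq> {}"
      then obtain i where "p i \<in> interior (- (\<Union>n\<in>{m..}. Z n))" using p open_interior by blast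
      then have "p i \<notin> Z (max i m)" using interior_subset by force
      moreover have "p i \<in> Z (max i m)" unfolding Z_def
        by (intro CollectI exI[of _ i]) (use N(3) in simp)
      ultimately show False by blast
    qed
    ultimately show ?thesis by (simp add: nowhere_dense_def)
  qed
  then have "Y \<in> meager_sets" unfolding meager_sets_def Y_def
    by (intro CollectI exI[of _ "\<lambda>m. - (\<Union>n\<in>{m..}. Z n)"] conjI allI) auto
  moreover have "\<exists>t. \<forall>s\<in>T. \<forall>x\<in>X. t + s + x \<in> Y" if T: "finite T" for T
  proof -
    obtain ts where ts: "set ts = T" using T finite_list by blast
    \<comment> \<open>\<open>r n\<close> is the centre of the nested sets at stage \<open>n\<close>; the list passed to \<open>good\<close> is shifted by the current centre.\<close>
    have "\<exists>r. \<forall>n. True \<and> ((\<forall>a\<in>closure (N (Suc n)). r (Suc n) + a - r n \<in> N n) \<and>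
       (length ts \<le> n \<longrightarrow> (\<forall>s\<in>T. \<forall>a\<in>closure (N (Suc n)). \<forall>b\<in>N (Suc n). r (Suc n) + a + b + s \<notin> E n)))"
    proof (rule dependent_nat_choice)
      fix c :: 'a and n :: nat
      define ss where "ss = (if length ts \<le> n then map (\<lambda>s. - s - c) ts else [])"
      have "length ss \<le> n" by (simp add: ss_def)
      then obtain y where y: "\<And>a. a\<in>closure (N (Suc n)) \<Longrightarrow> y + a \<in> N n"
       "\<And>s a b. s\<in>set ss \<Longrightarrow> a\<in>closure (N (Suc n)) \<Longrightarrow> b\<in>N (Suc n) \<Longrightarrow> y + a + b - s \<notin> E n"
        using N(5)[of n] unfolding good_def by blast
      have "c + y + a + b + s \<notin> E n" if "length ts \<le> n" "s \<in> T" "a\<in>closure (N (Suc n))" "b\<in>N (Suc n)" for s a b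
      proof -
        have "- s - c \<in> set ss" using that ts by (auto simp: ss_def)
        then have "y + a + b - (- s - c) \<notin> E n" using y(2) that by blast
        then show ?thesis by (simp add: algebra_simps)
      qed
      then show "\<exists>r'. True \<and> ((\<forall>a\<in>closure (N (Suc n)). r' + a - c \<in> N n) \<and>
       (length ts \<le> n \<longrightarrow> (\<forall>s\<in>T. \<forall>a\<in>closure (N (Suc n)). \<forall>b\<in>N (Suc n). r' + a + b + s \<notin> E n)))"
        using y(1) by (intro exI[of _ "c + y"]) (auto simp: algebra_simps)
    qed simp
    then obtain r where r: "\<And>n a. a\<in>closure (N (Suc n)) \<Longrightarrow> r (Suc n) + a - r n \<in> N n"
       "\<And>n s a b. length ts \<le> n \<Longrightarrow> s\<in>T \<Longrightarrow> a\<in>closure (N (Suc n)) \<Longrightarrow> b\<in>N (Suc n) \<Longrightarrow> r (Suc n) + a + b + s \<notin> E n"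
      by blast
    define A where "A n = (+) (r n) ` closure (N n)" for n
    have clK: "closure (N n) \<subseteq> closure (N 0)" for n
    proof (induction n)
      case (Suc n)
      then show ?case using N(4)[of n] closure_subset by blast
    qed simp
    have "closure (N 0) \<subseteq> K" using UK N(1) compact_imp_closed closure_minimal[of "N 0" K] by blast
    then have "closure (N n) \<subseteq> K" for n using clK by blast
    then have "compact (closure (N n))" for n using UK(2) closed_closure compact_Int_closed[of K "closure (N n)"]
      by (simp add: Int_absorb1)
    then have cA: "compact (A n)" for n unfolding A_def by (intro compact_continuous_image continuous_intros)
    have neA: "A n \<noteq> {}" for n using N(3)[of n] closure_subset by (auto simp: A_def)
    have "A (Suc n) \<subseteq> A n" for n
    proof
      fix x assume "x \<in> A (Suc n)"
      then obtain a where a: "a \<in> closure (N (Suc n))" "x = r (Suc n) + a"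
        by (auto simp: A_def)
      then have "x - r n \<in> closure (N n)" using r(1) closure_subset by auto
      then show "x \<in> A n" unfolding A_def by (rule image_eqI[rotated]) simp
    qed
    then have decA: "A n \<subseteq> A m" if "m \<le> n" for m n using lift_Suc_antimono_le[of A] that by blast
    have "A 0 \<inter> (\<Inter>n. A n) \<noteq> {}"
    proof (rule compact_imp_fip_image)
      fix I :: "nat set" assume "finite I"
      then have "A (Max (insert 0 I)) \<subseteq> A i" if "i \<in> insert 0 I" for i
        using decA[OF Max_ge[OF _ that]] by simp
      then have "A (Max (insert 0 I)) \<subseteq> A 0 \<inter> (\<Inter>n\<in>I. A n)" by blast
      then show "A 0 \<inter> (\<Inter>n\<in>I. A n) \<noteq> {}" using neA by blast
    qed (rule cA, rule compact_imp_closed[OF cA])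
    then obtain t where t: "\<And>n. t \<in> A n" by auto
    have "\<forall>s\<in>T. \<forall>x\<in>X. t + s + x \<in> Y"
    proof (intro ballI)
      fix s x assume s: "s \<in> T" and "x \<in> X"
      then obtain m where m: "x \<in> C m" using C(2) by blast
      have "t + s + x \<notin> Z n" if n: "n \<ge> max m (length ts)" for n
      proof
        assume "t + s + x \<in> Z n"
        then obtain i where i: "i \<le> n" "p i - (t + s + x) \<in> N (Suc n)" by (auto simp: Z_def)
        obtain a where a: "a \<in> closure (N (Suc n))" "t = r (Suc n) + a"
          using t[of "Suc n"] by (auto simp: A_def)
        have "x \<in> C n" using m C(1) n by (auto simp: incseq_def)
        then have "p i - x \<in> E n" using i by (auto simp: E_def)
        moreover have "r (Suc n) + a + (p i - (t + s + x)) + s = p i - x" using a by (simp add: algebra_simps)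
        ultimately show False using r(2)[OF _ s a(1) i(2)] n by auto
      qed
      then show "t + s + x \<in> Y" unfolding Y_def by blast
    qed
    then show ?thesis by blast
  qed
  ultimately show ?thesis by blast
qed

section \<open>Haar measure\<close>

lemma borel_measurable_group_diff[measurable (raw)]:
  fixes f g :: "'b \<Rightarrow> 'a::{second_countable_topology, topological_ab_group_add}"
  assumes "f \<in> borel_measurable M" "g \<in> borel_measurable M"
  shows "(\<lambda>x. f x - g x) \<in> borel_measurable M"
  using assms by (rule borel_measurable_continuous_Pair) (intro continuous_intros)

lemma haar_measure_sigma_finite:
  fixes \<mu> :: "'a::{polish_space, topological_ab_group_add} measure"
  assumes "haar_measure \<mu>" "locally_compact_space (euclidean :: 'a topology)"
  shows "sigma_finite_measure \<mu>"
proof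
  obtain C :: "nat \<Rightarrow> 'a set" where C: "\<forall>n. compact (C n) \<and> 0 \<in> C n" "(\<Union>n. C n) = UNIV"
    using compact_exhaustion[OF assms(2)] by (elim exE conjE) (rule that)
  have S: "sets \<mu> = sets borel" using assms(1) by (simp add: haar_measure_def)
  then have "space \<mu> = UNIV" using sets_eq_imp_space_eq[OF S] by simp
  moreover have "range C \<subseteq> sets \<mu>" using C(1) S by (auto intro: borel_closed compact_imp_closed)
  moreover have "emeasure \<mu> (C n) \<noteq> \<infinity>" for n using C(1) assms(1) by (simp add: haar_measure_def less_top)
  ultimately show "\<exists>A. countable A \<and> A \<subseteq> sets \<mu> \<and> \<Union> A = space \<mu> \<and> (\<forall>a\<in>A. emeasure \<mu> a \<noteq> \<infinity>)"
    using C(2) by (intro exI[of _ "range C"]) auto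
qed

locale haar_group =
  fixes \<mu> :: "'a::{polish_space, topological_ab_group_add} measure"
  assumes haar: "haar_measure \<mu>"
    and locally_compact: "locally_compact_space (euclidean :: 'a topology)"

sublocale haar_group \<subseteq> sigma_finite_measure \<mu>
  by (rule haar_measure_sigma_finite[OF haar locally_compact])

sublocale haar_group \<subseteq> pair: pair_sigma_finite \<mu> \<mu> ..

context haar_group
begin

lemma sets_haar[simp, measurable_cong]: "sets \<mu> = sets borel"
  using haar by (simp add: haar_measure_def)

lemma space_haar[simp]: "space \<mu> = UNIV"
  using sets_eq_imp_space_eq[OF sets_haar] by simp

lemma emeasure_compact: "compact K \<Longrightarrow> emeasure \<mu> K < \<infinity>"
  using haar by (simp add: haar_measure_def)

lemma emeasure_subset_compact: "compact K \<Longrightarrow> A \<subseteq> K \<Longrightarrow> emeasure \<mu> A < \<infinity>"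
  using emeasure_mono[of A K \<mu>] emeasure_compact[of K]
  by (auto simp: borel_closed compact_imp_closed intro: le_less_trans)

lemma emeasure_translate: "A \<in> sets borel \<Longrightarrow> emeasure \<mu> ((+) g ` A) = emeasure \<mu> A"
  using haar by (simp add: haar_measure_def)

lemma translate_eq: "(+) g ` A = {x. x - g \<in> A}" for g :: 'a
  by (auto intro!: image_eqI[of _ _ "_ - g"])

lemma emeasure_translate_vimage:
  assumes "A \<in> sets borel"
  shows "emeasure \<mu> {x. x - g \<in> A} = emeasure \<mu> A" "emeasure \<mu> {x. g + x \<in> A} = emeasure \<mu> A"
  using emeasure_translate[OF assms, of g] emeasure_translate[OF assms, of "- g"]
  unfolding translate_eq by (simp_all add: add.commute)

lemma distr_translate: "distr \<mu> borel ((+) g) = \<mu>"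
proof (rule measure_eqI)
  show "emeasure (distr \<mu> borel ((+) g)) A = emeasure \<mu> A" if "A \<in> sets (distr \<mu> borel ((+) g))" for A
    using that emeasure_translate_vimage(2)[of A g] by (simp add: emeasure_distr vimage_def)
qed simp

lemma nn_integral_translate:
  assumes [measurable]: "f \<in> borel_measurable borel"
  shows "(\<integral>\<^sup>+x. f (g + x) \<partial>\<mu>) = (\<integral>\<^sup>+x. f x \<partial>\<mu>)"
proof -
  have "(\<integral>\<^sup>+x. f x \<partial>\<mu>) = (\<integral>\<^sup>+x. f x \<partial>(distr \<mu> borel ((+) g)))" by (simp only: distr_translate)
  also have "\<dots> = (\<integral>\<^sup>+x. f (g + x) \<partial>\<mu>)" by (subst nn_integral_distr) auto
  finally show ?thesis by simp
qed

lemma integral_translate: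
  fixes f :: "'a \<Rightarrow> real"
  assumes [measurable]: "f \<in> borel_measurable borel"
  shows "(\<integral>x. f (x - g) \<partial>\<mu>) = (\<integral>x. f x \<partial>\<mu>)"
proof -
  have "(\<integral>x. f x \<partial>\<mu>) = (\<integral>x. f x \<partial>(distr \<mu> borel ((+) (- g))))" by (simp only: distr_translate)
  also have "\<dots> = (\<integral>x. f (- g + x) \<partial>\<mu>)" by (subst integral_distr) auto
  finally show ?thesis by simp
qed

text \<open>The overlap of \<open>x + A\<close> with \<open>B\<close>, integrated over \<open>x\<close>, is the same as if the two were independent. All averaging arguments below
rest on this instance of Fubini's theorem.\<close>

lemma nn_integral_overlap:
  assumes [measurable]: "A \<in> sets borel" "B \<in> sets borel"
  shows "(\<integral>\<^sup>+x. emeasure \<mu> {y\<in>A. x + y \<in> B} \<partial>\<mu>) = emeasure \<mu> A * emeasure \<mu> B"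
proof -
  have "(\<integral>\<^sup>+x. emeasure \<mu> {y\<in>A. x + y \<in> B} \<partial>\<mu>) =
      (\<integral>\<^sup>+x. (\<integral>\<^sup>+y. indicator A y * indicator B (x + y) \<partial>\<mu>) \<partial>\<mu>)"
  proof (rule nn_integral_cong)
    fix x
    have "emeasure \<mu> {y\<in>A. x + y \<in> B} = (\<integral>\<^sup>+y. indicator {y\<in>A. x + y \<in> B} y \<partial>\<mu>)"
      by (rule nn_integral_indicator[symmetric]) measurable
    then show "emeasure \<mu> {y\<in>A. x + y \<in> B} = (\<integral>\<^sup>+y. indicator A y * indicator B (x + y) \<partial>\<mu>)"
      by (simp add: indicator_def of_bool_conj[symmetric] if_distrib cong: if_cong)
  qed
  also have "\<dots> = (\<integral>\<^sup>+y. (\<integral>\<^sup>+x. indicator A y * indicator B (x + y) \<partial>\<mu>) \<partial>\<mu>)"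
    by (rule pair.Fubini'[symmetric]) measurable
  also have "\<dots> = (\<integral>\<^sup>+y. indicator A y * emeasure \<mu> B \<partial>\<mu>)"
  proof (rule nn_integral_cong)
    fix y
    have "(\<integral>\<^sup>+x. indicator B (x + y) \<partial>\<mu>) = emeasure \<mu> B"
      using nn_integral_translate[of "indicator B" y] by (simp add: add.commute)
    then show "(\<integral>\<^sup>+x. indicator A y * indicator B (x + y) \<partial>\<mu>) = indicator A y * emeasure \<mu> B"
      by (subst nn_integral_cmult) auto
  qed
  also have "\<dots> = emeasure \<mu> A * emeasure \<mu> B" by (subst nn_integral_multc) auto
  finally show ?thesis .
qed

text \<open>Integrate the indicator of \<open>A\<close> at \<open>x + y\<close>, with \<open>x\<close> distributed by \<open>\<mu>\<close> and \<open>y\<close> by \<open>\<nu>\<close>: one order of integration gives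
zero, the other gives \<open>\<mu> A * \<nu> UNIV\<close>.\<close>

lemma null_set_other_haar_measure:
  assumes \<nu>: "haar_measure \<nu>" and A[measurable]: "A \<in> sets borel" and null: "emeasure \<nu> A = 0"
  shows "emeasure \<mu> A = 0"
proof -
  interpret \<nu>: haar_group \<nu> using \<nu> locally_compact by unfold_locales
  interpret P: pair_sigma_finite \<mu> \<nu> ..
  have 1: "(\<integral>\<^sup>+y. indicator A (x + y) \<partial>\<nu>) = 0" for x
    using \<nu>.nn_integral_translate[of "indicator A" x] null by simp
  have 2: "(\<integral>\<^sup>+x. indicator A (x + y) \<partial>\<mu>) = emeasure \<mu> A" for y
    using nn_integral_translate[of "indicator A" y] by (simp add: add.commute)
  have "(\<integral>\<^sup>+y. (\<integral>\<^sup>+x. indicator A (x + y) \<partial>\<mu>) \<partial>\<nu>) = (\<integral>\<^sup>+x. (\<integral>\<^sup>+y. indicator A (x + y) \<partial>\<nu>) \<partial>\<mu>)"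
    by (rule P.Fubini') measurable
  then have "emeasure \<mu> A * emeasure \<nu> UNIV = 0" by (simp add: 1 2)
  then show ?thesis using \<nu> by (auto simp: haar_measure_def)
qed

lemma haar_null_sets_iff: "X \<in> haar_null_sets \<longleftrightarrow> (\<exists>A\<in>sets borel. emeasure \<mu> A = 0 \<and> X \<subseteq> A)"
proof
  assume "X \<in> haar_null_sets"
  then obtain \<nu> where \<nu>: "haar_measure \<nu>" "X \<in> null_sets (completion \<nu>)" by (auto simp: haar_null_sets_def)
  interpret \<nu>: haar_group \<nu> using \<nu>(1) locally_compact by unfold_locales
  obtain A where A: "A \<in> null_sets \<nu>" "X \<subseteq> A" using \<nu>(2) by (auto simp: null_sets_completion_iff2)
  then have "A \<in> sets borel" "emeasure \<nu> A = 0" by (auto simp: null_sets_def)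
  then show "\<exists>A\<in>sets borel. emeasure \<mu> A = 0 \<and> X \<subseteq> A"
    using null_set_other_haar_measure[OF \<nu>(1)] A by blast
next
  assume "\<exists>A\<in>sets borel. emeasure \<mu> A = 0 \<and> X \<subseteq> A"
  then have "X \<in> null_sets (completion \<mu>)" 
    unfolding null_sets_completion_iff2 by (auto simp: null_sets_def)
  then show "X \<in> haar_null_sets" using haar by (auto simp: haar_null_sets_def)
qed

lemma emeasure_open_pos:
  assumes "open S" "S \<noteq> {}"
  shows "emeasure \<mu> S > 0"
proof (rule ccontr)
  assume "\<not> emeasure \<mu> S > 0"
  then have 0: "emeasure \<mu> S = 0" by simp
  obtain a where a: "a \<in> S" using assms by auto
  obtain F where F: "F \<subseteq> range (\<lambda>g. {x. x - g \<in> S})" "countable F" "\<Union>F = \<Union>(range (\<lambda>g. {x. x - g \<in> S}))"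
    using Lindelof[of "range (\<lambda>g. {x. x - g \<in> S})"] open_vimage_uminus_plus(3)[OF assms(1)] by auto
  have "x \<in> \<Union>(range (\<lambda>g. {x. x - g \<in> S}))" for x
    using a by (intro UnionI[of "{y. y - (x - a) \<in> S}"]) auto
  then have "\<Union>F = UNIV" using F(3) by auto
  moreover have "(\<Union>S'\<in>F. S') \<in> null_sets \<mu>"
  proof (rule null_sets_UN'[OF F(2)])
    show "S' \<in> null_sets \<mu>" if S': "S' \<in> F" for S'
    proof -
      obtain g where g: "S' = {x. x - g \<in> S}" using F(1) S' by auto
      have "S' \<in> sets borel" unfolding g by (rule borel_open[OF open_vimage_uminus_plus(3)[OF assms(1)]])
      moreover have "emeasure \<mu> S' = 0" unfolding g using emeasure_translate_vimage(1)[of S g] 0 assms(1) by simp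
      ultimately show ?thesis by auto
    qed
  qed
  ultimately show False using haar by (auto simp: haar_measure_def null_sets_def)
qed

lemma AE_obtain_in_open:
  assumes "AE x in \<mu>. P x" "open S" "S \<noteq> {}"
  obtains x where "x \<in> S" "P x"
proof -
  have "\<exists>x\<in>S. P x"
  proof (rule ccontr)
    assume "\<not> ?thesis"
    then have "AE x in \<mu>. x \<notin> S" using assms(1) by (auto elim: eventually_mono)
    then have "emeasure \<mu> S = 0"
      using AE_iff_measurable[of S \<mu> "\<lambda>x. x \<notin> S"] assms(2) by simp
    then show False using emeasure_open_pos[OF assms(2,3)] by simp
  qed
  then show ?thesis using that by blast
qed

text \<open>If points had positive measure, compact sets would be finite and the group, being sigma-compact, would be countable.\<close>

lemma small_neighbourhood:
  assumes unc: "uncountable (UNIV :: 'a set)" and "e > 0"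
  shows "\<exists>N. open N \<and> (0::'a) \<in> N \<and> emeasure \<mu> N < e"
proof -
  have point: "emeasure \<mu> {0} = 0"
  proof (rule ccontr)
    assume p: "emeasure \<mu> {0::'a} \<noteq> 0"
    have "finite K" if K: "compact K" for K :: "'a set"
    proof (rule ccontr)
      assume "infinite K"
      have eq: "emeasure \<mu> {x} = emeasure \<mu> {0}" for x using emeasure_translate[of "{0}" x] by simp
      have le: "of_nat (card F) * emeasure \<mu> {0} \<le> emeasure \<mu> K" if F: "finite F" "F \<subseteq> K" for F
      proof -
        have "of_nat (card F) * emeasure \<mu> {0} = (\<Sum>x\<in>F. emeasure \<mu> {x})"
          by (subst eq) simp
        also have "\<dots> = emeasure \<mu> F" using emeasure_eq_sum_singleton[of F \<mu>] F by simp
        also have "\<dots> \<le> emeasure \<mu> K" using emeasure_mono[of F K \<mu>] F K by (simp add: borel_closed compact_imp_closed)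
        finally show ?thesis .
      qed
      have fin: "emeasure \<mu> {0::'a} < \<infinity>" "emeasure \<mu> K < \<infinity>" using emeasure_compact K by auto
      have "real n * measure \<mu> {0} \<le> measure \<mu> K" for n
      proof -
        obtain F where F: "finite F" "F \<subseteq> K" "card F = n" using infinite_arbitrarily_large[OF \<open>infinite K\<close>] by blast
        then have "ennreal (real n * measure \<mu> {0}) \<le> ennreal (measure \<mu> K)"
          using le[OF F(1,2)] fin by (simp add: emeasure_eq_ennreal_measure ennreal_mult ennreal_of_nat_eq_real_of_nat less_top)
        then show ?thesis by (simp add: ennreal_le_iff)
      qed
      moreover have "measure \<mu> {0} > 0" using p fin by (simp add: measure_def enn2real_positive_iff zero_less_iff_neq_zero)
      ultimately show False using reals_Archimedean3 by (meson not_le)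
    qed
    moreover obtain C :: "nat \<Rightarrow> 'a set" where C: "\<forall>n. compact (C n) \<and> 0 \<in> C n" "(\<Union>n. C n) = UNIV"
      using compact_exhaustion[OF locally_compact] by (elim exE conjE) (rule that)
    ultimately have "countable (\<Union>n. C n)" by (intro countable_UN) (auto intro: countable_finite)
    then show False using unc C(2) by simp
  qed
  obtain U K where UK: "open U" "compact K" "(0::'a) \<in> U" "U \<subseteq> K"
    by (rule zero_neighbourhood_in_compact[OF locally_compact])
  let ?B = "\<lambda>n. U \<inter> ball 0 (1 / Suc n)"
  have "(\<lambda>n. emeasure \<mu> (?B n)) \<longlonglongrightarrow> emeasure \<mu> (\<Inter>n. ?B n)"
  proof (rule Lim_emeasure_decseq)
    show "range ?B \<subseteq> sets \<mu>" using UK by (auto intro!: sets.Int borel_open)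
    show "decseq ?B" unfolding decseq_def
      by (intro allI impI Int_mono order_refl subset_ball frac_le) auto
    show "emeasure \<mu> (?B n) \<noteq> \<infinity>" for n using emeasure_subset_compact[OF UK(2), of "?B n"] UK(4) le_infI1[of U K] by (simp add: less_top)
  qed
  moreover have "(\<Inter>n. ?B n) = {0}"
  proof -
    have "x = 0" if "\<And>n. dist 0 x < 1 / Suc n" for x :: 'a
      using that nat_approx_posE[of "dist 0 x"] by (metis less_asym zero_less_dist_iff)
    then show ?thesis using UK by auto
  qed
  ultimately have "(\<lambda>n. emeasure \<mu> (?B n)) \<longlonglongrightarrow> 0" using point by simp
  then have "eventually (\<lambda>n. emeasure \<mu> (?B n) < e) sequentially" using \<open>e > 0\<close> by (rule order_tendstoD)
  then obtain n where "emeasure \<mu> (?B n) < e" by (auto simp: eventually_sequentially)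
  then show ?thesis using UK by (intro exI[of _ "?B n"]) auto
qed

end

section \<open>Averaging and greedy choices\<close>

lemma exists_le_average:
  fixes f :: "'b \<Rightarrow> ennreal"
  assumes [measurable]: "K \<in> sets M" "f \<in> borel_measurable M"
    and K: "0 < emeasure M K" "emeasure M K < \<infinity>"
  shows "\<exists>x\<in>K. f x * emeasure M K \<le> (\<integral>\<^sup>+x. f x \<partial>M)"
proof (rule ccontr)
  define I where "I = (\<integral>\<^sup>+x. f x \<partial>M)"
  assume "\<not> ?thesis"
  then have less: "I < f x * emeasure M K" if "x \<in> K" for x using that by (auto simp: I_def not_le)
  obtain x0 where "x0 \<in> K" using K(1) by fastforce
  then have fin: "I < \<infinity>" using less_le_trans[OF less top_greatest] by simp
  have "(\<integral>\<^sup>+x. I * indicator K x \<partial>M) < (\<integral>\<^sup>+x. f x * emeasure M K \<partial>M)"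
  proof (rule nn_integral_less)
    show "(\<integral>\<^sup>+x. I * indicator K x \<partial>M) \<noteq> \<infinity>"
      using fin K(2) by (simp add: nn_integral_cmult_indicator ennreal_mult_eq_top_iff less_top)
    show "AE x in M. I * indicator K x \<le> f x * emeasure M K"
      using less by (auto simp: indicator_def less_imp_le)
    show "\<not> (AE x in M. f x * emeasure M K \<le> I * indicator K x)"
    proof
      assume "AE x in M. f x * emeasure M K \<le> I * indicator K x"
      then have "AE x in M. x \<notin> K"
      proof eventually_elim
        case (elim x)
        then show ?case using less[of x] by (auto simp: indicator_def not_less)
      qed
      then have "emeasure M K = 0" using AE_iff_measurable[of K M "\<lambda>x. x \<notin> K"] sets.sets_into_space[OF assms(1)]
        by (simp add: Int_absorb1 Collect_conj_eq inf_commute)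
      then show False using K(1) by simp
    qed
  qed auto
  then show False by (simp add: nn_integral_cmult_indicator nn_integral_multc I_def)
qed

context haar_group
begin

lemma translate_measurable[measurable]:
  fixes g :: 'a
  assumes [measurable]: "B \<in> sets borel"
  shows "(+) g ` B \<in> sets borel"
  unfolding translate_eq by measurable

lemma measure_translate: "B \<in> sets borel \<Longrightarrow> measure \<mu> ((+) g ` B) = measure \<mu> B"
  by (simp add: measure_def emeasure_translate)

lemma measurable_overlap[measurable]:
  assumes [measurable]: "A \<in> sets borel" "B \<in> sets borel"
  shows "(\<lambda>x. emeasure \<mu> {y\<in>A. x + y \<in> B}) \<in> borel_measurable borel"
proof -
  have "Measurable.pred (borel \<Otimes>\<^sub>M \<mu>) (\<lambda>p. snd p \<in> A \<and> fst p + snd p \<in> B)" by measurable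
  then have "{p. snd p \<in> A \<and> fst p + snd p \<in> B} \<in> sets (borel \<Otimes>\<^sub>M \<mu>)"
    by (simp add: pred_def space_pair_measure)
  then have "(\<lambda>x. emeasure \<mu> (Pair x -` {p. snd p \<in> A \<and> fst p + snd p \<in> B})) \<in> borel_measurable borel"
    by (rule measurable_emeasure_Pair)
  then show ?thesis by (simp add: vimage_def)
qed

lemma emeasure_eq_measure: "emeasure \<mu> A < \<infinity> \<Longrightarrow> emeasure \<mu> A = ennreal (measure \<mu> A)"
  by (simp add: emeasure_eq_ennreal_measure less_top)

lemma measure_split:
  assumes A: "A \<in> sets borel" "emeasure \<mu> A < \<infinity>" and P: "P \<in> sets borel"
  shows "measure \<mu> A = measure \<mu> (A - P) + measure \<mu> (A \<inter> P)"
    and "emeasure \<mu> P < \<infinity> \<Longrightarrow> measure \<mu> (P \<union> (A - P)) = measure \<mu> P + measure \<mu> (A - P)"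
proof -
  have fin: "emeasure \<mu> (A - P) \<noteq> \<infinity>" "emeasure \<mu> (A \<inter> P) \<noteq> \<infinity>"
    using emeasure_mono[of "A - P" A \<mu>] emeasure_mono[of "A \<inter> P" A \<mu>] A by (auto simp: top_unique)
  have "measure \<mu> ((A - P) \<union> (A \<inter> P)) = measure \<mu> (A - P) + measure \<mu> (A \<inter> P)"
    using fin A P by (intro measure_Union) auto
  moreover have "(A - P) \<union> (A \<inter> P) = A" by blast
  ultimately show "measure \<mu> A = measure \<mu> (A - P) + measure \<mu> (A \<inter> P)" by simp
  show "measure \<mu> (P \<union> (A - P)) = measure \<mu> P + measure \<mu> (A - P)" if "emeasure \<mu> P < \<infinity>"
    using fin that A P by (intro measure_Union) (auto simp: less_top)
qed

lemma emeasure_translates_le: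
  assumes "B \<in> sets borel"
  shows "emeasure \<mu> (\<Union>s\<in>set ss. (+) s ` B) \<le> of_nat (length ss) * emeasure \<mu> B"
proof -
  have "emeasure \<mu> (\<Union>s\<in>set ss. (+) s ` B) \<le> (\<Sum>s\<in>set ss. emeasure \<mu> ((+) s ` B))"
    by (rule emeasure_subadditive_finite) (use assms translate_measurable in auto)
  also have "\<dots> = of_nat (card (set ss)) * emeasure \<mu> B" by (simp add: emeasure_translate[OF assms])
  also have "\<dots> \<le> of_nat (length ss) * emeasure \<mu> B" by (intro mult_right_mono of_nat_mono card_length) auto
  finally show ?thesis .
qed

text \<open>By averaging over \<open>Q\<close> there is always a point that lies in at least the proportion \<open>\<theta>\<close> of the sets that
have not been hit so far; choose such points one after the other.\<close>

lemma hitting_points: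
  assumes Q[measurable]: "Q \<in> sets borel" and Qpos: "0 < emeasure \<mu> Q" "emeasure \<mu> Q < \<infinity>"
    and "finite \<Omega>" and \<theta>: "0 \<le> \<theta>" "\<theta> \<le> 1"
    and T[measurable]: "\<And>c. c \<in> \<Omega> \<Longrightarrow> T c \<in> sets borel"
    and TQ: "\<And>c. c \<in> \<Omega> \<Longrightarrow> T c \<subseteq> Q" "\<And>c. c \<in> \<Omega> \<Longrightarrow> \<theta> * measure \<mu> Q \<le> measure \<mu> (T c)"
  shows "\<exists>us. length us = L \<and> set us \<subseteq> Q \<and>
    real (card {c\<in>\<Omega>. \<forall>u\<in>set us. u \<notin> T c}) \<le> (1 - \<theta>) ^ L * real (card \<Omega>)"
proof (induction L)
  case 0
  then show ?case by simp
next
  case (Suc L)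
  then obtain us where us: "length us = L" "set us \<subseteq> Q"
    "real (card {c\<in>\<Omega>. \<forall>u\<in>set us. u \<notin> T c}) \<le> (1 - \<theta>) ^ L * real (card \<Omega>)" by blast
  define A where "A = {c\<in>\<Omega>. \<forall>u\<in>set us. u \<notin> T c}"
  have A: "finite A" "A \<subseteq> \<Omega>" using \<open>finite \<Omega>\<close> by (auto simp: A_def)
  have mQ: "emeasure \<mu> Q = ennreal (measure \<mu> Q)" using Qpos by (simp add: emeasure_eq_measure)
  have mpos: "measure \<mu> Q > 0" using Qpos mQ by (metis ennreal_less_zero_iff ennreal_0)
  let ?f = "\<lambda>u. \<Sum>c\<in>A. indicator (Q - T c) u :: ennreal"
  have [measurable]: "?f \<in> borel_measurable \<mu>"
    by (intro borel_measurable_sum borel_measurable_indicator) (use A T Q in auto)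
  have "\<exists>u\<in>Q. ?f u * emeasure \<mu> Q \<le> (\<integral>\<^sup>+u. ?f u \<partial>\<mu>)"
    by (rule exists_le_average) (use Qpos in auto)
  then obtain u where u: "u \<in> Q" "?f u * emeasure \<mu> Q \<le> (\<integral>\<^sup>+u. ?f u \<partial>\<mu>)" by blast
  have "(\<integral>\<^sup>+u. ?f u \<partial>\<mu>) = (\<Sum>c\<in>A. emeasure \<mu> (Q - T c))"
    by (subst nn_integral_sum) (use A T Q in \<open>auto intro!: sum.cong\<close>)
  also have "\<dots> \<le> (\<Sum>c\<in>A. ennreal ((1 - \<theta>) * measure \<mu> Q))"
  proof (rule sum_mono)
    fix c assume "c \<in> A"
    then have c: "c \<in> \<Omega>" using A by auto
    have "emeasure \<mu> (Q - T c) < \<infinity>" using Qpos(2) emeasure_mono[of "Q - T c" Q \<mu>] by (auto intro: le_less_trans)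
    then have "emeasure \<mu> (Q - T c) = ennreal (measure \<mu> (Q - T c))"
      by (simp add: emeasure_eq_measure)
    also have "measure \<mu> (Q - T c) = measure \<mu> Q - measure \<mu> (T c)"
      using T[OF c] TQ(1)[OF c] Qpos by (intro measure_Diff) auto
    also have "\<dots> \<le> (1 - \<theta>) * measure \<mu> Q" using TQ(2)[OF c] by (simp add: algebra_simps)
    finally show "emeasure \<mu> (Q - T c) \<le> ennreal ((1 - \<theta>) * measure \<mu> Q)" by (simp add: ennreal_leI)
  qed
  finally have le: "?f u * emeasure \<mu> Q \<le> (\<Sum>c\<in>A. ennreal ((1 - \<theta>) * measure \<mu> Q))" using u(2) by simp
  define A' where "A' = {c\<in>\<Omega>. \<forall>u'\<in>set (u # us). u' \<notin> T c}"
  have A': "A' = {c\<in>A. u \<notin> T c}" by (auto simp: A_def A'_def)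
  have "?f u = (\<Sum>c\<in>A. if u \<notin> T c then 1 else 0)" using u(1) by (intro sum.cong) (auto simp: indicator_def)
  also have "\<dots> = of_nat (card A')" using A(1) by (simp add: A' sum.If_cases Int_def)
  finally have "of_nat (card A') * emeasure \<mu> Q \<le> of_nat (card A) * ennreal ((1 - \<theta>) * measure \<mu> Q)" using le by simp
  then have "ennreal (real (card A') * measure \<mu> Q) \<le> ennreal (real (card A) * ((1 - \<theta>) * measure \<mu> Q))"
    using \<theta> by (simp add: mQ ennreal_of_nat_eq_real_of_nat ennreal_mult)
  then have "real (card A') * measure \<mu> Q \<le> real (card A) * ((1 - \<theta>) * measure \<mu> Q)"
    using \<theta> by (subst (asm) ennreal_le_iff) auto
  then have "real (card A') * measure \<mu> Q \<le> ((1 - \<theta>) * real (card A)) * measure \<mu> Q" by (simp add: mult_ac)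
  then have "real (card A') \<le> (1 - \<theta>) * real (card A)" using mpos by (rule mult_right_le_imp_le)
  also have "\<dots> \<le> (1 - \<theta>) * ((1 - \<theta>) ^ L * real (card \<Omega>))" using us(3) \<theta> by (intro mult_left_mono) (auto simp: A_def)
  finally show ?case using us u(1) by (intro exI[of _ "u # us"]) (auto simp: A'_def)
qed

text \<open>Pick elements of \<open>C\<close> greedily as long as a new translate of \<open>B\<close> adds at least half of the measure of \<open>B\<close> to the
union \<open>F\<close> of the previous ones. If this stops early, every \<open>a + B\<close> with \<open>a \<in> C\<close> has half of its measure inside \<open>F\<close>. Since \<open>a + y + B'\<close>
contains \<open>a + B\<close> for \<open>y \<in> R\<close>, the set \<open>C + R\<close> lies in the set \<open>H\<close> of all \<open>x\<close> such that \<open>x + B'\<close> overlaps \<open>F\<close> that much, and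
\<open>nn_integral_overlap\<close> bounds the measure of \<open>H\<close>.\<close>

lemma many_translates_or_thin:
  assumes B[measurable]: "B \<in> sets borel" and Bpos: "0 < emeasure \<mu> B" "emeasure \<mu> B < \<infinity>"
    and B'[measurable]: "B' \<in> sets borel" and B'fin: "emeasure \<mu> B' < \<infinity>"
    and BB': "\<And>y b. y \<in> R \<Longrightarrow> b \<in> B \<Longrightarrow> b - y \<in> B'"
  shows "(\<exists>ss. length ss = k \<and> set ss \<subseteq> C \<and> real k * measure \<mu> B / 2 \<le> measure \<mu> (\<Union>s\<in>set ss. (+) s ` B)) \<or>
    (\<exists>H\<in>sets borel. (\<forall>a\<in>C. \<forall>y\<in>R. a + y \<in> H) \<and> emeasure \<mu> H \<le> ennreal (2 * real k * measure \<mu> B'))"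
proof (rule ccontr)
  assume neg: "\<not> ?thesis"
  have mB: "emeasure \<mu> B = ennreal (measure \<mu> B)" using Bpos by (simp add: emeasure_eq_measure)
  have mB': "emeasure \<mu> B' = ennreal (measure \<mu> B')" using B'fin by (simp add: emeasure_eq_measure)
  define \<beta> where "\<beta> = measure \<mu> B"
  have \<beta>: "\<beta> > 0" using Bpos mB unfolding \<beta>_def by (metis ennreal_less_zero_iff ennreal_0)
  have "\<exists>ss. length ss = i \<and> set ss \<subseteq> C \<and> real i * \<beta> / 2 \<le> measure \<mu> (\<Union>s\<in>set ss. (+) s ` B)" if "i \<le> k" for i
    using that
  proof (induction i)
    case 0
    then show ?case by simp
  next
    case (Suc i)
    then obtain ss where ss: "length ss = i" "set ss \<subseteq> C" "real i * \<beta> / 2 \<le> measure \<mu> (\<Union>s\<in>set ss. (+) s ` B)" by auto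
    define F where "F = (\<Union>s\<in>set ss. (+) s ` B)"
    have [measurable]: "F \<in> sets borel" unfolding F_def by (intro sets.finite_UN) (use B translate_measurable in auto)
    have Fle: "emeasure \<mu> F \<le> of_nat i * emeasure \<mu> B" using emeasure_translates_le[OF B, of ss] by (simp add: F_def ss(1))
    have Ffin: "emeasure \<mu> F < \<infinity>"
      by (rule le_less_trans[OF Fle]) (use Bpos in \<open>auto simp: mB ennreal_of_nat_eq_real_of_nat ennreal_mult[symmetric]\<close>)
    have ov: "emeasure \<mu> ((+) a ` B \<inter> F) = emeasure \<mu> {b\<in>B. a + b \<in> F}" for a
    proof -
      have "(+) a ` B \<inter> F = (+) a ` {b\<in>B. a + b \<in> F}" by auto
      then show ?thesis by (simp add: emeasure_translate)
    qed
    show ?case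
    proof (cases "\<exists>a\<in>C. \<beta> / 2 \<le> measure \<mu> ((+) a ` B - F)")
      case True
      then obtain a where a: "a \<in> C" "\<beta> / 2 \<le> measure \<mu> ((+) a ` B - F)" by blast
      have "measure \<mu> (F \<union> ((+) a ` B - F)) = measure \<mu> F + measure \<mu> ((+) a ` B - F)"
        using Ffin Bpos(2) by (intro measure_split) (auto simp: emeasure_translate translate_measurable)
      moreover have "F \<union> ((+) a ` B - F) = (\<Union>s\<in>set (a # ss). (+) s ` B)" by (auto simp: F_def)
      ultimately have "real (Suc i) * \<beta> / 2 \<le> measure \<mu> (\<Union>s\<in>set (a # ss). (+) s ` B)"
        using a(2) ss(3) by (simp add: F_def algebra_simps)
      then show ?thesis using a(1) ss by (intro exI[of _ "a # ss"]) auto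
    next
      case False
      have ge: "ennreal (\<beta>/2) \<le> emeasure \<mu> {b\<in>B. a + b \<in> F}" if "a \<in> C" for a
      proof -
        have "measure \<mu> ((+) a ` B) = measure \<mu> ((+) a ` B - F) + measure \<mu> ((+) a ` B \<inter> F)"
          using Bpos(2) by (intro measure_split) (auto simp: emeasure_translate translate_measurable)
        then have "\<beta> / 2 \<le> measure \<mu> ((+) a ` B \<inter> F)" using False that by (auto simp: measure_translate \<beta>_def not_le)
        then have "ennreal (\<beta> / 2) \<le> emeasure \<mu> ((+) a ` B \<inter> F)"
          by (metis emeasure_eq_ennreal_measure ennreal_leI top_greatest)
        then show ?thesis by (simp add: ov)
      qed
      define H where "H = {x. ennreal (\<beta>/2) \<le> emeasure \<mu> {b\<in>B'. x + b \<in> F}}"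
      have [measurable]: "H \<in> sets borel" unfolding H_def by measurable
      have "a + y \<in> H" if "a \<in> C" "y \<in> R" for a y
      proof -
        have "(+) (- y) ` {b\<in>B. a + b \<in> F} \<subseteq> {b\<in>B'. a + y + b \<in> F}"
          using BB'[OF that(2)] by (auto simp: algebra_simps)
        then have "emeasure \<mu> {b\<in>B. a + b \<in> F} \<le> emeasure \<mu> {b\<in>B'. a + y + b \<in> F}"
          using emeasure_mono[of "(+) (- y) ` {b\<in>B. a + b \<in> F}" "{b\<in>B'. a + y + b \<in> F}" \<mu>]
            emeasure_translate[of "{b\<in>B. a + b \<in> F}" "- y"] by simp
        then show ?thesis using ge[OF that(1)] unfolding H_def by simp
      qed
      moreover have "emeasure \<mu> H \<le> ennreal (2 * real k * measure \<mu> B')"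
      proof -
        have "ennreal (\<beta>/2) * emeasure \<mu> H = (\<integral>\<^sup>+x. ennreal (\<beta>/2) * indicator H x \<partial>\<mu>)"
          by (simp add: nn_integral_cmult_indicator)
        also have "\<dots> \<le> (\<integral>\<^sup>+x. emeasure \<mu> {b\<in>B'. x + b \<in> F} \<partial>\<mu>)"
          by (rule nn_integral_mono) (auto simp: H_def indicator_def)
        also have "\<dots> = emeasure \<mu> B' * emeasure \<mu> F" by (rule nn_integral_overlap) auto
        also have "\<dots> \<le> ennreal (measure \<mu> B') * ennreal (real i * \<beta>)"
          using Fle by (intro mult_mono) (auto simp: mB' mB \<beta>_def ennreal_of_nat_eq_real_of_nat ennreal_mult)
        also have "\<dots> = ennreal (\<beta>/2) * ennreal (2 * real i * measure \<mu> B')"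
          using \<beta> by (simp add: ennreal_mult[symmetric])
        finally have "emeasure \<mu> H \<le> ennreal (2 * real i * measure \<mu> B')"
          using \<beta> by (subst (asm) ennreal_mult_le_mult_iff) auto
        also have "\<dots> \<le> ennreal (2 * real k * measure \<mu> B')" using Suc.prems by (intro ennreal_leI mult_mono) auto
        finally show ?thesis .
      qed
      ultimately have "\<exists>H\<in>sets borel. (\<forall>a\<in>C. \<forall>y\<in>R. a + y \<in> H) \<and> emeasure \<mu> H \<le> ennreal (2 * real k * measure \<mu> B')"
        by (intro bexI[of _ H]) auto
      with neg show ?thesis by (simp only: simp_thms)
    qed
  qed
  from this[of k] neg show False unfolding \<beta>_def by (simp only: simp_thms order_refl)
qed

text \<open>As long as the union \<open>P\<close> of the chosen translates has less than half of the measure of \<open>K\<close>, for some \<open>x \<in> K\<close> at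
most half of \<open>x + F\<close> falls into \<open>P\<close>, by averaging over \<open>K\<close>.\<close>

lemma few_translates_spread:
  assumes K[measurable]: "K \<in> sets borel" and Kfin: "emeasure \<mu> K < \<infinity>" and c: "0 < c" "c \<le> measure \<mu> K"
    and F[measurable]: "F \<in> sets borel" and Ffin: "emeasure \<mu> F < \<infinity>"
  shows "\<exists>ks. length ks = j \<and> set ks \<subseteq> K \<and>
    min (c / 2) (real j * measure \<mu> F / 2) \<le> measure \<mu> (\<Union>x\<in>set ks. (+) x ` F)"
proof (induction j)
  case 0
  then show ?case using c by simp
next
  case (Suc j)
  then obtain ks where ks: "length ks = j" "set ks \<subseteq> K"
    "min (c / 2) (real j * measure \<mu> F / 2) \<le> measure \<mu> (\<Union>x\<in>set ks. (+) x ` F)" by blast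
  define P where "P = (\<Union>x\<in>set ks. (+) x ` F)"
  have [measurable]: "P \<in> sets borel" unfolding P_def by (intro sets.finite_UN) (use F translate_measurable in auto)
  have mF: "emeasure \<mu> F = ennreal (measure \<mu> F)" using Ffin by (simp add: emeasure_eq_measure)
  have mK: "emeasure \<mu> K = ennreal (measure \<mu> K)" using Kfin by (simp add: emeasure_eq_measure)
  have "emeasure \<mu> P \<le> of_nat j * emeasure \<mu> F" using emeasure_translates_le[OF F, of ks] by (simp add: P_def ks(1))
  then have Pfin: "emeasure \<mu> P < \<infinity>"
    by (rule le_less_trans) (auto simp: mF ennreal_of_nat_eq_real_of_nat ennreal_mult[symmetric])
  then have mP: "emeasure \<mu> P = ennreal (measure \<mu> P)" by (simp add: emeasure_eq_measure)
  have fin1: "emeasure \<mu> ((+) x ` F) < \<infinity>" for x using Ffin by (simp add: emeasure_translate)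
  have un: "P \<union> ((+) x ` F - P) = (\<Union>x\<in>set (x # ks). (+) x ` F)" for x by (auto simp: P_def)
  have add: "measure \<mu> (P \<union> ((+) x ` F - P)) = measure \<mu> P + measure \<mu> ((+) x ` F - P)" for x
    using Pfin fin1[of x] by (intro measure_split) (auto simp: translate_measurable)
  have "\<exists>x\<in>K. emeasure \<mu> {f\<in>F. x + f \<in> P} * emeasure \<mu> K \<le> (\<integral>\<^sup>+x. emeasure \<mu> {f\<in>F. x + f \<in> P} \<partial>\<mu>)"
  proof (rule exists_le_average)
    show "(\<lambda>x. emeasure \<mu> {f\<in>F. x + f \<in> P}) \<in> borel_measurable \<mu>" by measurable
    show "0 < emeasure \<mu> K" using c by (simp add: mK)
  qed (use Kfin in auto)
  then obtain x where x: "x \<in> K" "emeasure \<mu> {f\<in>F. x + f \<in> P} * emeasure \<mu> K \<le> emeasure \<mu> F * emeasure \<mu> P"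
    by (auto simp: nn_integral_overlap)
  show ?case
  proof (cases "c / 2 \<le> measure \<mu> P")
    case True
    then have "c / 2 \<le> measure \<mu> (\<Union>x\<in>set (x # ks). (+) x ` F)" unfolding un[symmetric] add
      by (simp add: add_increasing2)
    then show ?thesis using ks x(1) by (intro exI[of _ "x # ks"]) auto
  next
    case False
    have "(+) x ` F \<inter> P = (+) x ` {f\<in>F. x + f \<in> P}" by auto
    then have ov: "emeasure \<mu> ((+) x ` F \<inter> P) = emeasure \<mu> {f\<in>F. x + f \<in> P}" by (simp add: emeasure_translate)
    have "emeasure \<mu> ((+) x ` F \<inter> P) < \<infinity>" using Pfin emeasure_mono[of "(+) x ` F \<inter> P" P \<mu>] by (auto intro: le_less_trans)
    then have mI: "emeasure \<mu> ((+) x ` F \<inter> P) = ennreal (measure \<mu> ((+) x ` F \<inter> P))" by (simp add: emeasure_eq_measure)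
    have "ennreal (measure \<mu> ((+) x ` F \<inter> P) * measure \<mu> K) \<le> ennreal (measure \<mu> F * measure \<mu> P)"
      using x(2) unfolding ov[symmetric] mI mK mF mP by (simp add: ennreal_mult)
    then have "measure \<mu> ((+) x ` F \<inter> P) * measure \<mu> K \<le> measure \<mu> F * measure \<mu> P" by (simp add: ennreal_le_iff)
    also have "\<dots> \<le> measure \<mu> F * (measure \<mu> K / 2)" using False c by (intro mult_left_mono) auto
    finally have half: "measure \<mu> ((+) x ` F \<inter> P) \<le> measure \<mu> F / 2" using c by (simp add: field_simps)
    have "measure \<mu> F = measure \<mu> ((+) x ` F - P) + measure \<mu> ((+) x ` F \<inter> P)"
      using measure_split(1)[of "(+) x ` F" P] fin1[of x] by (simp add: measure_translate translate_measurable)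
    then have "measure \<mu> F / 2 \<le> measure \<mu> ((+) x ` F - P)" using half by simp
    then have "real (Suc j) * measure \<mu> F / 2 \<le> measure \<mu> (\<Union>x\<in>set (x # ks). (+) x ` F)"
      unfolding un[symmetric] add using ks(3) False by (auto simp: P_def algebra_simps)
    then show ?thesis using ks x(1) by (intro exI[of _ "x # ks"]) auto
  qed
qed

end

section \<open>Small open sets that force thinness\<close>

definition group_seminorm :: "('a::topological_ab_group_add \<Rightarrow> real) \<Rightarrow> bool" where
  "group_seminorm d \<longleftrightarrow> continuous_on UNIV d \<and> d 0 = 0 \<and> (\<forall>x. d (- x) = d x) \<and> (\<forall>x y. d (x + y) \<le> d x + d y)"

text \<open>What is required of the measure \<open>\<beta>\<close> of a ball in \<open>thinness_forcing_set\<close>. The last conjunct beats the number of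
configurations that have to be hit: the left side bounds the logarithm of that number when pairs of lists of length at most \<open>2 * \<beta> powr (-1/2)\<close>
are drawn from a net with at most \<open>v / \<beta> powr \<kappa>\<close> points, and the right side is half of \<open>\<epsilon> / \<beta>\<close>, a lower bound for the number of
centres, times the proportion \<open>\<beta> powr (1/4) / (4 * v)\<close> of the remaining configurations that each centre hits.\<close>

definition small_enough :: "real \<Rightarrow> real \<Rightarrow> real \<Rightarrow> real \<Rightarrow> bool" where
  "small_enough \<epsilon> v \<kappa> \<beta> \<longleftrightarrow> \<beta> < 1 \<and> \<beta> \<le> \<epsilon> \<and> \<beta> powr (1/4) \<le> 4 * v \<and> 4 * \<beta> powr (1/4) \<le> \<epsilon> \<and>
     4 * \<beta> powr (-1/2) * (ln v - \<kappa> * ln \<beta>) < \<epsilon> / (8 * v) * \<beta> powr (-3/4)"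

lemma eventually_small_enough:
  assumes "\<epsilon> > 0" "v > 0" "\<kappa> > 0"
  shows "eventually (small_enough \<epsilon> v \<kappa>) (at_right 0)"
proof -
  have "eventually (\<lambda>\<beta>::real. \<beta> < 1) (at_right 0)" by real_asymp
  moreover have "eventually (\<lambda>\<beta>::real. \<beta> \<le> \<epsilon>) (at_right 0)" using assms by real_asymp
  moreover have "eventually (\<lambda>\<beta>::real. \<beta> powr (1/4) \<le> 4 * v) (at_right 0)" using assms by real_asymp
  moreover have "eventually (\<lambda>\<beta>::real. 4 * \<beta> powr (1/4) \<le> \<epsilon>) (at_right 0)" using assms by real_asymp
  moreover have "eventually (\<lambda>\<beta>::real. 4 * \<beta> powr (-1/2) * (ln v - \<kappa> * ln \<beta>) < \<epsilon> / (8 * v) * \<beta> powr (-3/4)) (at_right 0)"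
    using assms by real_asymp
  ultimately show ?thesis by eventually_elim (simp add: small_enough_def)
qed

lemma few_unhit:
  fixes \<beta> :: real
  assumes \<beta>: "0 < \<beta>" "small_enough \<epsilon> v \<kappa> \<beta>" and pos: "\<epsilon> > 0" "v > 0"
    and M: "1 \<le> M" "real M \<le> v / \<beta> powr \<kappa>" and k: "real k \<le> 2 * \<beta> powr (-1/2)"
  shows "(1 - \<beta> powr (1/4) / (4 * v)) ^ nat \<lfloor>\<epsilon> / \<beta>\<rfloor> * real (M ^ k * M ^ k) < 1"
proof -
  define \<theta> where "\<theta> = \<beta> powr (1/4) / (4 * v)"
  define L where "L = nat \<lfloor>\<epsilon> / \<beta>\<rfloor>"
  have small: "\<beta> \<le> \<epsilon>" "\<beta> powr (1/4) \<le> 4 * v"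
    "4 * \<beta> powr (-1/2) * (ln v - \<kappa> * ln \<beta>) < \<epsilon> / (8 * v) * \<beta> powr (-3/4)"
    using \<beta>(2) by (auto simp: small_enough_def)
  have \<theta>: "0 \<le> \<theta>" "\<theta> \<le> 1" using small pos by (auto simp: \<theta>_def)
  have "1 \<le> \<epsilon> / \<beta>" using \<beta>(1) small(1) by simp
  moreover have "x / 2 \<le> real (nat \<lfloor>x\<rfloor>)" if "1 \<le> x" for x :: real
  proof -
    have "1 \<le> real_of_int \<lfloor>x\<rfloor>" "real (nat \<lfloor>x\<rfloor>) = of_int \<lfloor>x\<rfloor>" using that by simp_all
    then show ?thesis using real_of_int_floor_add_one_ge[of x] by linarith
  qed
  ultimately have "(\<epsilon> / \<beta>) / 2 \<le> real L" unfolding L_def by blast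
  then have L: "real L \<ge> \<epsilon> / (2 * \<beta>)" by (simp add: mult.commute)
  have "\<epsilon> / (8 * v) * \<beta> powr (-3/4) = \<theta> * (\<epsilon> / (2 * \<beta>))"
  proof -
    have "\<beta> powr (-3/4) = \<beta> powr (1/4) / \<beta>"
      using \<beta>(1) powr_add[of \<beta> "1/4" "-1"] by (simp add: powr_minus_divide)
    then show ?thesis using \<beta>(1) pos by (simp add: \<theta>_def field_simps)
  qed
  also have "\<dots> \<le> \<theta> * real L" using L \<theta>(1) by (intro mult_left_mono)
  finally have 1: "4 * \<beta> powr (-1/2) * (ln v - \<kappa> * ln \<beta>) < \<theta> * real L" using small(3) by simp
  have "ln (real M) \<le> ln (v / \<beta> powr \<kappa>)" using M by (intro ln_mono) auto
  also have "\<dots> = ln v - \<kappa> * ln \<beta>" using pos \<beta>(1) by (simp add: ln_div ln_powr)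
  finally have lnM: "ln (real M) \<le> ln v - \<kappa> * ln \<beta>" .
  have "2 * real k * ln (real M) \<le> (2 * (2 * \<beta> powr (-1/2))) * (ln v - \<kappa> * ln \<beta>)"
    using k lnM M(1) by (intro mult_mono) auto
  also have "\<dots> = 4 * \<beta> powr (-1/2) * (ln v - \<kappa> * ln \<beta>)" by simp
  also note 1
  finally have 2: "2 * real k * ln (real M) < \<theta> * real L" .
  have "(1 - \<theta>) ^ L \<le> exp (- \<theta>) ^ L" using \<theta> exp_ge_add_one_self[of "- \<theta>"] by (intro power_mono) auto
  also have "\<dots> = exp (- (\<theta> * real L))" by (simp add: exp_of_nat_mult[symmetric] mult.commute)
  finally have 3: "(1 - \<theta>) ^ L \<le> exp (- (\<theta> * real L))" .
  have "real (M ^ k * M ^ k) = exp (2 * real k * ln (real M))"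
  proof -
    have "real M ^ k = exp (real k * ln (real M))" using M(1) by (simp add: exp_of_nat_mult)
    then show ?thesis by (simp add: exp_add[symmetric])
  qed
  then have "(1 - \<theta>) ^ L * real (M ^ k * M ^ k) \<le> exp (- (\<theta> * real L)) * exp (2 * real k * ln (real M))"
    using 3 by (intro mult_mono) auto
  also have "\<dots> < 1" using 2 by (simp add: exp_add[symmetric])
  finally show ?thesis by (simp add: \<theta>_def L_def)
qed

text \<open>A separated set of maximal cardinality is a net.\<close>

lemma maximal_separated_net:
  fixes X :: "'a::topological_ab_group_add set"
  assumes d: "group_seminorm d" and s: "0 < s"
    and bound: "\<And>P. finite P \<Longrightarrow> P \<subseteq> X \<Longrightarrow> \<forall>p\<in>P. \<forall>q\<in>P. p \<noteq> q \<longrightarrow> s \<le> d (p - q) \<Longrightarrow> card P \<le> B"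
  shows "\<exists>P. finite P \<and> P \<subseteq> X \<and> (\<forall>p\<in>P. \<forall>q\<in>P. p \<noteq> q \<longrightarrow> s \<le> d (p - q)) \<and> (\<forall>x\<in>X. \<exists>p\<in>P. d (x - p) < s)"
proof -
  have d0: "d 0 = 0" and dm: "\<And>x. d (- x) = d x" using d by (auto simp: group_seminorm_def)
  define sep where "sep P \<longleftrightarrow> finite P \<and> P \<subseteq> X \<and> (\<forall>p\<in>P. \<forall>q\<in>P. p \<noteq> q \<longrightarrow> s \<le> d (p - q))" for P
  have "sep {}" by (simp add: sep_def)
  moreover have "card P < Suc B" if "sep P" for P using bound[of P] that by (simp add: sep_def)
  ultimately obtain P where P: "sep P" "\<And>P'. sep P' \<Longrightarrow> card P' \<le> card P"
    using ex_has_greatest_nat[of sep "{}" card "Suc B"] by blast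
  have "\<exists>p\<in>P. d (x - p) < s" if x: "x \<in> X" for x
  proof (rule ccontr)
    assume "\<not> ?thesis"
    then have far: "s \<le> d (x - p)" if "p \<in> P" for p using that by (auto simp: not_less)
    have far': "s \<le> d (p - x)" if "p \<in> P" for p using far[OF that] dm[of "x - p"] by simp
    have "x \<notin> P" using far[of x] d0 s by auto
    moreover have "sep (insert x P)" using P(1) x far far' by (auto simp: sep_def)
    ultimately show False using P(1) P(2)[of "insert x P"] by (simp add: sep_def)
  qed
  then show ?thesis using P(1) by (intro exI[of _ P]) (simp add: sep_def)
qed

context haar_group
begin

lemma seminorm_ball_measurable[measurable]: "group_seminorm d \<Longrightarrow> {x. d x < s} \<in> sets borel"
  by (intro borel_open open_Collect_less) (auto simp: group_seminorm_def)

lemma seminorm_net: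
  assumes d: "group_seminorm d" and r: "0 < r" "0 < measure \<mu> {x. d x < r}"
    and Q: "Q \<in> sets borel" "emeasure \<mu> Q < \<infinity>" "\<And>x z. x \<in> O' \<Longrightarrow> d z < r \<Longrightarrow> x + z \<in> Q"
  shows "\<exists>P. finite P \<and> P \<subseteq> O' \<and> real (card P) * measure \<mu> {x. d x < r} \<le> measure \<mu> Q \<and>
    (\<forall>x\<in>O'. \<exists>p\<in>P. d (x - p) < 2 * r)"
proof -
  define D where "D = {x. d x < r}"
  have Dm: "D \<in> sets borel" unfolding D_def by (rule seminorm_ball_measurable[OF d])
  have dm: "\<And>x. d (- x) = d x" and dt: "\<And>x y. d (x + y) \<le> d x + d y"
    using d by (auto simp: group_seminorm_def)
  have bound: "real (card P) * measure \<mu> D \<le> measure \<mu> Q" 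
    if P: "finite P" "P \<subseteq> O'" "\<forall>p\<in>P. \<forall>q\<in>P. p \<noteq> q \<longrightarrow> 2 * r \<le> d (p - q)" for P
  proof -
    have disj: "disjoint_family_on (\<lambda>p. (+) p ` D) P"
      unfolding disjoint_family_on_def
    proof (intro ballI impI, rule ccontr)
      fix p q assume pq: "p \<in> P" "q \<in> P" "p \<noteq> q" "(+) p ` D \<inter> (+) q ` D \<noteq> {}"
      then obtain a b where ab: "d a < r" "d b < r" "p + a = q + b" by (auto simp: D_def)
      then have "p - q = b + (- a)" by (simp add: algebra_simps)
      then have "d (p - q) < 2 * r" using dt[of b "- a"] ab dm[of a] by simp
      then show False using pq P(3) by force
    qed
    have "(\<Sum>p\<in>P. measure \<mu> ((+) p ` D)) = measure \<mu> (\<Union>p\<in>P. (+) p ` D)"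
    proof (rule measure_finite_Union[symmetric])
      show "emeasure \<mu> ((+) p ` D) \<noteq> \<infinity>" if "p \<in> P" for p
      proof -
        have "(+) p ` D \<subseteq> Q" using that P Q(3) by (auto simp: D_def)
        then show ?thesis using emeasure_mono[of "(+) p ` D" Q \<mu>] Q(1,2) by (auto simp: top_unique)
      qed
    qed (use P disj Dm translate_measurable in auto)
    also have "\<dots> \<le> measure \<mu> Q"
      using P Q by (intro measure_mono_fmeasurable) (auto simp: D_def fmeasurable_def intro!: sets.finite_UN translate_measurable Dm[unfolded D_def])
    finally show ?thesis by (simp add: measure_translate[OF Dm])
  qed
  define N where "N = nat \<lceil>measure \<mu> Q / measure \<mu> D\<rceil>"
  have "card P \<le> N" if P: "finite P" "P \<subseteq> O'" "\<forall>p\<in>P. \<forall>q\<in>P. p \<noteq> q \<longrightarrow> 2 * r \<le> d (p - q)" for P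
  proof -
    have "real (card P) \<le> measure \<mu> Q / measure \<mu> D"
      using bound[OF P] r unfolding D_def[symmetric] by (simp add: pos_le_divide_eq)
    then show ?thesis using real_nat_ceiling_ge[of "measure \<mu> Q / measure \<mu> D"] unfolding N_def by linarith
  qed
  then obtain P where "finite P" "P \<subseteq> O'" "\<forall>p\<in>P. \<forall>q\<in>P. p \<noteq> q \<longrightarrow> 2 * r \<le> d (p - q)" "\<forall>x\<in>O'. \<exists>p\<in>P. d (x - p) < 2 * r"
    using maximal_separated_net[OF d, of "2 * r" O' N] r(1) by auto
  then show ?thesis using bound[of P] unfolding D_def by blast
qed

definition forces_thinness :: "'a set \<Rightarrow> 'a set \<Rightarrow> 'a set \<Rightarrow> real \<Rightarrow> real \<Rightarrow> bool" where
  "forces_thinness U R X \<epsilon> \<eta> \<longleftrightarrow> (\<forall>C K. C \<subseteq> X \<longrightarrow> K \<subseteq> X \<longrightarrow> K \<in> sets borel \<longrightarrow> \<epsilon> \<le> measure \<mu> K \<longrightarrow>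
     (\<forall>c\<in>C. \<forall>k\<in>K. c + k \<notin> U) \<longrightarrow> emeasure \<mu> (\<Union>c\<in>C. (+) c ` R) \<le> ennreal \<eta>)"

text \<open>\<open>U\<close> is a union of at most \<open>\<epsilon> / \<beta>\<close> balls of radius \<open>\<rho>\<close>. Their centres hit every set \<open>T (S, L)\<close>, the union of slightly smaller balls
around the points of \<open>S + L\<close>, for all lists \<open>S\<close> and \<open>L\<close> of length \<open>k\<close> in a net for which this union is large. Suppose that
\<open>C + K\<close> misses \<open>U\<close> and \<open>K\<close> has measure at least \<open>\<epsilon>\<close>. If \<open>C\<close> were not thin, it would contain \<open>k\<close> points whose balls overlap
little; adding \<open>k\<close> suitable points of \<open>K\<close> yields a union of measure about \<open>\<beta> powr (1/4)\<close>. Rounding the points to the net moves each of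
them by less than \<open>2 * r\<close>, so some centre lies within \<open>\<rho>\<close> of a point of \<open>C + K\<close>, a contradiction. The two assumptions on the
measures of smaller balls are used as follows: \<open>inner\<close> makes \<open>k\<close> balls of radius \<open>\<rho>'\<close> almost as large as \<open>k\<close> balls of
radius \<open>\<rho>\<close>, and \<open>tiny\<close> bounds the size of the net and turns powers of \<open>\<beta>\<close> into powers of the measure of the smallest ball.\<close>

lemma thinness_forcing_set:
  fixes d :: "'a \<Rightarrow> real"
  assumes d: "group_seminorm d" and \<rho>: "\<rho> > 0"
    and \<beta>_def: "\<beta> = measure \<mu> {x. d x < \<rho>}" and \<beta>: "0 < \<beta>"
    and fin: "emeasure \<mu> {x. d x < \<rho>} < \<infinity>"
    and inner: "\<beta> powr (5/4) \<le> measure \<mu> {x. d x < 19/20 * \<rho>}"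
    and tiny: "\<beta> powr \<kappa> \<le> measure \<mu> {x. d x < \<rho> / 160}"
    and O': "0 \<in> O'" and Q: "Q \<in> sets borel" "emeasure \<mu> Q < \<infinity>"
    and OQ: "\<And>x y z. x \<in> O' \<Longrightarrow> y \<in> O' \<Longrightarrow> d z < \<rho> \<Longrightarrow> x + y + z \<in> Q"
    and pos: "\<epsilon> > 0" "\<kappa> > 0" and small: "small_enough \<epsilon> (measure \<mu> Q) \<kappa> \<beta>"
  shows "\<exists>U. open U \<and> emeasure \<mu> U \<le> ennreal \<epsilon> \<and>
    forces_thinness U {x. d x < \<rho> / 160} O' \<epsilon> (\<epsilon> * measure \<mu> {x. d x < \<rho> / 160} powr (1 / (4 * \<kappa>)))"
proof -
  define r where "r = \<rho> / 160"
  define \<rho>' where "\<rho>' = 19/20 * \<rho>"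
  define v where "v = measure \<mu> Q"
  define D where "D s = {x. d x < s}" for s
  have Dm[measurable]: "D s \<in> sets borel" for s unfolding D_def by (rule seminorm_ball_measurable[OF d])
  have d0: "d 0 = 0" and dm: "\<And>x. d (- x) = d x" and dt: "\<And>x y. d (x + y) \<le> d x + d y" and dc: "continuous_on UNIV d"
    using d by (auto simp: group_seminorm_def)
  have Dle: "emeasure \<mu> (D s) < \<infinity>" if "s \<le> \<rho>" for s
  proof -
    have "D s \<subseteq> D \<rho>" using that by (auto simp: D_def)
    then show ?thesis using fin emeasure_mono[of "D s" "D \<rho>" \<mu>] by (auto simp: D_def[symmetric] intro: le_less_trans)
  qed
  have rr: "r \<le> \<rho>" "\<rho>' \<le> \<rho>" "\<rho>' + r \<le> \<rho>" "\<rho>' + 8 * r = \<rho>" "r > 0" using \<rho> by (auto simp: r_def \<rho>'_def)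
  have Dr: "\<beta> powr \<kappa> \<le> measure \<mu> (D r)" "0 < measure \<mu> (D r)"
    using tiny \<beta> by (auto simp: D_def r_def intro: less_le_trans[of _ "\<beta> powr \<kappa>"])
  have D\<rho>': "\<beta> powr (5/4) \<le> measure \<mu> (D \<rho>')" using inner by (simp add: D_def \<rho>'_def)
  have D\<rho>'pos: "0 < emeasure \<mu> (D \<rho>')"
    using D\<rho>' \<beta> Dle[OF rr(2)] by (simp add: emeasure_eq_measure) (metis less_le_trans powr_gt_zero less_irrefl)
  have sm: "\<beta> < 1" "\<beta> \<le> \<epsilon>" "\<beta> powr (1/4) \<le> 4 * v" "4 * \<beta> powr (1/4) \<le> \<epsilon>" using small by (auto simp: small_enough_def v_def)
  have vpos: "v > 0" using sm(3) \<beta> by (smt (verit) powr_gt_zero)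
  have vQ: "emeasure \<mu> Q = ennreal v" using Q(2) by (simp add: v_def emeasure_eq_measure)
  obtain P where P: "finite P" "P \<subseteq> O'" "real (card P) * measure \<mu> (D r) \<le> v" "\<forall>x\<in>O'. \<exists>p\<in>P. d (x - p) < 2 * r"
  proof -
    have "x + z \<in> Q" if "x \<in> O'" "d z < r" for x z using OQ[OF that(1) O', of z] that(2) rr(1) by simp
    then show ?thesis using seminorm_net[OF d rr(5) Dr(2)[unfolded D_def] Q, of O'] that unfolding v_def D_def by blast
  qed
  obtain \<pi> where \<pi>: "\<forall>x\<in>O'. \<pi> x \<in> P \<and> d (x - \<pi> x) < 2 * r" using P(4) by metis
  define M where "M = card P"
  have "P \<noteq> {}" using P(4) O' by auto
  then have M1: "1 \<le> M" using P(1) by (simp add: M_def Suc_leI card_gt_0_iff)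
  have M2: "real M \<le> v / \<beta> powr \<kappa>"
  proof -
    have "real M * \<beta> powr \<kappa> \<le> v" using P(3) Dr(1) by (smt (verit) M_def mult_left_mono of_nat_0_le_iff)
    then show ?thesis using \<beta> by (simp add: pos_le_divide_eq)
  qed
  \<comment> \<open>With this length, \<open>2 * k * \<beta>\<close> is about \<open>\<beta> powr (1/2)\<close>, small compared with \<open>\<beta> powr (1/4)\<close>, while \<open>k\<^sup>2\<close> balls of measure
  \<open>\<beta> powr (5/4)\<close> add up to \<open>\<beta> powr (1/4)\<close>.\<close>
  define k where "k = nat \<lceil>\<beta> powr (-1/2)\<rceil>"
  have b1: "1 \<le> \<beta> powr (-1/2)" using \<beta> sm(1) by (simp add: powr_minus_divide powr_le1)
  have k: "\<beta> powr (-1/2) \<le> real k" "real k \<le> 2 * \<beta> powr (-1/2)" using b1 unfolding k_def by linarith+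
  define \<theta> where "\<theta> = \<beta> powr (1/4) / (4 * v)"
  have \<theta>: "0 \<le> \<theta>" "\<theta> \<le> 1" using vpos sm(3) by (auto simp: \<theta>_def)
  define T where "T c = (\<Union>s\<in>set (fst c). \<Union>x\<in>set (snd c). (+) (s + x) ` D (\<rho>' + 4 * r))" for c :: "'a list \<times> 'a list"
  define A where "A = {xs. set xs \<subseteq> P \<and> length xs = k}"
  define \<Omega> where "\<Omega> = {c\<in>A \<times> A. \<theta> * v \<le> measure \<mu> (T c)}"
  have finA: "finite A" unfolding A_def by (rule finite_lists_length_eq[OF P(1)])
  have "card \<Omega> \<le> card (A \<times> A)" unfolding \<Omega>_def by (rule card_mono) (use finA in auto)
  also have "\<dots> = M ^ k * M ^ k" using card_lists_length_eq[OF P(1), of k] by (simp add: card_cartesian_product A_def M_def)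
  finally have card\<Omega>: "card \<Omega> \<le> M ^ k * M ^ k" .
  have Tm: "T c \<in> sets borel" for c unfolding T_def by (intro sets.finite_UN translate_measurable Dm) auto
  have TQ: "T c \<subseteq> Q" if c: "c \<in> A \<times> A" for c
  proof
    fix u assume "u \<in> T c"
    then obtain s x z where "s \<in> set (fst c)" "x \<in> set (snd c)" "d z < \<rho>' + 4 * r" "u = s + x + z"
      by (auto simp: T_def D_def)
    moreover from this have "s \<in> O'" "x \<in> O'" using c P(2) by (auto simp: A_def)
    moreover have "\<rho>' + 4 * r \<le> \<rho>" using rr by simp
    ultimately show "u \<in> Q" using OQ[of s x z] by simp
  qed
  define L where "L = nat \<lfloor>\<epsilon> / \<beta>\<rfloor>"
  obtain us where us: "length us = L" "set us \<subseteq> Q"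
    "real (card {c\<in>\<Omega>. \<forall>u\<in>set us. u \<notin> T c}) \<le> (1 - \<theta>) ^ L * real (card \<Omega>)"
    using hitting_points[of Q \<Omega> \<theta> T L] Q finA \<theta> Tm TQ vpos vQ by (force simp: \<Omega>_def v_def)
  have "(1 - \<theta>) ^ L * real (card \<Omega>) \<le> (1 - \<theta>) ^ L * real (M ^ k * M ^ k)"
    using card\<Omega> \<theta> by (intro mult_left_mono of_nat_mono) auto
  also have "\<dots> < 1" unfolding \<theta>_def L_def
    by (rule few_unhit[OF \<beta> small[folded v_def] pos(1) vpos M1 M2 k(2)])
  finally have "card {c\<in>\<Omega>. \<forall>u\<in>set us. u \<notin> T c} = 0" using us(3) by simp
  moreover have "finite {c\<in>\<Omega>. \<forall>u\<in>set us. u \<notin> T c}" using finA by (auto simp: \<Omega>_def)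
  ultimately have "{c\<in>\<Omega>. \<forall>u\<in>set us. u \<notin> T c} = {}" by (simp only: card_eq_0_iff) blast
  then have hit: "\<exists>u\<in>set us. u \<in> T c" if "c \<in> \<Omega>" for c using that by blast
  define U where "U = (\<Union>u\<in>set us. (+) u ` D \<rho>)"
  have "open U" unfolding U_def translate_eq D_def
    by (intro open_UN ballI) (auto intro!: open_Collect_less continuous_intros continuous_on_compose2[OF dc])
  moreover have "emeasure \<mu> U \<le> ennreal \<epsilon>"
  proof -
    have "emeasure \<mu> U \<le> of_nat L * emeasure \<mu> (D \<rho>)" using emeasure_translates_le[OF Dm[of \<rho>], of us] us(1) by (simp add: U_def)
    also have "emeasure \<mu> (D \<rho>) = ennreal \<beta>" using fin by (simp add: \<beta>_def D_def emeasure_eq_measure)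
    also have "of_nat L * ennreal \<beta> = ennreal (real L * \<beta>)" using \<beta> by (simp add: ennreal_of_nat_eq_real_of_nat ennreal_mult)
    also have "\<dots> \<le> ennreal \<epsilon>"
    proof (rule ennreal_leI)
      have "real L \<le> \<epsilon> / \<beta>" unfolding L_def using \<beta> pos by simp
      then show "real L * \<beta> \<le> \<epsilon>" using \<beta> by (simp add: pos_le_divide_eq)
    qed
    finally show ?thesis .
  qed
  moreover have "emeasure \<mu> (\<Union>c\<in>C. (+) c ` D r) \<le> ennreal (\<epsilon> * measure \<mu> (D r) powr (1 / (4 * \<kappa>)))"
    if C: "C \<subseteq> O'" and K: "K \<subseteq> O'" "K \<in> sets borel" "\<epsilon> \<le> measure \<mu> K" and av: "\<forall>c\<in>C. \<forall>k\<in>K. c + k \<notin> U" for C K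
  proof -
    have "b - y \<in> D \<rho>" if "y \<in> D r" "b \<in> D \<rho>'" for y b
      using that dt[of b "- y"] dm[of y] rr by (auto simp: D_def)
    then consider (many) ss where "length ss = k" "set ss \<subseteq> C" "real k * measure \<mu> (D \<rho>') / 2 \<le> measure \<mu> (\<Union>s\<in>set ss. (+) s ` D \<rho>')"
      | (thin) H where "H \<in> sets borel" "\<forall>a\<in>C. \<forall>y\<in>D r. a + y \<in> H" "emeasure \<mu> H \<le> ennreal (2 * real k * measure \<mu> (D \<rho>))"
      using many_translates_or_thin[OF Dm D\<rho>'pos Dle[OF rr(2)] Dm Dle[OF order_refl], of "D r" k C] by blast
    then show ?thesis
    proof cases
      case thin
      have "2 * real k * measure \<mu> (D \<rho>) \<le> 2 * (2 * \<beta> powr (-1/2)) * \<beta>"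
        using k(2) \<beta> by (simp add: \<beta>_def[folded D_def, symmetric])
      also have "\<dots> = 4 * \<beta> powr (1/4) * \<beta> powr (1/4)"
        using \<beta> powr_add[of \<beta> "-1/2" 1] powr_add[of \<beta> "1/4" "1/4"] by simp
      also have "\<dots> \<le> \<epsilon> * \<beta> powr (1/4)" using sm(4) by (intro mult_right_mono) auto
      also have "\<beta> powr (1/4) = (\<beta> powr \<kappa>) powr (1 / (4 * \<kappa>))" using pos by (simp add: powr_powr)
      also have "\<epsilon> * \<dots> \<le> \<epsilon> * measure \<mu> (D r) powr (1 / (4 * \<kappa>))"
        using Dr(1) pos by (intro mult_left_mono powr_mono2) auto
      finally have "ennreal (2 * real k * measure \<mu> (D \<rho>)) \<le> ennreal (\<epsilon> * measure \<mu> (D r) powr (1 / (4 * \<kappa>)))"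
        by (rule ennreal_leI)
      moreover have "emeasure \<mu> (\<Union>c\<in>C. (+) c ` D r) \<le> emeasure \<mu> H"
        using thin(1,2) by (intro emeasure_mono) auto
      ultimately show ?thesis using thin(3) order_trans by blast
    next
      case many
      define F where "F = (\<Union>s\<in>set ss. (+) s ` D \<rho>')"
      have Fm: "F \<in> sets borel" unfolding F_def by (intro sets.finite_UN translate_measurable Dm) auto
      have "O' \<subseteq> Q"
      proof
        fix x assume "x \<in> O'"
        then show "x \<in> Q" using OQ[OF _ O', of x 0] d0 \<rho> by simp
      qed
      have Kfin: "emeasure \<mu> K < \<infinity>" using K(1) \<open>O' \<subseteq> Q\<close> emeasure_mono[of K Q \<mu>] Q by (auto intro: le_less_trans)
      have "emeasure \<mu> F \<le> of_nat k * emeasure \<mu> (D \<rho>')" using emeasure_translates_le[OF Dm[of \<rho>'], of ss] many(1) by (simp add: F_def)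
      then have Ffin: "emeasure \<mu> F < \<infinity>"
        by (rule le_less_trans) (use Dle[OF rr(2)] in \<open>simp add: ennreal_mult_less_top of_nat_less_top\<close>)
      obtain ks where ks: "length ks = k" "set ks \<subseteq> K"
        "min (\<epsilon> / 2) (real k * measure \<mu> F / 2) \<le> measure \<mu> (\<Union>x\<in>set ks. (+) x ` F)"
        using few_translates_spread[OF K(2) Kfin pos(1) K(3) Fm Ffin, of k] by blast
      define c where "c = (map \<pi> ss, map \<pi> ks)"
      have piP: "\<pi> x \<in> P" "d (x - \<pi> x) < 2 * r" if "x \<in> C \<union> K" for x using \<pi> that C K(1) by auto
      have cA: "c \<in> A \<times> A" using many(1,2) ks(1,2) piP by (auto simp: c_def A_def)
      have sub: "(\<Union>x\<in>set ks. (+) x ` F) \<subseteq> T c"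
      proof -
        have "x + (s + b) \<in> (+) (\<pi> s + \<pi> x) ` D (\<rho>' + 4 * r)" if "x \<in> set ks" "s \<in> set ss" "b \<in> D \<rho>'" for x s b
        proof -
          have "d ((x - \<pi> x) + (s - \<pi> s) + b) < \<rho>' + 4 * r"
            using dt[of "(x - \<pi> x) + (s - \<pi> s)" b] dt[of "x - \<pi> x" "s - \<pi> s"] piP(2)[of x] piP(2)[of s] that ks(2) many(2)
            by (auto simp: D_def subset_iff)
          then show ?thesis by (intro image_eqI[of _ _ "(x - \<pi> x) + (s - \<pi> s) + b"]) (auto simp: D_def algebra_simps)
        qed
        then show ?thesis by (fastforce simp: T_def c_def F_def)
      qed
      have "\<beta> powr (1/4) / 4 \<le> min (\<epsilon> / 2) (real k * measure \<mu> F / 2)"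
      proof -
        have "\<beta> powr (1/4) = \<beta> powr (-1/2) * (\<beta> powr (-1/2) * \<beta> powr (5/4))"
          using \<beta> by (simp add: powr_add[symmetric])
        also have "\<dots> \<le> real k * (real k * measure \<mu> (D \<rho>'))"
          using k(1) D\<rho>' by (intro mult_mono) auto
        also have "\<dots> \<le> real k * (2 * measure \<mu> F)" using many(3) by (intro mult_left_mono) (auto simp: F_def)
        finally have "\<beta> powr (1/4) \<le> real k * (2 * measure \<mu> F)" .
        moreover have "\<beta> powr (1/4) \<le> \<epsilon> * 2" using sm(4) pos(1) by linarith
        ultimately show ?thesis by auto
      qed
      also have "\<dots> \<le> measure \<mu> (T c)"
      proof -
        have "emeasure \<mu> (T c) < \<infinity>"
          using TQ[OF cA] emeasure_mono[of "T c" Q \<mu>] Q by (auto intro: le_less_trans)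
        then have "measure \<mu> (\<Union>x\<in>set ks. (+) x ` F) \<le> measure \<mu> (T c)"
          using Tm[of c] Fm by (intro measure_mono_fmeasurable sub) (auto simp: fmeasurable_def intro!: sets.finite_UN translate_measurable)
        then show ?thesis using ks(3) by linarith
      qed
      finally have "c \<in> \<Omega>" using cA vpos by (simp add: \<Omega>_def \<theta>_def)
      then obtain u where u: "u \<in> set us" "u \<in> T c" using hit by blast
      then obtain s x z where sx: "s \<in> set ss" "x \<in> set ks" "u = \<pi> s + \<pi> x + z" "d z < \<rho>' + 4 * r"
        by (auto simp: T_def c_def D_def)
      have "d ((s - \<pi> s) + (x - \<pi> x) + (- z)) < \<rho>"
        using dt[of "(s - \<pi> s) + (x - \<pi> x)" "- z"] dt[of "s - \<pi> s" "x - \<pi> x"] dm[of z] piP(2)[of x] piP(2)[of s] sx ks(2) many(2) rr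
        by (auto simp: subset_iff)
      then have "s + x \<in> (+) u ` D \<rho>"
        by (intro image_eqI[of _ _ "(s - \<pi> s) + (x - \<pi> x) + (- z)"]) (auto simp: D_def sx(3) algebra_simps)
      then have "s + x \<in> U" using u(1) by (auto simp: U_def)
      moreover have "s \<in> C" "x \<in> K" using sx many(2) ks(2) by auto
      ultimately show ?thesis using av by blast
    qed
  qed
  ultimately show ?thesis
    unfolding forces_thinness_def D_def r_def by (intro exI[of _ U]) simp
qed

end

section \<open>Seminorms with polynomial doubling\<close>

lemma borel_measurable_group_uminus[measurable (raw)]:
  fixes f :: "'b \<Rightarrow> 'a::{second_countable_topology, topological_ab_group_add}"
  assumes "f \<in> borel_measurable M"
  shows "(\<lambda>x. - f x) \<in> borel_measurable M"
  using borel_measurable_group_diff[of "\<lambda>_. 0" M f] assms by simp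

context haar_group
begin

text \<open>A class of functions closed under sums, products and translations on which all integrals below converge.\<close>

definition test_function :: "('a \<Rightarrow> real) \<Rightarrow> bool" where
  "test_function f \<longleftrightarrow> f \<in> borel_measurable borel \<and>
     (\<exists>B S. S \<in> sets borel \<and> emeasure \<mu> S < \<infinity> \<and> (\<forall>x. \<bar>f x\<bar> \<le> B) \<and> (\<forall>x. x \<notin> S \<longrightarrow> f x = 0))"

lemma test_function_measurable[measurable_dest]: "test_function f \<Longrightarrow> f \<in> borel_measurable borel"
  by (simp add: test_function_def)

lemma test_functionI:
  assumes "f \<in> borel_measurable borel" "S \<in> sets borel" "emeasure \<mu> S < \<infinity>" "\<And>x. \<bar>f x\<bar> \<le> B" "\<And>x. x \<notin> S \<Longrightarrow> f x = 0"
  shows "test_function f"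
  using assms unfolding test_function_def by blast

lemma test_functionD:
  assumes "test_function f"
  shows "\<exists>B S. S \<in> sets borel \<and> emeasure \<mu> S < \<infinity> \<and> (\<forall>x. \<bar>f x\<bar> \<le> B) \<and> (\<forall>x. x \<notin> S \<longrightarrow> f x = 0) \<and> B \<ge> 0"
  using assms unfolding test_function_def by (metis abs_ge_zero order_trans)

lemma test_function_integrable:
  assumes "test_function f"
  shows "integrable \<mu> f"
proof -
  have [measurable]: "f \<in> borel_measurable borel" using assms by (rule test_function_measurable)
  obtain B S where "S \<in> sets borel" "emeasure \<mu> S < \<infinity>" "\<forall>x. \<bar>f x\<bar> \<le> B" "\<forall>x. x \<notin> S \<longrightarrow> f x = 0"
    using test_functionD[OF assms] by blast
  then show ?thesis by (intro integrableI_bounded_set[of S _ _ B]) auto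
qed

lemma test_function_mult_bounded:
  assumes "test_function f" and [measurable]: "g \<in> borel_measurable borel" and g: "\<And>x. \<bar>g x\<bar> \<le> B"
  shows "test_function (\<lambda>x. f x * g x)"
proof -
  have [measurable]: "f \<in> borel_measurable borel" using assms(1) by (rule test_function_measurable)
  obtain A S where S: "S \<in> sets borel" "emeasure \<mu> S < \<infinity>" "\<forall>x. \<bar>f x\<bar> \<le> A" "\<forall>x. x \<notin> S \<longrightarrow> f x = 0" "A \<ge> 0"
    using test_functionD[OF assms(1)] by blast
  note S = S(1,2) S(3,4)[rule_format] S(5)
  show ?thesis
  proof (rule test_functionI[of _ S "A * B"])
    show "\<bar>f x * g x\<bar> \<le> A * B" for x unfolding abs_mult using S(3,5) g by (intro mult_mono) auto
  qed (use S in auto)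
qed

lemma test_function_mult:
  assumes f: "test_function f" and g: "test_function g"
  shows "test_function (\<lambda>x. f x * g x)"
proof -
  obtain B where "\<forall>x. \<bar>g x\<bar> \<le> B" using test_functionD[OF g] by blast
  then show ?thesis by (intro test_function_mult_bounded[OF f test_function_measurable[OF g]]) auto
qed

lemma test_function_cmult: "test_function f \<Longrightarrow> test_function (\<lambda>x. c * f x)"
  using test_function_mult_bounded[of f "\<lambda>_. c" "\<bar>c\<bar>"] by (simp add: mult.commute)

lemma test_function_add:
  assumes "test_function f" "test_function g"
  shows "test_function (\<lambda>x. f x + g x)"
proof -
  have [measurable]: "f \<in> borel_measurable borel" using assms(1) by (rule test_function_measurable)
  obtain A S where S: "S \<in> sets borel" "emeasure \<mu> S < \<infinity>" "\<forall>x. \<bar>f x\<bar> \<le> A" "\<forall>x. x \<notin> S \<longrightarrow> f x = 0" "A \<ge> 0"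
    using test_functionD[OF assms(1)] by blast
  note S = S(1,2) S(3,4)[rule_format] S(5)
  have [measurable]: "g \<in> borel_measurable borel" using assms(2) by (rule test_function_measurable)
  obtain B T where T: "T \<in> sets borel" "emeasure \<mu> T < \<infinity>" "\<forall>x. \<bar>g x\<bar> \<le> B" "\<forall>x. x \<notin> T \<longrightarrow> g x = 0" "B \<ge> 0"
    using test_functionD[OF assms(2)] by blast
  note T = T(1,2) T(3,4)[rule_format] T(5)
  show ?thesis
  proof (rule test_functionI[of _ "S \<union> T" "A + B"])
    show "\<bar>f x + g x\<bar> \<le> A + B" for x using S(3)[of x] T(3)[of x] by linarith
    have "emeasure \<mu> (S \<union> T) \<le> emeasure \<mu> S + emeasure \<mu> T" using S T by (intro emeasure_subadditive) auto
    also have "\<dots> < \<infinity>" using S T by simp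
    finally show "emeasure \<mu> (S \<union> T) < \<infinity>" .
  qed (use S T in auto)
qed

lemma test_function_diff: "test_function f \<Longrightarrow> test_function g \<Longrightarrow> test_function (\<lambda>x. f x - g x)"
  using test_function_add[of f "\<lambda>x. (-1) * g x"] test_function_cmult[of g "-1"] by simp

lemma test_function_translate:
  assumes "test_function f"
  shows "test_function (\<lambda>x. f (x - a))"
proof -
  have [measurable]: "f \<in> borel_measurable borel" using assms(1) by (rule test_function_measurable)
  obtain A S where S[measurable]: "S \<in> sets borel" and S'': "emeasure \<mu> S < \<infinity>" "\<forall>x. \<bar>f x\<bar> \<le> A" "\<forall>x. x \<notin> S \<longrightarrow> f x = 0" "A \<ge> 0"
    using test_functionD[OF assms(1)] by blast
  note S' = S''(1) S''(2,3)[rule_format] S''(4)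
  show ?thesis
    by (rule test_functionI[of _ "{x. x - a \<in> S}" A]) (use S' emeasure_translate_vimage(1)[OF S] in \<open>auto\<close>)
qed

definition sqnorm :: "('a \<Rightarrow> real) \<Rightarrow> real" where "sqnorm f = (\<integral>x. f x * f x \<partial>\<mu>)"

lemma sqnorm_nonneg: "0 \<le> sqnorm f" by (simp add: sqnorm_def integral_nonneg_AE)

lemma sqnorm_translate: "test_function f \<Longrightarrow> sqnorm (\<lambda>x. f (x - a)) = sqnorm f"
  unfolding sqnorm_def
  by (rule integral_translate[of "\<lambda>x. f x * f x"]) (intro borel_measurable_times test_function_measurable)

lemma sqnorm_add:
  assumes "test_function f" "test_function g"
  shows "sqnorm (\<lambda>x. f x + g x) = sqnorm f + 2 * (\<integral>x. f x * g x \<partial>\<mu>) + sqnorm g"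
proof -
  have "sqnorm (\<lambda>x. f x + g x) = (\<integral>x. f x * f x + 2 * (f x * g x) + g x * g x \<partial>\<mu>)"
    unfolding sqnorm_def by (rule Bochner_Integration.integral_cong) (auto simp: algebra_simps)
  then show ?thesis using assms by (simp add: sqnorm_def test_function_integrable test_function_mult)
qed

lemma sqnorm_cmult: "sqnorm (\<lambda>x. c * f x) = c\<^sup>2 * sqnorm f"
  unfolding sqnorm_def by (simp add: power2_eq_square algebra_simps flip: integral_mult_right_zero)

lemma sqnorm_minkowski:
  assumes f: "test_function f" and g: "test_function g"
  shows "sqrt (sqnorm (\<lambda>x. f x + g x)) \<le> sqrt (sqnorm f) + sqrt (sqnorm g)"
proof -
  define A B C where "A = sqnorm f" and "B = (\<integral>x. f x * g x \<partial>\<mu>)" and "C = sqnorm g"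
  have nn: "A \<ge> 0" "C \<ge> 0" by (simp_all add: A_def C_def sqnorm_nonneg)
  have quad: "0 \<le> A + 2 * t * B + t\<^sup>2 * C" for t
  proof -
    have "sqnorm (\<lambda>x. f x + t * g x) = A + 2 * (\<integral>x. f x * (t * g x) \<partial>\<mu>) + t\<^sup>2 * C"
      using sqnorm_add[OF f test_function_cmult[OF g, of t]] by (simp add: sqnorm_cmult A_def C_def)
    also have "(\<integral>x. f x * (t * g x) \<partial>\<mu>) = t * B" unfolding B_def by (simp add: mult.left_commute)
    finally show ?thesis using sqnorm_nonneg[of "\<lambda>x. f x + t * g x"] by simp
  qed
  have "B\<^sup>2 \<le> A * C"
  proof (cases "C = 0")
    case True
    have "B = 0"
    proof (rule ccontr)
      assume "B \<noteq> 0"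
      then show False using quad[of "- (A + 1) / (2 * B)"] True by (simp add: field_simps)
    qed
    then show ?thesis using True by simp
  next
    case False
    then have "C > 0" using nn by simp
    then have "0 \<le> A - B\<^sup>2 / C" using quad[of "- B / C"] by (simp add: field_simps power2_eq_square)
    then show ?thesis using \<open>C > 0\<close> by (simp add: field_simps)
  qed
  then have "\<bar>B\<bar> \<le> sqrt (A * C)" by (metis real_sqrt_abs real_sqrt_le_iff)
  then have "B \<le> sqrt A * sqrt C" by (simp add: real_sqrt_mult)
  then have "A + 2 * B + C \<le> (sqrt A + sqrt C)\<^sup>2" using nn by (simp add: power2_sum)
  then have "sqrt (A + 2 * B + C) \<le> sqrt A + sqrt C" using nn by (intro real_le_lsqrt) auto
  then show ?thesis using sqnorm_add[OF f g] by (simp add: A_def B_def C_def)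
qed

lemma continuous_parameter_integral:
  fixes k :: "'a \<Rightarrow> 'a \<Rightarrow> real"
  assumes f: "test_function f" and kc: "\<And>v. continuous_on UNIV (\<lambda>x. k x v)"
    and [measurable]: "\<And>x. k x \<in> borel_measurable borel" and kB: "\<And>x v. \<bar>k x v\<bar> \<le> B"
  shows "continuous_on UNIV (\<lambda>x. \<integral>v. f v * k x v \<partial>\<mu>)"
proof (rule continuous_on_sequentiallyI)
  fix u :: "nat \<Rightarrow> 'a" and a assume ua: "u \<longlonglongrightarrow> a"
  have [measurable]: "f \<in> borel_measurable borel" using f by (rule test_function_measurable)
  show "(\<lambda>n. \<integral>v. f v * k (u n) v \<partial>\<mu>) \<longlonglongrightarrow> (\<integral>v. f v * k a v \<partial>\<mu>)"
  proof (rule integral_dominated_convergence[where w = "\<lambda>v. \<bar>f v\<bar> * B"])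
    show "integrable \<mu> (\<lambda>v. \<bar>f v\<bar> * B)" using test_function_integrable[OF f] by simp
    have "(\<lambda>n. k (u n) v) \<longlonglongrightarrow> k a v" for v
      using continuous_on_tendsto_compose[OF kc[of v] ua] by simp
    then show "AE v in \<mu>. (\<lambda>n. f v * k (u n) v) \<longlonglongrightarrow> f v * k a v" by (intro AE_I2 tendsto_mult tendsto_const)
    show "AE v in \<mu>. norm (f v * k (u n) v) \<le> \<bar>f v\<bar> * B" for n
      using kB by (intro AE_I2) (auto simp: abs_mult intro: mult_left_mono)
  qed measurable
qed

lemma integral_pos_if_pos_on_open:
  assumes f: "test_function f" "\<And>x. 0 \<le> f x" and S: "open S" "S \<noteq> {}" "\<And>x. x \<in> S \<Longrightarrow> 0 < f x"
  shows "0 < (\<integral>x. f x \<partial>\<mu>)"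
proof -
  have "(\<integral>x. f x \<partial>\<mu>) \<noteq> 0"
  proof
    assume "(\<integral>x. f x \<partial>\<mu>) = 0"
    then have "AE x in \<mu>. f x = 0"
      using integral_nonneg_eq_0_iff_AE[OF test_function_integrable[OF f(1)]] f(2) by simp
    then obtain x where "x \<in> S" "f x = 0" by (rule AE_obtain_in_open[OF _ S(1,2)])
    then show False using S(3)[of x] by simp
  qed
  moreover have "0 \<le> (\<integral>x. f x \<partial>\<mu>)" using f(2) by simp
  ultimately show ?thesis by simp
qed

end

text \<open>A bump \<open>h\<close> supported in a small symmetric neighbourhood \<open>V\<close>; its translates by the elements of \<open>V\<close> will be averaged.\<close>

locale averaged_bump = haar_group +
  fixes V N :: "'a set" and h :: "'a \<Rightarrow> real"
  assumes V: "open V" "0 \<in> V" "\<And>a. a \<in> V \<Longrightarrow> - a \<in> V"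
    and VN: "V \<subseteq> N" "\<And>a b. a \<in> V \<Longrightarrow> b \<in> V \<Longrightarrow> a + b \<in> N"
      "\<And>a b c d. a \<in> V \<Longrightarrow> b \<in> V \<Longrightarrow> c \<in> V \<Longrightarrow> d \<in> V \<Longrightarrow> a + b + c + d \<in> N"
    and N: "open N" "emeasure \<mu> N < \<infinity>"
    and h: "continuous_on UNIV h" "\<And>x. 0 \<le> h x" "\<And>x. h x \<le> 1" "\<And>x. x \<notin> V \<Longrightarrow> h x = 0" "h 0 > 0"
begin

definition vol where "vol = measure \<mu> V"

definition \<phi> where "\<phi> x = (\<integral>v. indicator V v * h (x - v) \<partial>\<mu>) / vol"

lemma Vfin: "emeasure \<mu> V < \<infinity>"
  using emeasure_mono[OF VN(1), of \<mu>] N by (auto intro: le_less_trans)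

lemma vol_pos: "vol > 0"
  using emeasure_open_pos[OF V(1)] V(2) Vfin unfolding vol_def
  by (auto simp: measure_def enn2real_positive_iff)

lemma h_measurable[measurable]: "h \<in> borel_measurable borel"
  using h(1) by (rule borel_measurable_continuous_onI)

lemma h_abs: "\<bar>h x\<bar> \<le> 1" using h(2,3)[of x] by simp

lemma h_shift_continuous: "continuous_on UNIV (\<lambda>x. h (x - v))" "continuous_on UNIV (\<lambda>v. h (x - v))"
proof -
  show "continuous_on UNIV (\<lambda>x. h (x - v))" by (rule continuous_on_compose2[OF h(1)]) (auto intro: continuous_intros)
  show "continuous_on UNIV (\<lambda>v. h (x - v))" by (rule continuous_on_compose2[OF h(1)]) (auto intro: continuous_intros)
qed

lemma V_sets[measurable]: "V \<in> sets borel" and N_sets[measurable]: "N \<in> sets borel"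
  using V(1) N(1) by auto

lemma test_function_h: "test_function h"
  by (rule test_functionI[of _ V 1]) (use Vfin h_abs h(4) in auto)

lemma test_function_indicator_V: "test_function (indicator V)"
  by (rule test_functionI[of _ V 1]) (use Vfin in \<open>auto simp: indicator_def\<close>)

lemma \<phi>_continuous: "continuous_on UNIV \<phi>"
  unfolding \<phi>_def[abs_def]
  by (intro continuous_intros continuous_parameter_integral[OF test_function_indicator_V, where B = 1])
    (use vol_pos h_shift_continuous h_abs in \<open>auto\<close>)

lemma \<phi>_measurable[measurable]: "\<phi> \<in> borel_measurable borel"
  using \<phi>_continuous by (rule borel_measurable_continuous_onI)

lemma integrable_kernel: "integrable \<mu> (\<lambda>v. indicator V v * h (x - v))"
  by (intro test_function_integrable test_function_mult_bounded[OF test_function_indicator_V, of _ 1])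
    (auto simp: h_abs)

lemma \<phi>_nonneg: "0 \<le> \<phi> x"
  unfolding \<phi>_def using vol_pos h(2) by (intro divide_nonneg_pos integral_nonneg_AE) (auto simp: indicator_def)

lemma \<phi>_le_1: "\<phi> x \<le> 1"
proof -
  have "(\<integral>v. indicator V v * h (x - v) \<partial>\<mu>) \<le> (\<integral>v. indicator V v \<partial>\<mu>)"
  proof (rule integral_mono[OF integrable_kernel test_function_integrable[OF test_function_indicator_V]])
    show "indicator V v * h (x - v) \<le> indicator V v" for v using h(3)[of "x - v"] by (auto simp: indicator_def)
  qed
  then show ?thesis using vol_pos by (simp add: \<phi>_def vol_def)
qed

lemma \<phi>_abs: "\<bar>\<phi> x\<bar> \<le> 1" using \<phi>_nonneg[of x] \<phi>_le_1[of x] by simp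

lemma \<phi>_support: "\<phi> x \<noteq> 0 \<Longrightarrow> \<exists>a\<in>V. \<exists>b\<in>V. x = a + b"
proof (rule ccontr)
  assume "\<phi> x \<noteq> 0" and no: "\<not> (\<exists>a\<in>V. \<exists>b\<in>V. x = a + b)"
  have "indicator V v * h (x - v) = (0::real)" for v
  proof (cases "v \<in> V")
    case True
    then have "x - v \<notin> V" using no by (metis add.commute diff_add_cancel)
    then show ?thesis by (simp add: h(4))
  qed simp
  then have "(\<lambda>v. indicator V v * h (x - v)) = (\<lambda>v. 0::real)" by (rule ext)
  then show False using \<open>\<phi> x \<noteq> 0\<close> by (simp add: \<phi>_def)
qed

lemma test_function_\<phi>: "test_function \<phi>"
  by (rule test_functionI[of _ N 1]) (use N \<phi>_abs \<phi>_support VN(2) in \<open>auto\<close>)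

lemma sqnorm_\<phi>_pos: "sqnorm \<phi> > 0"
proof -
  have "0 < (\<integral>v. indicator V v * h (0 - v) \<partial>\<mu>)"
  proof (rule integral_pos_if_pos_on_open[of _ "V \<inter> {v. 0 < h (0 - v)}"])
    show "test_function (\<lambda>v. indicator V v * h (0 - v))"
      by (rule test_function_mult_bounded[OF test_function_indicator_V, of _ 1]) (auto simp: h_abs)
    show "open (V \<inter> {v. 0 < h (0 - v)})"
      using V(1) h_shift_continuous(2)[of 0] by (intro open_Int open_Collect_less) (auto intro: continuous_intros)
    have "0 \<in> V \<inter> {v. 0 < h (0 - v)}" using V(2) h(5) by simp
    then show "V \<inter> {v. 0 < h (0 - v)} \<noteq> {}" by blast
  qed (auto simp: h(2))
  then have pos0: "0 < \<phi> 0" using vol_pos by (simp add: \<phi>_def)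
  show ?thesis unfolding sqnorm_def
  proof (rule integral_pos_if_pos_on_open[of _ "{x. 0 < \<phi> x}"])
    show "open {x. 0 < \<phi> x}" using \<phi>_continuous by (intro open_Collect_less) (auto intro: continuous_intros)
    show "{x. 0 < \<phi> x} \<noteq> {}" using pos0 by blast
  qed (use \<phi>_nonneg test_function_mult[OF test_function_\<phi> test_function_\<phi>] in auto)
qed

lemma sqnorm_h_pos: "sqnorm h > 0"
  unfolding sqnorm_def
proof (rule integral_pos_if_pos_on_open[of _ "{x. 0 < h x}"])
  show "open {x. 0 < h x}" using h(1) by (intro open_Collect_less) (auto intro: continuous_intros)
  show "{x. 0 < h x} \<noteq> {}" using h(5) by blast
qed (use h(2) test_function_mult[OF test_function_h test_function_h] in auto)

text \<open>In the weak sense, the average of the translates of \<open>h\<close> by \<open>y + V\<close> is the translate of \<open>\<phi>\<close> by \<open>y\<close>.\<close>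

lemma average_inner_product:
  assumes f: "test_function f"
  shows "(\<integral>v. indicator V (v - y) * (\<integral>x. f x * h (x - v) \<partial>\<mu>) \<partial>\<mu>) = vol * (\<integral>x. f x * \<phi> (x - y) \<partial>\<mu>)"
proof -
  have [measurable]: "f \<in> borel_measurable borel" using assms(1) by (rule test_function_measurable)
  obtain A S where S[measurable]: "S \<in> sets borel" and S'': "emeasure \<mu> S < \<infinity>" "\<forall>x. \<bar>f x\<bar> \<le> A" "\<forall>x. x \<notin> S \<longrightarrow> f x = 0" "A \<ge> 0"
    using test_functionD[OF assms(1)] by blast
  note S' = S''(1) S''(2,3)[rule_format] S''(4)
  let ?F = "\<lambda>v x. indicator V (v - y) * (f x * h (x - v)) :: real"
  have "integrable (\<mu> \<Otimes>\<^sub>M \<mu>) (case_prod ?F)"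
  proof (rule integrableI_bounded_set[of "{v. v - y \<in> V} \<times> S" _ _ A])
    show "emeasure (\<mu> \<Otimes>\<^sub>M \<mu>) ({v. v - y \<in> V} \<times> S) < \<infinity>"
      using Vfin S' by (simp add: emeasure_pair_measure_Times emeasure_translate_vimage ennreal_mult_less_top)
    have "\<bar>indicator V (v - y) * (f x * h (x - v))\<bar> \<le> A" for v x
      using mult_mono[OF S'(2)[of x] h_abs[of "x - v"]] S'(4) by (auto simp: indicator_def abs_mult)
    then show "AE x in \<mu> \<Otimes>\<^sub>M \<mu>. x \<in> {v. v - y \<in> V} \<times> S \<longrightarrow> norm (case_prod ?F x) \<le> A"
      by (intro AE_I2) (simp only: case_prod_beta real_norm_def simp_thms)
    show "AE x in \<mu> \<Otimes>\<^sub>M \<mu>. x \<notin> {v. v - y \<in> V} \<times> S \<longrightarrow> case_prod ?F x = 0"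
      using S'(3) by (intro AE_I2) (auto simp: indicator_def split: prod.split)
  qed measurable
  then have "(\<integral>v. (\<integral>x. ?F v x \<partial>\<mu>) \<partial>\<mu>) = (\<integral>x. (\<integral>v. ?F v x \<partial>\<mu>) \<partial>\<mu>)"
    by (rule pair.Fubini_integral[symmetric])
  also have "\<dots> = (\<integral>x. vol * (f x * \<phi> (x - y)) \<partial>\<mu>)"
  proof (rule Bochner_Integration.integral_cong[OF refl])
    fix x
    have "(\<integral>v. ?F v x \<partial>\<mu>) = f x * (\<integral>v. indicator V (v - y) * h ((x - y) - (v - y)) \<partial>\<mu>)"
      by (simp add: mult.left_commute)
    also have "(\<integral>v. indicator V (v - y) * h ((x - y) - (v - y)) \<partial>\<mu>) = (\<integral>v. indicator V v * h ((x - y) - v) \<partial>\<mu>)"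
      by (rule integral_translate) measurable
    also have "\<dots> = vol * \<phi> (x - y)" using vol_pos by (simp add: \<phi>_def)
    finally show "(\<integral>v. ?F v x \<partial>\<mu>) = vol * (f x * \<phi> (x - y))" by (simp add: mult_ac)
  qed
  finally show ?thesis by simp
qed

text \<open>If \<open>s\<close> is a sum of \<open>l\<close> translates of \<open>h\<close>, this measures how well \<open>s / l\<close> approximates the translate of \<open>\<phi>\<close> by \<open>y\<close>.\<close>

definition err where "err s l y = sqnorm (\<lambda>x. s x - real l * \<phi> (x - y))"

lemma test_function_residual: "test_function s \<Longrightarrow> test_function (\<lambda>x. s x - c * \<phi> (x - y))"
  by (intro test_function_diff test_function_cmult test_function_translate test_function_\<phi>)

text \<open>Adding to \<open>s\<close> the translate of \<open>h\<close> by a random \<open>v \<in> y + V\<close> increases the expected error by at most the variance of one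
summand, because its mean is the translate of \<open>\<phi>\<close> by \<open>y\<close>.\<close>

lemma err_average:
  assumes s: "test_function s"
  shows "integrable \<mu> (\<lambda>v. indicator V (v - y) * err (\<lambda>x. s x + h (x - v)) (Suc l) y)"
    and "(\<integral>v. indicator V (v - y) * err (\<lambda>x. s x + h (x - v)) (Suc l) y \<partial>\<mu>) \<le> vol * (err s l y + sqnorm h)"
proof -
  define g where "g x = s x - real (Suc l) * \<phi> (x - y)" for x
  have g: "test_function g" unfolding g_def by (rule test_function_residual[OF s])
  have py: "test_function (\<lambda>x. \<phi> (x - y))" by (intro test_function_translate test_function_\<phi>)
  have expand: "err (\<lambda>x. s x + h (x - v)) (Suc l) y = sqnorm g + sqnorm h + 2 * (\<integral>x. g x * h (x - v) \<partial>\<mu>)" for v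
  proof -
    have "err (\<lambda>x. s x + h (x - v)) (Suc l) y = sqnorm (\<lambda>x. g x + h (x - v))"
      unfolding err_def g_def by (simp add: algebra_simps)
    then show ?thesis using sqnorm_add[OF g test_function_translate[OF test_function_h, of v]]
      by (simp add: sqnorm_translate[OF test_function_h])
  qed
  have Vy: "test_function (\<lambda>v. indicator V (v - y))" by (rule test_function_translate[OF test_function_indicator_V])
  have cI: "continuous_on UNIV (\<lambda>v. \<integral>x. g x * h (x - v) \<partial>\<mu>)"
    by (rule continuous_parameter_integral[OF g, where B = 1]) (auto simp: h_abs h_shift_continuous)
  have bI: "\<bar>\<integral>x. g x * h (x - v) \<partial>\<mu>\<bar> \<le> (\<integral>x. \<bar>g x\<bar> \<partial>\<mu>)" for v
  proof -
    have "\<bar>\<integral>x. g x * h (x - v) \<partial>\<mu>\<bar> \<le> (\<integral>x. \<bar>g x * h (x - v)\<bar> \<partial>\<mu>)" by (rule integral_abs_bound)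
    also have "\<dots> \<le> (\<integral>x. \<bar>g x\<bar> \<partial>\<mu>)"
    proof (rule integral_mono)
      show "integrable \<mu> (\<lambda>x. \<bar>g x * h (x - v)\<bar>)"
        by (intro integrable_abs test_function_integrable test_function_mult g test_function_translate test_function_h)
      show "integrable \<mu> (\<lambda>x. \<bar>g x\<bar>)" by (intro integrable_abs test_function_integrable g)
      show "\<bar>g x * h (x - v)\<bar> \<le> \<bar>g x\<bar>" for x using mult_left_mono[OF h_abs[of "x - v"], of "\<bar>g x\<bar>"] by (simp add: abs_mult)
    qed
    finally show ?thesis .
  qed
  have I1: "integrable \<mu> (\<lambda>v. indicator V (v - y) * (\<integral>x. g x * h (x - v) \<partial>\<mu>))"
    by (rule test_function_integrable, rule test_function_mult_bounded[OF Vy _ bI])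
      (rule borel_measurable_continuous_onI[OF cI])
  have I2: "integrable \<mu> (\<lambda>v. indicator V (v - y) :: real)" by (rule test_function_integrable[OF Vy])
  have eq: "(\<lambda>v. indicator V (v - y) * err (\<lambda>x. s x + h (x - v)) (Suc l) y) =
    (\<lambda>v. (sqnorm g + sqnorm h) * indicator V (v - y) + 2 * (indicator V (v - y) * (\<integral>x. g x * h (x - v) \<partial>\<mu>)))"
    by (simp add: expand algebra_simps)
  show "integrable \<mu> (\<lambda>v. indicator V (v - y) * err (\<lambda>x. s x + h (x - v)) (Suc l) y)"
    unfolding eq using I1 I2 by simp
  have "(\<integral>v. indicator V (v - y) \<partial>\<mu>) = vol"
    using integral_translate[of "indicator V" y] by (simp add: vol_def)
  then have "(\<integral>v. indicator V (v - y) * err (\<lambda>x. s x + h (x - v)) (Suc l) y \<partial>\<mu>) =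
    vol * (sqnorm g + sqnorm h + 2 * (\<integral>x. g x * \<phi> (x - y) \<partial>\<mu>))"
    unfolding eq using I1 I2 by (simp add: average_inner_product[OF g] algebra_simps)
  also have "sqnorm g + 2 * (\<integral>x. g x * \<phi> (x - y) \<partial>\<mu>) = err s l y - sqnorm \<phi>"
  proof -
    have "err s l y = sqnorm (\<lambda>x. g x + \<phi> (x - y))" unfolding err_def g_def by (simp add: algebra_simps)
    then show ?thesis using sqnorm_add[OF g py] by (simp add: sqnorm_translate[OF test_function_\<phi>])
  qed
  then have "sqnorm g + sqnorm h + 2 * (\<integral>x. g x * \<phi> (x - y) \<partial>\<mu>) \<le> err s l y + sqnorm h"
    using sqnorm_nonneg[of \<phi>] by linarith
  finally show "(\<integral>v. indicator V (v - y) * err (\<lambda>x. s x + h (x - v)) (Suc l) y \<partial>\<mu>) \<le> vol * (err s l y + sqnorm h)"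
    using vol_pos by simp
qed

text \<open>A common \<open>v\<close> for all \<open>y \<in> V\<close> has to be drawn from \<open>N\<close>, which contains \<open>V + V\<close>, and it falls into a given \<open>y + V\<close> with
probability \<open>vol / measure \<mu> N\<close> only. The factor 2 leaves room for choosing a \<open>v\<close> that is better than average.\<close>

definition loss where "loss = 2 * measure \<mu> N / vol"

lemma loss_ge_2: "loss \<ge> 2"
proof -
  have "vol \<le> measure \<mu> N" unfolding vol_def using VN(1) N by (intro measure_mono_fmeasurable) (auto simp: fmeasurable_def)
  then show ?thesis using vol_pos by (simp add: loss_def pos_le_divide_eq)
qed

text \<open>The error is compared with a bound that grows by \<open>sqnorm h\<close> in every step, plus one initial unit. Only the sum over \<open>Y\<close> is
controlled, so that one sequence of translates serves many \<open>y\<close> simultaneously; the elements that it does not serve are dropped.\<close>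

definition credit where "credit s l Y = (\<Sum>y\<in>Y. real (Suc l) * sqnorm h - err s l y)"

lemma credit_step:
  assumes s: "test_function s" and Y: "finite Y" "Y \<subseteq> V" and pos: "0 < credit s l Y"
  shows "\<exists>s' Y'. test_function s' \<and> Y' \<subseteq> Y \<and> credit s l Y / loss \<le> credit s' (Suc l) Y'"
proof -
  define C where "C = sqnorm h"
  define sv where "sv v = (\<lambda>x. s x + h (x - v))" for v
  define J where "J v = (\<Sum>y\<in>Y. indicator V (v - y) * (real (Suc (Suc l)) * C) - indicator V (v - y) * err (sv v) (Suc l) y)" for v
  have Vy: "test_function (\<lambda>v. indicator V (v - y))" for y by (rule test_function_translate[OF test_function_indicator_V])
  have I2: "(\<integral>v. indicator V (v - y) \<partial>\<mu>) = vol" for y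
    using integral_translate[of "indicator V" y] by (simp add: vol_def)
  have Jint: "integrable \<mu> J" unfolding J_def sv_def
    by (intro Bochner_Integration.integrable_sum Bochner_Integration.integrable_diff err_average(1)[OF s]
        integrable_mult_left test_function_integrable Vy)
  have "vol * credit s l Y = (\<Sum>y\<in>Y. vol * (real (Suc (Suc l)) * C) - vol * (err s l y + C))"
    unfolding credit_def C_def by (simp add: sum_distrib_left algebra_simps)
  also have "\<dots> \<le> (\<Sum>y\<in>Y. vol * (real (Suc (Suc l)) * C) - (\<integral>v. indicator V (v - y) * err (sv v) (Suc l) y \<partial>\<mu>))"
    using err_average(2)[OF s] by (intro sum_mono diff_left_mono) (auto simp: sv_def C_def)
  also have "\<dots> = (\<integral>v. J v \<partial>\<mu>)"
    unfolding J_def using err_average(1)[OF s] test_function_integrable[OF Vy] I2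
    by (subst Bochner_Integration.integral_sum) (auto simp: sv_def)
  finally have ge: "vol * credit s l Y \<le> (\<integral>v. J v \<partial>\<mu>)" .
  have J0: "J v = 0" if "v \<notin> N" for v
  proof -
    have "v - y \<notin> V" if "y \<in> Y" for y
    proof
      assume "v - y \<in> V"
      then have "(v - y) + y \<in> N" using VN(2) that Y(2) by blast
      then show False using \<open>v \<notin> N\<close> by simp
    qed
    then show ?thesis by (simp add: J_def)
  qed
  have "\<exists>v. credit s l Y / loss \<le> J v"
  proof (rule ccontr)
    assume "\<not> ?thesis"
    then have lt: "J v \<le> credit s l Y / loss" for v by (auto simp: not_le less_imp_le)
    have "J v \<le> (credit s l Y / loss) * indicator N v" for v using lt[of v] J0[of v] by (cases "v \<in> N") auto
    then have "(\<integral>v. J v \<partial>\<mu>) \<le> (\<integral>v. (credit s l Y / loss) * indicator N v \<partial>\<mu>)"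
      using N by (intro integral_mono Jint integrable_mult_right) (auto simp: integrable_indicator_iff)
    also have "\<dots> = credit s l Y / loss * measure \<mu> N" by simp
    also have "\<dots> = vol * credit s l Y / 2"
      using loss_ge_2 vol_pos by (simp add: loss_def field_simps)
    finally have "vol * credit s l Y \<le> vol * credit s l Y / 2" using ge by simp
    moreover have "0 < vol * credit s l Y" using pos vol_pos by simp
    ultimately show False by simp
  qed
  then obtain v where v: "credit s l Y / loss \<le> J v" by blast
  have "J v = credit (sv v) (Suc l) {y\<in>Y. v - y \<in> V}"
  proof -
    have "J v = (\<Sum>y\<in>Y. if v - y \<in> V then real (Suc (Suc l)) * C - err (sv v) (Suc l) y else 0)"
      unfolding J_def by (intro sum.cong) (auto simp: indicator_def)
    also have "\<dots> = (\<Sum>y\<in>{y\<in>Y. v - y \<in> V}. real (Suc (Suc l)) * C - err (sv v) (Suc l) y)"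
      by (rule sum.inter_filter[symmetric, OF Y(1)])
    finally show ?thesis by (simp add: credit_def C_def)
  qed
  moreover have "test_function (sv v)" unfolding sv_def by (intro test_function_add s test_function_translate test_function_h)
  ultimately show ?thesis using v by (intro exI[of _ "sv v"] exI[of _ "{y\<in>Y. v - y \<in> V}"]) auto
qed

lemma credit_iterate:
  assumes Y: "finite Y" "Y \<subseteq> V" "Y \<noteq> {}"
  shows "\<exists>s Y'. test_function s \<and> Y' \<subseteq> Y \<and> sqnorm h * real (card Y) / loss ^ l \<le> credit s l Y'"
proof (induction l)
  case 0
  have "test_function (\<lambda>_. 0)" by (rule test_functionI[of _ "{}" 0]) auto
  moreover have "credit (\<lambda>_. 0) 0 Y = sqnorm h * real (card Y)" by (simp add: credit_def err_def sqnorm_def)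
  ultimately show ?case by (intro exI[of _ "\<lambda>_. 0"] exI[of _ Y]) auto
next
  case (Suc l)
  then obtain s Y' where s: "test_function s" "Y' \<subseteq> Y" "sqnorm h * real (card Y) / loss ^ l \<le> credit s l Y'" by blast
  have "0 < sqnorm h * real (card Y) / loss ^ l" using sqnorm_h_pos Y loss_ge_2 by (simp add: card_gt_0_iff)
  then have "0 < credit s l Y'" using s(3) by linarith
  then obtain s' Y'' where s': "test_function s'" "Y'' \<subseteq> Y'" "credit s l Y' / loss \<le> credit s' (Suc l) Y''"
    using credit_step[OF s(1), of Y' l] finite_subset[OF s(2) Y(1)] s(2) Y(2) by blast
  have "sqnorm h * real (card Y) / loss ^ Suc l = (sqnorm h * real (card Y) / loss ^ l) / loss" by simp
  also have "\<dots> \<le> credit s l Y' / loss" using s(3) loss_ge_2 by (intro divide_right_mono) auto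
  also note s'(3)
  finally show ?case using s s' by blast
qed

definition dist_sq where "dist_sq z = sqnorm (\<lambda>x. \<phi> (x - z) - \<phi> x)"

lemma dist_sq_diff: "dist_sq (y - y') = sqnorm (\<lambda>x. \<phi> (x - y) - \<phi> (x - y'))"
proof -
  have "sqnorm (\<lambda>x. \<phi> ((x - y') - (y - y')) - \<phi> (x - y')) = dist_sq (y - y')"
    unfolding dist_sq_def
    by (rule sqnorm_translate) (intro test_function_diff test_function_translate test_function_\<phi>)
  then show ?thesis by (simp add: algebra_simps)
qed

text \<open>After \<open>l\<close> steps the translates of \<open>\<phi>\<close> by the remaining points with positive credit are all approximated by the same
function \<open>s / l\<close>, with squared error at most about \<open>sqnorm h / l\<close>. Two \<open>\<delta>\<close>-separated points cannot both be among them once \<open>l\<close> exceeds a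
multiple of \<open>1 / \<delta>\<close>, so at most one is left, while the total credit has shrunk by no more than \<open>loss ^ l\<close>.\<close>

lemma packing_bound:
  assumes Y: "finite Y" "Y \<subseteq> V" and sep: "\<And>y y'. y \<in> Y \<Longrightarrow> y' \<in> Y \<Longrightarrow> y \<noteq> y' \<Longrightarrow> \<delta> \<le> dist_sq (y - y')"
    and l: "4 * real (Suc l) * sqnorm h < (real l)\<^sup>2 * \<delta>"
  shows "real (card Y) \<le> loss ^ l * real (Suc l)"
proof (cases "Y = {}")
  case False
  then obtain s Y' where s: "test_function s" "Y' \<subseteq> Y" "sqnorm h * real (card Y) / loss ^ l \<le> credit s l Y'"
    using credit_iterate[OF Y False, of l] by blast
  define C where "C = real (Suc l) * sqnorm h"
  define P where "P = {y\<in>Y'. err s l y < C}"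
  have finY': "finite Y'" using s(2) Y(1) finite_subset by blast
  have uniq: "y = y'" if "y \<in> P" "y' \<in> P" for y y'
  proof (rule ccontr)
    assume ne: "y \<noteq> y'"
    define f where "f y = (\<lambda>x. s x - real l * \<phi> (x - y))" for y
    have f: "test_function (f y)" for y unfolding f_def by (rule test_function_residual[OF s(1)])
    have "(real l)\<^sup>2 * \<delta> \<le> (real l)\<^sup>2 * dist_sq (y - y')"
      using sep[of y y'] ne that s(2) by (intro mult_left_mono) (auto simp: P_def)
    also have "\<dots> = sqnorm (\<lambda>x. real l * (\<phi> (x - y) - \<phi> (x - y')))" by (simp only: dist_sq_diff sqnorm_cmult)
    also have "\<dots> = sqnorm (\<lambda>x. f y' x - f y x)" by (simp add: f_def algebra_simps)
    also have "\<dots> \<le> 2 * sqnorm (f y') + 2 * sqnorm (f y)"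
    proof -
      have "sqnorm (\<lambda>x. f y' x - f y x) \<le> (\<integral>x. 2 * (f y' x * f y' x) + 2 * (f y x * f y x) \<partial>\<mu>)"
        unfolding sqnorm_def
      proof (rule integral_mono)
        show "integrable \<mu> (\<lambda>x. (f y' x - f y x) * (f y' x - f y x))"
          by (intro test_function_integrable test_function_mult test_function_diff f)
        show "integrable \<mu> (\<lambda>x. 2 * (f y' x * f y' x) + 2 * (f y x * f y x))"
          by (intro test_function_integrable test_function_add test_function_cmult test_function_mult f)
        show "(f y' x - f y x) * (f y' x - f y x) \<le> 2 * (f y' x * f y' x) + 2 * (f y x * f y x)" for x
          using zero_le_square[of "f y' x + f y x"] by (simp add: algebra_simps)
      qed
      then show ?thesis using f by (simp add: sqnorm_def test_function_integrable test_function_mult)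
    qed
    also have "\<dots> < 4 * C" using that by (simp add: P_def f_def err_def)
    finally show False using l by (simp add: C_def algebra_simps)
  qed
  have "finite P" using finY' by (simp add: P_def)
  then have cardP: "card P \<le> 1" using card_le_Suc0_iff_eq[of P] uniq by auto
  have "credit s l Y' \<le> (\<Sum>y\<in>P. C - err s l y)"
  proof -
    have "credit s l Y' = (\<Sum>y\<in>P. C - err s l y) + (\<Sum>y\<in>Y' - P. C - err s l y)"
      unfolding credit_def C_def[symmetric] using finY' sum.subset_diff[of P Y' "\<lambda>y. C - err s l y"] by (auto simp: P_def)
    moreover have "(\<Sum>y\<in>Y' - P. C - err s l y) \<le> 0" by (intro sum_nonpos) (auto simp: P_def)
    ultimately show ?thesis by simp
  qed
  also have "\<dots> \<le> (\<Sum>y\<in>P. C)" by (intro sum_mono) (simp add: err_def sqnorm_nonneg)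
  also have "\<dots> \<le> 1 * C" using cardP sqnorm_h_pos by (simp add: C_def mult_le_cancel_right1)
  finally have "sqnorm h * real (card Y) / loss ^ l \<le> sqnorm h * real (Suc l)" using s(3) by (simp add: C_def mult.commute)
  then have "sqnorm h * real (card Y) \<le> sqnorm h * (loss ^ l * real (Suc l))" using loss_ge_2 by (simp add: divide_le_eq mult_ac)
  then show ?thesis using sqnorm_h_pos by simp
qed (use loss_ge_2 in simp)

lemma dist_sq_expand: "dist_sq z = 2 * sqnorm \<phi> - 2 * (\<integral>x. \<phi> x * \<phi> (x - z) \<partial>\<mu>)"
proof -
  have "sqnorm (\<lambda>x. \<phi> (x - z) + (-1) * \<phi> x) = sqnorm (\<lambda>x. \<phi> (x - z)) + 2 * (\<integral>x. \<phi> (x - z) * ((-1) * \<phi> x) \<partial>\<mu>) + sqnorm (\<lambda>x. (-1) * \<phi> x)"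
    by (rule sqnorm_add) (intro test_function_translate test_function_cmult test_function_\<phi>)+
  then show ?thesis
    unfolding dist_sq_def sqnorm_cmult sqnorm_translate[OF test_function_\<phi>] by (simp add: mult.commute)
qed

lemma seminorm_sqrt_dist_sq: "group_seminorm (\<lambda>z. sqrt (dist_sq z))"
proof -
  have "continuous_on UNIV (\<lambda>z. \<integral>x. \<phi> x * \<phi> (x - z) \<partial>\<mu>)"
  proof (rule continuous_parameter_integral[OF test_function_\<phi>, where B = 1])
    show "continuous_on UNIV (\<lambda>z. \<phi> (x - z))" for x
      by (rule continuous_on_compose2[OF \<phi>_continuous]) (auto intro: continuous_intros)
  qed (auto simp: \<phi>_abs)
  then have "continuous_on UNIV (\<lambda>z. sqrt (dist_sq z))" unfolding dist_sq_expand by (intro continuous_intros)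
  moreover have "dist_sq 0 = 0" by (simp add: dist_sq_def sqnorm_def)
  moreover have "dist_sq (- z) = dist_sq z" for z
  proof -
    have "dist_sq (0 - z) = sqnorm (\<lambda>x. \<phi> x - \<phi> (x - z))" unfolding dist_sq_diff by simp
    also have "\<dots> = dist_sq z" by (simp add: dist_sq_def sqnorm_def algebra_simps)
    finally show ?thesis by simp
  qed
  moreover have "sqrt (dist_sq (x + y)) \<le> sqrt (dist_sq x) + sqrt (dist_sq y)" for x y
  proof -
    define f where "f = (\<lambda>t. \<phi> (t - (x + y)) - \<phi> (t - y))"
    define g where "g = (\<lambda>t. \<phi> (t - y) - \<phi> t)"
    have fg: "test_function f" "test_function g" unfolding f_def g_def
      by (intro test_function_diff test_function_translate test_function_\<phi>)+
    have "sqnorm f = dist_sq x" unfolding f_def dist_sq_diff[symmetric] by simp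
    moreover have "sqnorm g = dist_sq y" unfolding g_def dist_sq_def ..
    moreover have "sqnorm (\<lambda>t. f t + g t) = dist_sq (x + y)" by (simp add: f_def g_def dist_sq_def)
    ultimately show ?thesis using sqnorm_minkowski[OF fg] by simp
  qed
  ultimately show ?thesis by (simp add: group_seminorm_def)
qed

text \<open>The translate of \<open>\<phi>\<close> by \<open>z\<close> and \<open>\<phi>\<close> itself have disjoint supports.\<close>

lemma dist_sq_support:
  assumes "z \<notin> N"
  shows "dist_sq z = 2 * sqnorm \<phi>"
proof -
  have "\<phi> x * \<phi> (x - z) = 0" for x
  proof (rule ccontr)
    assume "\<phi> x * \<phi> (x - z) \<noteq> 0"
    then obtain a b c e where ab: "a \<in> V" "b \<in> V" "x = a + b" "c \<in> V" "e \<in> V" "x - z = c + e"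
      using \<phi>_support[of x] \<phi>_support[of "x - z"] by auto
    then have "z = a + b + (- c) + (- e)" by (simp add: algebra_simps)
    then show False using VN(3)[of a b "- c" "- e"] V(3) ab assms by simp
  qed
  then have "(\<lambda>x. \<phi> x * \<phi> (x - z)) = (\<lambda>_. 0)" by (rule ext)
  then show ?thesis by (simp add: dist_sq_expand)
qed

text \<open>A maximal \<open>\<sigma>\<close>-separated subset of \<open>V\<close> is small by \<open>packing_bound\<close>, and the balls around its points cover \<open>V\<close>.\<close>

lemma ball_measure_lower:
  assumes \<sigma>: "\<sigma> > 0" and l: "4 * real (Suc l) * sqnorm h < (real l)\<^sup>2 * \<sigma>\<^sup>2"
    and fin: "emeasure \<mu> {x. sqrt (dist_sq x) < \<sigma>} < \<infinity>"
  shows "vol \<le> loss ^ l * real (Suc l) * measure \<mu> {x. sqrt (dist_sq x) < \<sigma>}"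
proof -
  define d where "d = (\<lambda>z. sqrt (dist_sq z))"
  have d: "group_seminorm d" unfolding d_def by (rule seminorm_sqrt_dist_sq)
  have packing: "real (card P) \<le> loss ^ l * real (Suc l)"
    if P: "finite P" "P \<subseteq> V" "\<forall>p\<in>P. \<forall>q\<in>P. p \<noteq> q \<longrightarrow> \<sigma> \<le> d (p - q)" for P
  proof (rule packing_bound[OF P(1,2) _ l])
    fix y y' assume "y \<in> P" "y' \<in> P" "y \<noteq> y'"
    then have "\<sigma> \<le> sqrt (dist_sq (y - y'))" using P(3) by (auto simp: d_def)
    then show "\<sigma>\<^sup>2 \<le> dist_sq (y - y')" 
      using power_mono[of \<sigma> "sqrt (dist_sq (y - y'))" 2] \<sigma> by (simp add: dist_sq_def sqnorm_nonneg)
  qed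
  then have "card P \<le> nat \<lfloor>loss ^ l * real (Suc l)\<rfloor>"
    if "finite P" "P \<subseteq> V" "\<forall>p\<in>P. \<forall>q\<in>P. p \<noteq> q \<longrightarrow> \<sigma> \<le> d (p - q)" for P
    using that by (simp add: le_nat_floor)
  then obtain P where P: "finite P" "P \<subseteq> V" "\<forall>p\<in>P. \<forall>q\<in>P. p \<noteq> q \<longrightarrow> \<sigma> \<le> d (p - q)" "\<forall>x\<in>V. \<exists>p\<in>P. d (x - p) < \<sigma>"
    using maximal_separated_net[OF d \<sigma>, of V "nat \<lfloor>loss ^ l * real (Suc l)\<rfloor>"] by auto
  obtain ps where ps: "set ps = P" "distinct ps" using finite_distinct_list[OF P(1)] by blast
  define D where "D = {x. d x < \<sigma>}"
  have Dm: "D \<in> sets borel" unfolding D_def by (rule seminorm_ball_measurable[OF d])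
  have mD: "emeasure \<mu> D = ennreal (measure \<mu> D)" using fin by (simp add: D_def d_def emeasure_eq_measure)
  have "V \<subseteq> (\<Union>p\<in>set ps. (+) p ` D)"
  proof
    fix x assume "x \<in> V"
    then obtain p where "p \<in> P" "d (x - p) < \<sigma>" using P(4) by blast
    then show "x \<in> (\<Union>p\<in>set ps. (+) p ` D)" unfolding ps(1)
      by (intro UN_I[of p] image_eqI[of _ _ "x - p"]) (auto simp: D_def)
  qed
  then have "emeasure \<mu> V \<le> emeasure \<mu> (\<Union>p\<in>set ps. (+) p ` D)"
    by (rule emeasure_mono) (use Dm translate_measurable in \<open>auto intro!: sets.finite_UN\<close>)
  also have "\<dots> \<le> of_nat (length ps) * emeasure \<mu> D" by (rule emeasure_translates_le[OF Dm])
  also have "\<dots> = ennreal (real (card P) * measure \<mu> D)"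
    using ps distinct_card[of ps] by (simp add: mD ennreal_of_nat_eq_real_of_nat ennreal_mult)
  finally have "vol \<le> real (card P) * measure \<mu> D"
    using Vfin unfolding vol_def by (simp add: emeasure_eq_measure ennreal_le_iff)
  also have "\<dots> \<le> loss ^ l * real (Suc l) * measure \<mu> D" using packing[OF P(1-3)] by (intro mult_right_mono) auto
  finally show ?thesis by (simp add: D_def d_def)
qed

end

text \<open>At a radius where \<open>\<Lambda> \<sigma> * \<sigma> ^ 3\<close> is almost maximal, \<open>\<Lambda>\<close> grows at most like the inverse cube of the radius at all smaller
scales simultaneously.\<close>

lemma near_maximal_scale:
  fixes \<Lambda> :: "real \<Rightarrow> real"
  assumes "\<rho>0 > 0" and pos: "\<And>\<sigma>. 0 < \<sigma> \<Longrightarrow> \<sigma> \<le> \<rho>0 \<Longrightarrow> 0 < \<Lambda> \<sigma>"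
    and bnd: "\<And>\<sigma>. 0 < \<sigma> \<Longrightarrow> \<sigma> \<le> \<rho>0 \<Longrightarrow> \<Lambda> \<sigma> * \<sigma> ^ 3 \<le> B"
  shows "\<exists>\<rho>. 0 < \<rho> \<and> \<rho> \<le> \<rho>0 \<and> (\<forall>\<sigma>. 0 < \<sigma> \<longrightarrow> \<sigma> \<le> \<rho> \<longrightarrow> 99/100 * (\<Lambda> \<sigma> * \<sigma> ^ 3) \<le> \<Lambda> \<rho> * \<rho> ^ 3)"
proof -
  define S where "S = (\<lambda>\<sigma>. \<Lambda> \<sigma> * \<sigma> ^ 3) ` {0<..\<rho>0}"
  have bdd: "bdd_above S" unfolding S_def using bnd by (intro bdd_aboveI2[of _ _ B]) auto
  have mem: "\<Lambda> \<sigma> * \<sigma> ^ 3 \<in> S" if "0 < \<sigma>" "\<sigma> \<le> \<rho>0" for \<sigma> using that by (auto simp: S_def)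
  have "0 < \<Lambda> \<rho>0 * \<rho>0 ^ 3" using pos[of \<rho>0] assms(1) by simp
  also have "\<dots> \<le> Sup S" using assms(1) by (intro cSup_upper mem bdd) auto
  finally have "99/100 * Sup S < Sup S" by simp
  then obtain s where s: "s \<in> S" "99/100 * Sup S < s"
    using less_cSupD[of S "99/100 * Sup S"] mem[of \<rho>0] assms(1) by auto
  then obtain \<rho> where \<rho>: "0 < \<rho>" "\<rho> \<le> \<rho>0" "s = \<Lambda> \<rho> * \<rho> ^ 3" by (auto simp: S_def)
  have "99/100 * (\<Lambda> \<sigma> * \<sigma> ^ 3) \<le> \<Lambda> \<rho> * \<rho> ^ 3" if "0 < \<sigma>" "\<sigma> \<le> \<rho>" for \<sigma>
  proof -
    have "\<Lambda> \<sigma> * \<sigma> ^ 3 \<le> Sup S" using that \<rho> by (intro cSup_upper mem bdd) auto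
    then show ?thesis using s(2) \<rho>(3) by linarith
  qed
  then show ?thesis using \<rho> by blast
qed

text \<open>Let \<open>\<Lambda> \<sigma>\<close> be minus the logarithm of the measure of the ball of radius \<open>\<sigma>\<close>. By \<open>ball_measure_lower\<close> with \<open>l\<close> of order
\<open>1 / \<sigma>\<^sup>2\<close>, \<open>\<Lambda>\<close> grows at most like the inverse square of the radius, so \<open>near_maximal_scale\<close> applies to it. At the radius found there, passing to the
fraction \<open>c\<close> of the radius multiplies \<open>\<Lambda>\<close> by at most \<open>100 / (99 * c ^ 3)\<close>. This is below \<open>5/4\<close> for \<open>c = 19/20\<close> and
below \<open>5000000\<close> for \<open>c = 1/160\<close>; the second exponent only has to be independent of \<open>N0\<close> and \<open>\<gamma>\<close>.\<close>

lemma (in haar_group) polynomial_doubling_seminorm: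
  assumes unc: "uncountable (UNIV :: 'a set)" and N0: "open N0" "(0::'a) \<in> N0" and \<gamma>: "(\<gamma>::real) > 0"
  shows "\<exists>d \<rho>. group_seminorm d \<and> 0 < \<rho> \<and> {x. d x < \<rho>} \<subseteq> N0 \<and> emeasure \<mu> {x. d x < \<rho>} < \<infinity> \<and>
    0 < measure \<mu> {x. d x < \<rho>} \<and> measure \<mu> {x. d x < \<rho>} < \<gamma> \<and>
    measure \<mu> {x. d x < \<rho>} powr (5/4) \<le> measure \<mu> {x. d x < 19/20 * \<rho>} \<and>
    measure \<mu> {x. d x < \<rho>} powr 5000000 \<le> measure \<mu> {x. d x < \<rho> / 160}"
proof -
  obtain N1 where N1: "open N1" "(0::'a) \<in> N1" "emeasure \<mu> N1 < ennreal (min \<gamma> 1)"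
    using small_neighbourhood[OF unc, of "ennreal (min \<gamma> 1)"] \<gamma> by auto
  define N where "N = N0 \<inter> N1"
  have N: "open N" "0 \<in> N" using N0 N1 by (auto simp: N_def)
  have Nsmall: "emeasure \<mu> N < ennreal (min \<gamma> 1)"
    using N1(1,3) emeasure_mono[of N N1 \<mu>] by (auto simp: N_def intro: le_less_trans)
  obtain V where V: "open V" "0 \<in> V" "\<forall>a\<in>V. - a \<in> V" "V \<subseteq> N" "\<forall>a\<in>V. \<forall>b\<in>V. a + b \<in> N"
    "\<forall>a\<in>V. \<forall>b\<in>V. \<forall>c\<in>V. \<forall>d\<in>V. a + b + c + d \<in> N"
    using zero_neighbourhood_sum4[OF N] by blast
  obtain e where e: "e > 0" "ball 0 e \<subseteq> V" using V(1,2) open_contains_ball by blast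
  define h where "h = (\<lambda>x::'a. max 0 (1 - dist x 0 / e))"
  interpret averaged_bump \<mu> V N h
  proof unfold_locales
    show "continuous_on UNIV h" unfolding h_def using e(1) by (intro continuous_intros) auto
    show "h x = 0" if "x \<notin> V" for x
    proof -
      have "e \<le> dist x 0" using that e by (auto simp: dist_commute not_less[symmetric])
      then show ?thesis using e(1) by (simp add: h_def max_def)
    qed
    show "emeasure \<mu> N < \<infinity>" using Nsmall by (rule less_trans) simp
    show "0 < h 0" "0 \<le> h x" "h x \<le> 1" for x using e(1) by (simp_all add: h_def)
    show "- a \<in> V" if "a \<in> V" for a using V(3) that by blast
    show "a + b \<in> N" if "a \<in> V" "b \<in> V" for a b using V(5) that by blast
    show "a + b + c + d \<in> N" if "a \<in> V" "b \<in> V" "c \<in> V" "d \<in> V" for a b c d using V(6) that by blast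
  qed (use V(1,2,4) N(1) in auto)
  define d where "d = (\<lambda>z. sqrt (dist_sq z))"
  have d: "group_seminorm d" unfolding d_def by (rule seminorm_sqrt_dist_sq)
  define \<rho>0 where "\<rho>0 = sqrt (sqnorm \<phi>)"
  have \<rho>0: "\<rho>0 > 0" using sqnorm_\<phi>_pos by (simp add: \<rho>0_def)
  have sub: "{x. d x < \<sigma>} \<subseteq> N" if "\<sigma> \<le> \<rho>0" for \<sigma>
  proof
    fix x assume x: "x \<in> {x. d x < \<sigma>}"
    show "x \<in> N"
    proof (rule ccontr)
      assume "x \<notin> N"
      then have "d x = sqrt (2 * sqnorm \<phi>)" by (simp add: d_def dist_sq_support)
      moreover have "\<rho>0 \<le> sqrt (2 * sqnorm \<phi>)" unfolding \<rho>0_def using sqnorm_\<phi>_pos by (intro real_sqrt_le_mono) simp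
      ultimately show False using x that by simp
    qed
  qed
  define m where "m \<sigma> = measure \<mu> {x. d x < \<sigma>}" for \<sigma>
  have em: "emeasure \<mu> {x. d x < \<sigma>} < ennreal (min \<gamma> 1)" if "\<sigma> \<le> \<rho>0" for \<sigma>
    using emeasure_mono[OF sub[OF that], of \<mu>] Nsmall by (auto intro: le_less_trans)
  have efin: "emeasure \<mu> {x. d x < \<sigma>} < \<infinity>" if "\<sigma> \<le> \<rho>0" for \<sigma>
    using em[OF that] by (rule less_trans) simp
  have emm: "emeasure \<mu> {x. d x < \<sigma>} = ennreal (m \<sigma>)" if "\<sigma> \<le> \<rho>0" for \<sigma>
    using efin[OF that] by (simp add: m_def emeasure_eq_measure)
  have mlt: "m \<sigma> < min \<gamma> 1" if "\<sigma> \<le> \<rho>0" for \<sigma>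
    using em[OF that] unfolding emm[OF that] by (simp add: m_def ennreal_less_iff)
  have mpos: "0 < m \<sigma>" if "0 < \<sigma>" "\<sigma> \<le> \<rho>0" for \<sigma>
  proof -
    have "open {x. d x < \<sigma>}" using d by (intro open_Collect_less) (auto simp: group_seminorm_def)
    moreover have "0 \<in> {x. d x < \<sigma>}" using d that by (simp add: group_seminorm_def)
    ultimately have "0 < emeasure \<mu> {x. d x < \<sigma>}" by (intro emeasure_open_pos) auto
    then show ?thesis unfolding emm[OF that(2)] by simp
  qed
  define C where "C = sqnorm h"
  have C: "C > 0" using sqnorm_h_pos by (simp add: C_def)
  define k where "k = ln loss + 1"
  have k: "k \<ge> 1" using loss_ge_2 by (simp add: k_def)
  have growth: "- ln (m \<sigma>) * \<sigma> ^ 3 \<le> (8 * C * \<rho>0 + 2 * \<rho>0 ^ 3) * k + \<bar>ln vol\<bar> * \<rho>0 ^ 3" if \<sigma>: "0 < \<sigma>" "\<sigma> \<le> \<rho>0" for \<sigma>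
  proof -
    define l where "l = nat \<lceil>8 * C / \<sigma>\<^sup>2\<rceil> + 1"
    have q: "0 < 8 * C / \<sigma>\<^sup>2" using C \<sigma> by simp
    have l: "8 * C / \<sigma>\<^sup>2 + 1 \<le> real l" "real l \<le> 8 * C / \<sigma>\<^sup>2 + 2" using q unfolding l_def by linarith+
    have "8 * C < real l * \<sigma>\<^sup>2"
    proof -
      have "8 * C / \<sigma>\<^sup>2 < real l" using l(1) by linarith
      then show ?thesis using \<sigma> by (simp add: pos_divide_less_eq)
    qed
    moreover have "real l \<ge> 1" by (simp add: l_def)
    ultimately have "real l * (8 * C) < real l * (real l * \<sigma>\<^sup>2)" by (intro mult_strict_left_mono) auto
    moreover have "4 * real (Suc l) * C \<le> real l * (8 * C)" using \<open>real l \<ge> 1\<close> C by simp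
    ultimately have "4 * real (Suc l) * sqnorm h < (real l)\<^sup>2 * \<sigma>\<^sup>2" by (simp add: C_def power2_eq_square mult.assoc)
    then have "vol \<le> loss ^ l * real (Suc l) * m \<sigma>"
      unfolding m_def d_def by (rule ball_measure_lower[OF \<sigma>(1)]) (use efin[OF \<sigma>(2)] in \<open>simp add: d_def\<close>)
    then have "ln vol \<le> ln (loss ^ l * real (Suc l) * m \<sigma>)" using vol_pos by (intro ln_mono) auto
    also have "\<dots> = real l * ln loss + ln (1 + real l) + ln (m \<sigma>)"
      using loss_ge_2 mpos[OF \<sigma>] by (simp add: ln_mult ln_realpow)
    also have "\<dots> \<le> real l * k + ln (m \<sigma>)"
      using ln_add_one_self_le_self[of "real l"] by (simp add: k_def algebra_simps)
    finally have "- ln (m \<sigma>) \<le> (8 * C / \<sigma>\<^sup>2 + 2) * k + \<bar>ln vol\<bar>"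
      using mult_right_mono[OF l(2), of k] k by linarith
    then have "- ln (m \<sigma>) * \<sigma> ^ 3 \<le> ((8 * C / \<sigma>\<^sup>2 + 2) * k + \<bar>ln vol\<bar>) * \<sigma> ^ 3" using \<sigma> by (intro mult_right_mono) auto
    also have "\<dots> = (8 * C * \<sigma> + 2 * \<sigma> ^ 3) * k + \<bar>ln vol\<bar> * \<sigma> ^ 3"
      using \<sigma> by (simp add: field_simps power3_eq_cube power2_eq_square)
    also have "\<dots> \<le> (8 * C * \<rho>0 + 2 * \<rho>0 ^ 3) * k + \<bar>ln vol\<bar> * \<rho>0 ^ 3"
      using \<sigma> C k by (intro add_mono mult_mono power_mono mult_left_mono) auto
    finally show ?thesis .
  qed
  have "0 < - ln (m \<sigma>)" if "0 < \<sigma>" "\<sigma> \<le> \<rho>0" for \<sigma>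
    using mpos[OF that] mlt[OF that(2)] by simp
  then obtain \<rho> where \<rho>: "0 < \<rho>" "\<rho> \<le> \<rho>0"
    "\<forall>\<sigma>. 0 < \<sigma> \<longrightarrow> \<sigma> \<le> \<rho> \<longrightarrow> 99/100 * (- ln (m \<sigma>) * \<sigma> ^ 3) \<le> - ln (m \<rho>) * \<rho> ^ 3"
    using near_maximal_scale[OF \<rho>0, of "\<lambda>\<sigma>. - ln (m \<sigma>)"] growth by blast
  have scale: "m \<rho> powr a \<le> m (c * \<rho>)" if c: "0 < c" "c \<le> 1" "100 \<le> 99 * a * c ^ 3" for a c
  proof -
    have c\<rho>: "0 < c * \<rho>" "c * \<rho> \<le> \<rho>" "c * \<rho> \<le> \<rho>0"
      using c(1,2) \<rho>(1,2) mult_right_mono[of c 1 \<rho>] by (simp_all, linarith)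
    have L: "0 \<le> - ln (m \<rho>)" using mpos[OF \<rho>(1,2)] mlt[OF \<rho>(2)] by simp
    have "(99 * (- ln (m (c * \<rho>))) * c ^ 3) * \<rho> ^ 3 \<le> (100 * - ln (m \<rho>)) * \<rho> ^ 3"
      using \<rho>(3)[rule_format, OF c\<rho>(1,2)] by (simp add: power_mult_distrib)
    then have "99 * (- ln (m (c * \<rho>))) * c ^ 3 \<le> 100 * - ln (m \<rho>)"
      by (rule mult_right_le_imp_le) (use \<rho>(1) in simp)
    also have "\<dots> \<le> (99 * a * c ^ 3) * - ln (m \<rho>)" using c(3) L by (rule mult_right_mono)
    finally have "(- ln (m (c * \<rho>))) * (99 * c ^ 3) \<le> (a * - ln (m \<rho>)) * (99 * c ^ 3)" by (simp add: mult_ac)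
    then have "- ln (m (c * \<rho>)) \<le> a * - ln (m \<rho>)" by (rule mult_right_le_imp_le) (use c(1) in simp)
    then have "a * ln (m \<rho>) \<le> ln (m (c * \<rho>))" by simp
    then have "exp (a * ln (m \<rho>)) \<le> exp (ln (m (c * \<rho>)))" by simp
    then show ?thesis using mpos[OF \<rho>(1,2)] mpos[OF c\<rho>(1,3)] by (simp add: powr_def)
  qed
  have "m \<rho> powr (5/4) \<le> m (19/20 * \<rho>)" by (rule scale) (simp_all add: power3_eq_cube)
  moreover have "m \<rho> powr 5000000 \<le> m (1/160 * \<rho>)" by (rule scale) (simp_all add: power3_eq_cube)
  moreover have "{x. d x < \<rho>} \<subseteq> N0" using sub[OF \<rho>(2)] by (auto simp: N_def)
  ultimately show ?thesis using d \<rho> efin[OF \<rho>(2)] mpos[OF \<rho>(1,2)] mlt[OF \<rho>(2)]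
    by (intro exI[of _ d] exI[of _ \<rho>]) (simp add: m_def)
qed

section \<open>Null sets do not absorb finitely many translates\<close>

context haar_group
begin

text \<open>The integral over \<open>s\<close> of the measure of \<open>{z \<in> Z n. s + z \<in> E n}\<close> is at most \<open>a n * b n\<close>. By Markov's inequality it
exceeds \<open>2 ^ n\<close> times this value only on a set of measure \<open>(1/2) ^ n\<close>, and the Borel-Cantelli lemma applies.\<close>

lemma generic_translate:
  fixes E Z :: "nat \<Rightarrow> 'a set"
  assumes [measurable]: "\<And>n. E n \<in> sets borel" "\<And>n. Z n \<in> sets borel" and pos: "\<And>n. a n > 0" "\<And>n. b n > 0"
    and ev: "eventually (\<lambda>n. emeasure \<mu> (E n) \<le> ennreal (a n)) sequentially"
      "eventually (\<lambda>n. emeasure \<mu> (Z n) \<le> ennreal (b n)) sequentially"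
  shows "AE s in \<mu>. eventually (\<lambda>n. emeasure \<mu> {z\<in>Z n. s + z \<in> E n} \<le> ennreal (2 ^ n * a n * b n)) sequentially"
proof -
  define A where "A n = (if emeasure \<mu> (E n) \<le> ennreal (a n) \<and> emeasure \<mu> (Z n) \<le> ennreal (b n)
    then {s. ennreal (2 ^ n * a n * b n) \<le> emeasure \<mu> {z\<in>Z n. s + z \<in> E n}} else {})" for n
  have "{s. ennreal (2 ^ n * a n * b n) \<le> emeasure \<mu> {z\<in>Z n. s + z \<in> E n}} \<in> sets borel" for n
    by measurable
  then have Am: "A n \<in> sets \<mu>" for n by (simp add: A_def)
  have le: "emeasure \<mu> (A n) \<le> ennreal ((1/2) ^ n)" for n
  proof (cases "emeasure \<mu> (E n) \<le> ennreal (a n) \<and> emeasure \<mu> (Z n) \<le> ennreal (b n)")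
    case True
    define t where "t = 2 ^ n * a n * b n"
    have t: "t > 0" using pos by (simp add: t_def)
    have "ennreal t * emeasure \<mu> (A n) = (\<integral>\<^sup>+s. ennreal t * indicator (A n) s \<partial>\<mu>)"
      using Am by (simp add: nn_integral_cmult_indicator)
    also have "\<dots> \<le> (\<integral>\<^sup>+s. emeasure \<mu> {z\<in>Z n. s + z \<in> E n} \<partial>\<mu>)"
      using True by (intro nn_integral_mono) (auto simp: A_def t_def indicator_def)
    also have "\<dots> = emeasure \<mu> (Z n) * emeasure \<mu> (E n)" by (rule nn_integral_overlap) auto
    also have "\<dots> \<le> ennreal (b n) * ennreal (a n)" using True by (intro mult_mono) auto
    also have "\<dots> = ennreal t * ennreal ((1/2) ^ n)"
      using pos[of n] by (simp add: t_def ennreal_mult[symmetric] power_divide field_simps less_imp_le)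
    finally show ?thesis using t by (subst (asm) ennreal_mult_le_mult_iff) auto
  next
    case False
    then have "A n = {}" unfolding A_def by (rule if_not_P)
    then show ?thesis by simp
  qed
  have fin: "emeasure \<mu> (A n) < \<infinity>" for n using le[of n] by (rule le_less_trans) simp
  have "AE s in \<mu>. eventually (\<lambda>n. s \<in> space \<mu> - A n) sequentially"
  proof (rule borel_cantelli_AE1[OF Am fin])
    have "measure \<mu> (A n) \<le> (1/2) ^ n" for n
      using le[of n] fin[of n] by (simp add: emeasure_eq_measure ennreal_le_iff)
    then show "summable (\<lambda>n. measure \<mu> (A n))"
      using summable_comparison_test'[where N = 0 and g = "\<lambda>n. (1/2) ^ n" and f = "\<lambda>n. measure \<mu> (A n)"] by (simp add: summable_geometric)
  qed
  then show ?thesis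
  proof eventually_elim
    case (elim s)
    from elim ev show ?case
    proof eventually_elim
      case (elim n)
      then show ?case by (auto simp: A_def)
    qed
  qed
qed

text \<open>Choosing the \<open>s\<close> one after the other makes the intersection of \<open>q\<close> translates as small as for independent events,
up to the factors \<open>2 ^ n\<close>. One list serves all \<open>j\<close>, because the index \<open>j\<close> of the set that might contain a translate of it is not
known when it is chosen.\<close>

lemma generic_translates:
  fixes E :: "nat \<Rightarrow> nat \<Rightarrow> 'a set"
  assumes E[measurable]: "\<And>j n. E j n \<in> sets borel" and pos: "\<And>j n. a j n > 0"
    and ev: "\<And>j. eventually (\<lambda>n. emeasure \<mu> (E j n) \<le> ennreal (a j n)) sequentially"
  shows "\<exists>ss. \<forall>j. eventually (\<lambda>n. emeasure \<mu> {z. \<forall>s\<in>set ss. z + s \<in> E j n} \<le> ennreal ((2 ^ n * a j n) ^ Suc p)) sequentially"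
proof (induction p)
  case 0
  have "eventually (\<lambda>n. emeasure \<mu> {z. \<forall>s\<in>set [0]. z + s \<in> E j n} \<le> ennreal ((2 ^ n * a j n) ^ Suc 0)) sequentially" for j
    using ev[of j]
  proof eventually_elim
    case (elim n)
    have "a j n \<le> 2 ^ n * a j n" using pos[of j n] by simp
    then show ?case using elim by (auto intro: order_trans ennreal_leI)
  qed
  then show ?case by blast
next
  case (Suc p)
  then obtain ss where ss: "\<And>j. eventually (\<lambda>n. emeasure \<mu> {z. \<forall>s\<in>set ss. z + s \<in> E j n} \<le> ennreal ((2 ^ n * a j n) ^ Suc p)) sequentially"
    by blast
  define Z where "Z j n = {z. \<forall>s\<in>set ss. z + s \<in> E j n}" for j n
  have Zm: "Z j n \<in> sets borel" for j n
  proof -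
    have "Z j n = UNIV \<inter> (\<Inter>s\<in>set ss. {z. z + s \<in> E j n})" by (auto simp: Z_def)
    then show ?thesis by (cases "ss = []") (auto intro!: sets.finite_INT)
  qed
  have "AE s in \<mu>. \<forall>j. eventually (\<lambda>n. emeasure \<mu> {z\<in>Z j n. s + z \<in> E j n} \<le> ennreal (2 ^ n * a j n * (2 ^ n * a j n) ^ Suc p)) sequentially"
    unfolding AE_all_countable
  proof
    fix j
    show "AE s in \<mu>. eventually (\<lambda>n. emeasure \<mu> {z\<in>Z j n. s + z \<in> E j n} \<le> ennreal (2 ^ n * a j n * (2 ^ n * a j n) ^ Suc p)) sequentially"
      by (rule generic_translate) (use E Zm pos ev[of j] ss[of j] in \<open>simp_all add: Z_def\<close>)
  qed
  then obtain s where s: "\<forall>j. eventually (\<lambda>n. emeasure \<mu> {z\<in>Z j n. s + z \<in> E j n} \<le> ennreal (2 ^ n * a j n * (2 ^ n * a j n) ^ Suc p)) sequentially"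
    by (rule AE_obtain_in_open[of _ UNIV]) auto
  have "{z\<in>Z j n. s + z \<in> E j n} = {z. \<forall>s'\<in>set (s # ss). z + s' \<in> E j n}" for j n
    by (auto simp: Z_def add.commute)
  then show ?case using s by (intro exI[of _ "s # ss"]) simp
qed

text \<open>The exponent is \<open>1 / (4 * \<kappa>)\<close> for the exponent \<open>\<kappa> = 5000000\<close> of \<open>polynomial_doubling_seminorm\<close>. Its independence of \<open>O'\<close> and
\<open>\<epsilon>\<close> allows a fixed number of translations to work at all stages.\<close>

lemma exists_thinness_forcing_set:
  assumes unc: "uncountable (UNIV :: 'a set)" and O': "compact O'" "(0::'a) \<in> O'" and \<epsilon>: "\<epsilon> > 0"
  shows "\<exists>U R. open U \<and> emeasure \<mu> U \<le> ennreal \<epsilon> \<and> open R \<and> 0 \<in> R \<and> emeasure \<mu> R < \<infinity> \<and>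
    forces_thinness U R O' \<epsilon> (\<epsilon> * measure \<mu> R powr (1 / 20000000))"
proof -
  obtain N Kc where N: "open N" "compact Kc" "(0::'a) \<in> N" "N \<subseteq> Kc"
    by (rule zero_neighbourhood_in_compact[OF locally_compact])
  define Q where "Q = {x + y | x y. x \<in> {x + y | x y. x \<in> O' \<and> y \<in> O'} \<and> y \<in> Kc}"
  have Qc: "compact Q" unfolding Q_def by (intro compact_minus_image O' N)
  then have Q: "Q \<in> sets borel" "emeasure \<mu> Q < \<infinity>" by (simp_all only: borel_closed compact_imp_closed emeasure_compact)
  have "N \<subseteq> Q"
  proof
    fix x assume "x \<in> N"
    then have "x = (0 + 0) + x" "x \<in> Kc" using N by auto
    then show "x \<in> Q" unfolding Q_def using O'(2) by blast
  qed
  then have "0 < emeasure \<mu> Q" using emeasure_mono[of N Q \<mu>] Q(1) emeasure_open_pos[OF N(1)] N(3) by (auto intro: less_le_trans)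
  then have v: "0 < measure \<mu> Q" using Q(2) by (simp add: emeasure_eq_measure)
  have "eventually (small_enough \<epsilon> (measure \<mu> Q) 5000000) (at_right 0)"
    by (rule eventually_small_enough) (use \<epsilon> v in auto)
  then obtain \<gamma> where \<gamma>: "\<gamma> > 0" "\<And>\<beta>. 0 < \<beta> \<Longrightarrow> \<beta> < \<gamma> \<Longrightarrow> small_enough \<epsilon> (measure \<mu> Q) 5000000 \<beta>"
    unfolding eventually_at_right_field by blast
  obtain d \<rho> where d: "group_seminorm d" "0 < \<rho>" "{x. d x < \<rho>} \<subseteq> N" "emeasure \<mu> {x. d x < \<rho>} < \<infinity>"
    "0 < measure \<mu> {x. d x < \<rho>}" "measure \<mu> {x. d x < \<rho>} < \<gamma>"
    "measure \<mu> {x. d x < \<rho>} powr (5/4) \<le> measure \<mu> {x. d x < 19/20 * \<rho>}"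
    "measure \<mu> {x. d x < \<rho>} powr 5000000 \<le> measure \<mu> {x. d x < \<rho> / 160}"
    using polynomial_doubling_seminorm[OF unc N(1,3) \<gamma>(1)] by blast
  have OQ: "x + y + z \<in> Q" if "x \<in> O'" "y \<in> O'" "d z < \<rho>" for x y z
    unfolding Q_def using that d(3) N(4) by blast
  have "\<exists>U. open U \<and> emeasure \<mu> U \<le> ennreal \<epsilon> \<and>
    forces_thinness U {x. d x < \<rho> / 160} O' \<epsilon> (\<epsilon> * measure \<mu> {x. d x < \<rho> / 160} powr (1 / (4 * 5000000)))"
    by (rule thinness_forcing_set[OF d(1,2) refl d(5,4,7,8) O'(2) Q OQ \<epsilon> _ \<gamma>(2)[OF d(5,6)]]) simp_all
  then obtain U where U: "open U" "emeasure \<mu> U \<le> ennreal \<epsilon>"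
    "forces_thinness U {x. d x < \<rho> / 160} O' \<epsilon> (\<epsilon> * measure \<mu> {x. d x < \<rho> / 160} powr (1 / 20000000))"
    by (elim exE conjE) simp
  have "emeasure \<mu> {x. d x < \<rho> / 160} < \<infinity>"
  proof -
    have "{x. d x < \<rho> / 160} \<subseteq> {x. d x < \<rho>}" using d(2) by auto
    then have "emeasure \<mu> {x. d x < \<rho> / 160} \<le> emeasure \<mu> {x. d x < \<rho>}"
      by (rule emeasure_mono) (use seminorm_ball_measurable[OF d(1)] in auto)
    then show ?thesis using d(4) by (rule le_less_trans)
  qed
  moreover have "open {x. d x < s}" for s
    using d(1) by (intro open_Collect_less) (auto simp: group_seminorm_def)
  moreover have "0 \<in> {x. d x < \<rho> / 160}" using d(1,2) by (simp add: group_seminorm_def)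
  ultimately show ?thesis using U by (intro exI[of _ U] exI[of _ "{x. d x < \<rho> / 160}"] conjI)
qed

text \<open>By inner regularity there is a compact subset of positive measure; remove from it all basic open sets that it meets in a
null set.\<close>

lemma self_supporting_compact:
  assumes A: "A \<in> sets borel" "emeasure \<mu> A > 0"
  shows "\<exists>K \<subseteq> A. compact K \<and> K \<noteq> {} \<and> (\<forall>V. open V \<longrightarrow> V \<inter> K \<noteq> {} \<longrightarrow> 0 < emeasure \<mu> (K \<inter> V))"
proof -
  obtain C :: "nat \<Rightarrow> 'a set" where C: "\<forall>n. compact (C n) \<and> 0 \<in> C n" "(\<Union>n. C n) = UNIV"
    using compact_exhaustion[OF locally_compact] by (elim exE conjE) (rule that)
  have Cm: "C n \<in> sets borel" for n using C(1) by (auto intro: borel_closed compact_imp_closed)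
  have "\<exists>n. emeasure \<mu> (A \<inter> C n) \<noteq> 0"
  proof (rule ccontr)
    assume "\<not> ?thesis"
    then have "emeasure \<mu> (\<Union>n. A \<inter> C n) = 0" using A Cm by (intro emeasure_UN_eq_0) auto
    moreover have "(\<Union>n. A \<inter> C n) = A" using C(2) by blast
    ultimately show False using A by simp
  qed
  then obtain n where n: "emeasure \<mu> (A \<inter> C n) \<noteq> 0" by blast
  define M where "M = density \<mu> (indicator (C n))"
  have M: "emeasure M B = emeasure \<mu> (C n \<inter> B)" if "B \<in> sets borel" for B
    unfolding M_def using that Cm by (intro emeasure_restricted) auto
  have "emeasure M (A \<inter> C n) = (SUP K\<in>{K. K \<subseteq> A \<inter> C n \<and> compact K}. emeasure M K)"
  proof (rule inner_regular)
    show "sets M = sets borel" by (simp add: M_def)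
    show "emeasure M (space M) \<noteq> \<infinity>" using M[of UNIV] C(1) emeasure_compact[of "C n"] by (simp add: M_def)
  qed (use A Cm in auto)
  moreover have "emeasure M (A \<inter> C n) > 0" using n A Cm by (simp add: M Int_absorb1 Int_commute Int_left_commute zero_less_iff_neq_zero)
  ultimately obtain K where K: "K \<subseteq> A \<inter> C n" "compact K" "0 < emeasure M K" by (auto simp: less_SUP_iff)
  have Km: "K \<in> sets borel" using K(2) by (auto intro: borel_closed compact_imp_closed)
  have Kpos: "0 < emeasure \<mu> K" using K M[OF Km] by (simp add: Int_absorb1)
  obtain B :: "'a set set" where B: "countable B" "topological_basis B" using ex_countable_basis by blast
  define F where "F = {b\<in>B. emeasure \<mu> (K \<inter> b) = 0}"
  have Bo: "open b" if "b \<in> B" for b using topological_basis_open[OF B(2) that] .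
  define K' where "K' = K - \<Union>F"
  have "open (\<Union>F)" using Bo by (auto simp: F_def)
  then have K'c: "compact K'" unfolding K'_def using K(2) by (rule compact_diff[rotated])
  have K'm: "K' \<in> sets borel" using K'c by (auto intro: borel_closed compact_imp_closed)
  have "(\<Union>b\<in>F. K \<inter> b) \<in> null_sets \<mu>"
    by (rule null_sets_UN') (use B(1) Bo Km in \<open>auto simp: F_def null_sets_def\<close>)
  moreover have "(\<Union>b\<in>F. K \<inter> b) = K - K'" by (auto simp: K'_def)
  ultimately have null: "K - K' \<in> null_sets \<mu>" by simp
  have eq: "emeasure \<mu> (K' \<inter> S) = emeasure \<mu> (K \<inter> S)" if "S \<in> sets borel" for S
  proof -
    have "K' \<inter> S = (K \<inter> S) - (K - K')" by (auto simp: K'_def)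
    then show ?thesis using emeasure_Diff_null_set[OF null, of "K \<inter> S"] that Km by simp
  qed
  have "0 < emeasure \<mu> (K' \<inter> V)" if V: "open V" "V \<inter> K' \<noteq> {}" for V
  proof -
    obtain x where x: "x \<in> V" "x \<in> K'" using V by blast
    obtain b where b: "b \<in> B" "x \<in> b" "b \<subseteq> V" using topological_basisE[OF B(2) V(1) x(1)] by blast
    then have "b \<notin> F" using x by (auto simp: K'_def)
    then have "0 < emeasure \<mu> (K' \<inter> b)" using b Bo eq[of b] by (auto simp: F_def zero_less_iff_neq_zero)
    also have "\<dots> \<le> emeasure \<mu> (K' \<inter> V)" using b V K'm by (intro emeasure_mono) auto
    finally show ?thesis .
  qed
  moreover have "K' \<noteq> {}" using eq[of UNIV] Kpos by auto
  moreover have "K' \<subseteq> A" using K(1) by (auto simp: K'_def)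
  ultimately show ?thesis using K'c by blast
qed

lemma Baire_compact_cover:
  fixes K :: "'a set" and F :: "nat \<Rightarrow> 'a set"
  assumes K: "compact K" "K \<noteq> {}" and F: "\<And>m. closed (F m)" "K \<subseteq> (\<Union>m. F m)"
  shows "\<exists>m W. open W \<and> W \<inter> K \<noteq> {} \<and> W \<inter> K \<subseteq> F m"
proof (rule ccontr)
  assume no: "\<not> ?thesis"
  let ?X = "top_of_set K"
  have "completely_metrizable_space ?X"
    using completely_metrizable_space_closedin[OF completely_metrizable_space_euclidean, of K] compact_imp_closed[OF K(1)] by simp
  moreover have "closedin ?X (K \<inter> F m) \<and> ?X interior_of (K \<inter> F m) = {}" for m
  proof
    show "closedin ?X (K \<inter> F m)" using F(1) by (rule closedin_closed_Int)
    show "?X interior_of (K \<inter> F m) = {}"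
    proof (rule ccontr)
      assume "?X interior_of (K \<inter> F m) \<noteq> {}"
      moreover obtain W where "open W" "?X interior_of (K \<inter> F m) = K \<inter> W"
        using openin_interior_of[of ?X "K \<inter> F m"] unfolding openin_open by blast
      moreover have "?X interior_of (K \<inter> F m) \<subseteq> K \<inter> F m" by (rule interior_of_subset)
      ultimately show False using no by blast
    qed
  qed
  ultimately have "?X interior_of (\<Union>(range (\<lambda>m. K \<inter> F m))) = {}"
    by (intro Baire_category_alt) auto
  moreover have "\<Union>(range (\<lambda>m. K \<inter> F m)) = K" using F(2) by blast
  moreover have "?X interior_of K = K" using interior_of_topspace[of ?X] by simp
  ultimately show False using K(2) by simp
qed

theorem null_sets_not_absorbing:
  assumes unc: "uncountable (UNIV :: 'a set)"
  shows "\<exists>X\<in>haar_null_sets. \<forall>Y\<in>haar_null_sets. \<exists>T. finite T \<and> \<not> (\<exists>t. \<forall>s\<in>T. \<forall>x\<in>X. t + s + x \<in> (Y :: 'a set))"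
proof -
  obtain C :: "nat \<Rightarrow> 'a set" where C: "\<forall>n. compact (C n) \<and> 0 \<in> C n" "incseq C" "(\<Union>n. C n) = UNIV"
    using compact_exhaustion[OF locally_compact] by (elim exE conjE) (rule that)
  have Cmono: "C m \<subseteq> C n" if "m \<le> n" for m n using C(2) that by (auto simp: incseq_def)
  define \<epsilon> :: "nat \<Rightarrow> real" where "\<epsilon> n = (1/4) ^ n" for n
  have \<epsilon>: "\<epsilon> n > 0" for n by (simp add: \<epsilon>_def)
  define q where "q = (20000000 :: nat)"
  have q: "real q = 20000000" by (simp add: q_def)
  define good where "good n U R \<longleftrightarrow> open U \<and> emeasure \<mu> U \<le> ennreal (\<epsilon> n) \<and> open R \<and> 0 \<in> R \<and> emeasure \<mu> R < \<infinity> \<and>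
    forces_thinness U R (C n) (\<epsilon> n) (\<epsilon> n * measure \<mu> R powr (1 / real q))" for n U R
  have "\<exists>p. good n (fst p) (snd p)" for n
    using exists_thinness_forcing_set[OF unc C(1)[rule_format, THEN conjunct1] C(1)[rule_format, THEN conjunct2] \<epsilon>, of n n]
    unfolding good_def q by simp
  then obtain UR where UR: "\<And>n. good n (fst (UR n)) (snd (UR n))" by metis
  define U R where "U n = fst (UR n)" and "R n = snd (UR n)" for n
  have good: "good n (U n) (R n)" for n using UR[of n] by (simp add: U_def R_def)
  have U: "\<And>n. open (U n)" "\<And>n. emeasure \<mu> (U n) \<le> ennreal (\<epsilon> n)"
    and R: "\<And>n. open (R n)" "\<And>n. 0 \<in> R n" "\<And>n. emeasure \<mu> (R n) < \<infinity>"
    and thin: "\<And>n. forces_thinness (U n) (R n) (C n) (\<epsilon> n) (\<epsilon> n * measure \<mu> (R n) powr (1 / real q))"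
    using good unfolding good_def by blast+
  define r where "r n = measure \<mu> (R n)" for n
  have emR: "emeasure \<mu> (R n) = ennreal (r n)" for n using R(3)[of n] by (simp add: r_def emeasure_eq_measure)
  have r: "r n > 0" for n
  proof -
    have "0 < emeasure \<mu> (R n)" by (rule emeasure_open_pos[OF R(1)]) (use R(2)[of n] in auto)
    then show ?thesis by (simp add: emR)
  qed
  define X where "X = limsup U"
  have Xiff: "x \<in> X \<longleftrightarrow> (\<forall>m. \<exists>n\<ge>m. x \<in> U n)" for x by (auto simp: X_def limsup_INF_SUP)
  have "X \<in> null_sets \<mu>" unfolding X_def
  proof (rule borel_cantelli_limsup1)
    show Ufin: "emeasure \<mu> (U n) < \<infinity>" for n using U(2)[of n] by (rule le_less_trans) simp
    have "measure \<mu> (U n) \<le> (1/4) ^ n" for n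
      using U(2)[of n] Ufin[of n] by (simp add: \<epsilon>_def emeasure_eq_measure ennreal_le_iff)
    then show "summable (\<lambda>n. measure \<mu> (U n))"
      using summable_comparison_test'[where N = 0 and g = "\<lambda>n. (1/4) ^ n" and f = "\<lambda>n. measure \<mu> (U n)"] by (simp add: summable_geometric)
  qed (use U(1) in auto)
  then have "X \<in> haar_null_sets" unfolding haar_null_sets_iff by (auto simp: null_sets_def)
  moreover have "\<exists>T. finite T \<and> \<not> (\<exists>t. \<forall>s\<in>T. \<forall>x\<in>X. t + s + x \<in> Y)" if Y: "Y \<in> haar_null_sets" for Y
  proof -
    obtain Y' where Y': "Y' \<in> sets borel" "emeasure \<mu> Y' = 0" "Y \<subseteq> Y'" using Y unfolding haar_null_sets_iff by blast
    have "\<exists>j. emeasure \<mu> (C j) \<noteq> 0"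
    proof (rule ccontr)
      assume "\<not> ?thesis"
      then have "emeasure \<mu> (\<Union>n. C n) = 0"
        using C(1) by (intro emeasure_UN_eq_0) (auto simp: borel_closed compact_imp_closed)
      then show False using C(3) haar by (simp add: haar_measure_def)
    qed
    then obtain j0 where j0: "emeasure \<mu> (C j0) \<noteq> 0" by blast
    have Cm: "C j0 \<in> sets borel" using C(1) by (auto intro: borel_closed compact_imp_closed)
    have "emeasure \<mu> (C j0 - Y') = emeasure \<mu> (C j0)"
      by (rule emeasure_Diff_null_set) (use Y' Cm in \<open>auto simp: null_sets_def\<close>)
    then have "0 < emeasure \<mu> (C j0 - Y')" using j0 by (simp add: zero_less_iff_neq_zero)
    then obtain K where K: "K \<subseteq> C j0 - Y'" "compact K" "K \<noteq> {}"
      "\<forall>V. open V \<longrightarrow> V \<inter> K \<noteq> {} \<longrightarrow> 0 < emeasure \<mu> (K \<inter> V)"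
      using self_supporting_compact[of "C j0 - Y'"] Cm Y'(1) by blast
    have Km: "K \<in> sets borel" using K(2) by (auto intro: borel_closed compact_imp_closed)
    obtain B :: "'a set set" where B: "countable B" "topological_basis B" using ex_countable_basis by blast
    define V where "V = from_nat_into B"
    have "B \<noteq> {}" using topological_basisE[OF B(2) open_UNIV, of 0] by blast
    then have Vo: "open (V i)" for i unfolding V_def
      by (intro topological_basis_open[OF B(2)] from_nat_into)
    have VB: "\<exists>i. x \<in> V i \<and> V i \<subseteq> W" if W: "open W" "x \<in> W" for x W
    proof -
      obtain b where b: "b \<in> B" "x \<in> b" "b \<subseteq> W" by (rule topological_basisE[OF B(2) W])
      then obtain i where "V i = b" using from_nat_into_surj[OF B(1) b(1)] unfolding V_def by blast
      then show ?thesis using b by blast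
    qed
    define piece where "piece j i = {c\<in>C j. \<forall>n\<ge>j. \<forall>k\<in>K \<inter> V i. c + k \<notin> U n}" for j i
    \<comment> \<open>Increasing in \<open>j\<close>, so that finitely many elements of the union lie in a single \<open>D j\<close>.\<close>
    define D where "D j = (\<Union>i\<in>{i. i \<le> j \<and> V i \<inter> K \<noteq> {}}. piece j i)" for j
    have Dmono: "D j \<subseteq> D j'" if "j \<le> j'" for j j'
    proof
      fix c assume "c \<in> D j"
      then obtain i where i: "i \<le> j" "V i \<inter> K \<noteq> {}" "c \<in> piece j i" by (auto simp: D_def)
      then have "c \<in> piece j' i" using Cmono[OF that] that by (auto simp: piece_def)
      then show "c \<in> D j'" unfolding D_def using i that by (intro UN_I[of i]) auto
    qed
    have covered: "\<exists>j. c \<in> D j" if c: "\<forall>k\<in>K. c + k \<notin> X" for c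
    proof -
      define G where "G m = {k. \<forall>n\<ge>m. c + k \<notin> U n}" for m
      have "closed (G m)" for m
      proof -
        have "G m = - (\<Union>n\<in>{m..}. {k. c + k \<in> U n})" by (auto simp: G_def)
        moreover have "open (\<Union>n\<in>{m..}. {k. c + k \<in> U n})"
          by (intro open_UN ballI open_vimage_uminus_plus(1) U(1))
        ultimately show ?thesis by (simp only: closed_Compl)
      qed
      moreover have "K \<subseteq> (\<Union>m. G m)" using c by (auto simp: Xiff G_def)
      ultimately obtain m W where W: "open W" "W \<inter> K \<noteq> {}" "W \<inter> K \<subseteq> G m"
        using Baire_compact_cover[OF K(2,3), of G] by blast
      then obtain i where i: "V i \<inter> K \<noteq> {}" "V i \<subseteq> W" using VB[OF W(1)] by blast
      obtain l where l: "c \<in> C l" using C(3) by blast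
      define j where "j = max l (max i m)"
      have "c \<in> piece j i" using l Cmono[of l j] W(3) i(2) by (auto simp: piece_def j_def G_def)
      then have "c \<in> D j" unfolding D_def using i(1) by (intro UN_I[of i]) (auto simp: j_def)
      then show ?thesis ..
    qed
    have RUm: "(\<Union>c\<in>A. (+) c ` R n) \<in> sets borel" for A n
      unfolding translate_eq by (intro borel_open open_UN ballI open_vimage_uminus_plus(3)[OF R(1)])
    define E where "E j n = (\<Union>c\<in>D j. (+) c ` R n)" for j n
    have Em: "E j n \<in> sets borel" for j n unfolding E_def by (rule RUm)
    define a where "a j n = real (Suc j) * (\<epsilon> n * r n powr (1 / real q))" for j n
    have apos: "a j n > 0" for j n using \<epsilon>[of n] r[of n] by (simp add: a_def)
    have \<epsilon>0: "\<epsilon> \<longlonglongrightarrow> 0" unfolding \<epsilon>_def[abs_def] by (intro LIMSEQ_power_zero) simp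
    have Eev: "eventually (\<lambda>n. emeasure \<mu> (E j n) \<le> ennreal (a j n)) sequentially" for j
    proof -
      have "eventually (\<lambda>n. \<epsilon> n \<le> measure \<mu> (K \<inter> V i)) sequentially" if "V i \<inter> K \<noteq> {}" for i
      proof -
        have "0 < emeasure \<mu> (K \<inter> V i)" using K(4) Vo that by blast
        moreover have "emeasure \<mu> (K \<inter> V i) < \<infinity>" by (rule emeasure_subset_compact[OF K(2)]) auto
        ultimately have "0 < measure \<mu> (K \<inter> V i)" by (simp add: emeasure_eq_measure)
        with order_tendstoD(2)[OF \<epsilon>0] have "eventually (\<lambda>n. \<epsilon> n < measure \<mu> (K \<inter> V i)) sequentially" by blast
        then show ?thesis by (rule eventually_mono) simp
      qed
      then have "eventually (\<lambda>n. \<forall>i\<in>{i. i \<le> j \<and> V i \<inter> K \<noteq> {}}. \<epsilon> n \<le> measure \<mu> (K \<inter> V i)) sequentially"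
        by (intro eventually_ball_finite) auto
      moreover have "eventually (\<lambda>n. max j j0 \<le> n) sequentially" by (rule eventually_ge_at_top)
      ultimately show ?thesis
      proof eventually_elim
        case (elim n)
        define I where "I = {i. i \<le> j \<and> V i \<inter> K \<noteq> {}}"
        have "I \<subseteq> {..j}" by (auto simp: I_def)
        then have I: "finite I" "card I \<le> Suc j" using finite_subset card_mono[of "{..j}" I] by auto
        have piece: "emeasure \<mu> (\<Union>c\<in>piece j i. (+) c ` R n) \<le> ennreal (\<epsilon> n * r n powr (1 / real q))" if i: "i \<in> I" for i
          unfolding r_def
        proof (rule thin[unfolded forces_thinness_def, rule_format])
          show "piece j i \<subseteq> C n" using Cmono[of j n] elim by (auto simp: piece_def)
          show "K \<inter> V i \<subseteq> C n" using K(1) Cmono[of j0 n] elim by auto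
          show "K \<inter> V i \<in> sets borel" using Km Vo by auto
          show "\<epsilon> n \<le> measure \<mu> (K \<inter> V i)" using elim i by (auto simp: I_def)
          show "c + k \<notin> U n" if "c \<in> piece j i" "k \<in> K \<inter> V i" for c k using that elim by (auto simp: piece_def)
        qed
        have "E j n = (\<Union>i\<in>I. \<Union>c\<in>piece j i. (+) c ` R n)" by (simp add: E_def D_def I_def)
        then have "emeasure \<mu> (E j n) \<le> (\<Sum>i\<in>I. emeasure \<mu> (\<Union>c\<in>piece j i. (+) c ` R n))"
          using RUm I(1) by (simp only:) (rule emeasure_subadditive_finite, auto)
        also have "\<dots> \<le> (\<Sum>i\<in>I. ennreal (\<epsilon> n * r n powr (1 / real q)))" by (intro sum_mono piece)
        also have "\<dots> = ennreal (real (card I) * (\<epsilon> n * r n powr (1 / real q)))"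
          using \<epsilon>[of n] by (simp add: ennreal_of_nat_eq_real_of_nat ennreal_mult[symmetric] less_imp_le)
        also have "\<dots> \<le> ennreal (a j n)"
          unfolding a_def using I(2) \<epsilon>[of n] by (intro ennreal_leI mult_right_mono) auto
        finally show ?case .
      qed
    qed
    obtain p where p: "q = Suc p" by (cases q) (simp_all add: q_def)
    obtain ss where ss: "\<And>j. eventually (\<lambda>n. emeasure \<mu> {z. \<forall>s\<in>set ss. z + s \<in> E j n} \<le> ennreal ((2 ^ n * a j n) ^ q)) sequentially"
      using generic_translates[of E a p, OF Em apos Eev] unfolding p by blast
    have "\<not> (\<exists>t. \<forall>s\<in>uminus ` set ss. \<forall>x\<in>X. t + s + x \<in> Y)"
    proof
      assume "\<exists>t. \<forall>s\<in>uminus ` set ss. \<forall>x\<in>X. t + s + x \<in> Y"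
      then obtain t where t: "\<And>s x. s \<in> set ss \<Longrightarrow> x \<in> X \<Longrightarrow> t - s + x \<in> Y" by auto
      \<comment> \<open>The translations are the negatives of the list \<open>ss\<close>: \<open>t - s + X \<subseteq> Y\<close> implies that \<open>X\<close> is disjoint from \<open>(s - t) + K\<close>.\<close>
      have "\<exists>j. s - t \<in> D j" if s: "s \<in> set ss" for s
      proof (rule covered, intro ballI notI)
        fix k assume k: "k \<in> K" "s - t + k \<in> X"
        have "t - s + (s - t + k) \<in> Y" by (rule t[OF s k(2)])
        then show False using k(1) K(1) Y'(3) by auto
      qed
      then obtain js where js: "\<And>s. s \<in> set ss \<Longrightarrow> s - t \<in> D (js s)" by metis
      define j where "j = Max (insert 0 (js ` set ss))"
      have jD: "s - t \<in> D j" if "s \<in> set ss" for s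
      proof -
        have "js s \<le> j" unfolding j_def using that by (intro Max_ge) auto
        then show ?thesis using js[OF that] Dmono by blast
      qed
      have lim: "(\<lambda>n. real (Suc j) * (1/2) ^ n) \<longlonglongrightarrow> real (Suc j) * 0"
        by (intro tendsto_mult tendsto_const LIMSEQ_power_zero) simp
      have "eventually (\<lambda>n. real (Suc j) * (1/2) ^ n < 1) sequentially"
        by (rule order_tendstoD(2)[OF lim]) simp
      with ss[of j] have "eventually (\<lambda>n. False) sequentially"
      proof eventually_elim
        case (elim n)
        define x where "x = real (Suc j) * (1/2) ^ n"
        have x: "0 < x" "x < 1" using elim by (auto simp: x_def)
        have "(+) (- t) ` R n \<subseteq> {z. \<forall>s\<in>set ss. z + s \<in> E j n}"
        proof
          fix z assume "z \<in> (+) (- t) ` R n"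
          then obtain y where y: "y \<in> R n" "z = - t + y" by auto
          have "z + s \<in> E j n" if "s \<in> set ss" for s
          proof -
            have "z + s - (s - t) = y" using y by (simp add: algebra_simps)
            then show ?thesis unfolding E_def translate_eq using y(1) by (intro UN_I[OF jD[OF that]]) simp
          qed
          then show "z \<in> {z. \<forall>s\<in>set ss. z + s \<in> E j n}" by blast
        qed
        moreover have "{z. \<forall>s\<in>set ss. z + s \<in> E j n} \<in> sets borel"
        proof -
          have "{z. \<forall>s\<in>set ss. z + s \<in> E j n} = (\<Inter>s\<in>set ss. {z. z + s \<in> E j n})" by auto
          moreover have "{z. z + s \<in> E j n} \<in> sets borel" for s
            using Em[of j n] by measurable
          ultimately show ?thesis by (cases "ss = []") (auto intro!: sets.finite_INT)
        qed
        ultimately have "emeasure \<mu> ((+) (- t) ` R n) \<le> emeasure \<mu> {z. \<forall>s\<in>set ss. z + s \<in> E j n}"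
          by (intro emeasure_mono) auto
        also have "\<dots> \<le> ennreal ((2 ^ n * a j n) ^ q)" by (rule elim(1))
        also have "emeasure \<mu> ((+) (- t) ` R n) = ennreal (r n)"
          unfolding emR[symmetric] by (rule emeasure_translate[OF borel_open[OF R(1)]])
        finally have "ennreal (r n) \<le> ennreal ((2 ^ n * a j n) ^ q)" .
        then have "r n \<le> (2 ^ n * a j n) ^ q"
          by (rule ennreal_le_iff[THEN iffD1, rotated]) (intro zero_le_power mult_nonneg_nonneg less_imp_le[OF apos], simp)
        also have "2 ^ n * a j n = x * r n powr (1 / real q)"
        proof -
          have "2 ^ n * (1/4) ^ n = ((1/2) ^ n :: real)" by (simp flip: power_mult_distrib)
          moreover have "2 ^ n * a j n = real (Suc j) * (2 ^ n * (1/4) ^ n) * r n powr (1 / real q)"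
            by (simp only: a_def \<epsilon>_def mult_ac)
          ultimately show ?thesis by (simp only: x_def)
        qed
        also have "(x * r n powr (1 / real q)) ^ q = x ^ q * r n"
        proof -
          have "(r n powr (1 / real q)) ^ q = (r n powr (1 / real q)) powr real q"
            by (rule powr_realpow[symmetric]) (use r[of n] in simp)
          also have "\<dots> = r n" unfolding powr_powr using r[of n] q by simp
          finally show ?thesis by (simp only: power_mult_distrib)
        qed
        finally have "1 * r n \<le> x ^ q * r n" by simp
        then have "1 \<le> x ^ q" using r[of n] by (rule mult_right_le_imp_le)
        moreover have "x ^ q < 1" unfolding p using x by (intro power_Suc_less_one)
        ultimately show False by simp
      qed
      then show False by simp
    qed
    then show ?thesis by (intro exI[of _ "uminus ` set ss"]) simp
  qed
  ultimately show ?thesis by blast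
qed

end

section \<open>No additive Erdos-Sierpinski mapping\<close>

theorem theorem1p3:
  assumes "locally_compact_space (euclidean :: 'a::{polish_space, topological_ab_group_add} topology)"
    and "uncountable (UNIV :: 'a set)"
  shows "\<not> (\<exists>F :: 'a \<Rightarrow> 'a. erdos_sierpinski_mapping F \<and> (\<forall>x y. F (x + y) = F x + F y))"
proof
  assume "\<exists>F :: 'a \<Rightarrow> 'a. erdos_sierpinski_mapping F \<and> (\<forall>x y. F (x + y) = F x + F y)"
  then obtain F :: "'a \<Rightarrow> 'a" where es: "erdos_sierpinski_mapping F" and add: "\<And>x y. F (x + y) = F x + F y" by blast
  note es = es[unfolded erdos_sierpinski_mapping_def]
  have "bij F" using es by (rule conjunct1)
  have NM: "X \<in> haar_null_sets \<longleftrightarrow> F ` X \<in> meager_sets"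
    and MN: "X \<in> meager_sets \<longleftrightarrow> F ` X \<in> haar_null_sets" for X
    using es[THEN conjunct2, THEN spec, of X] by (rule conjunct1, rule conjunct2)
  have "({} :: 'a set) \<in> meager_sets" unfolding meager_sets_iff nowhere_dense_def
    by (intro exI[of _ "\<lambda>_. {}"]) auto
  \<comment> \<open>Since the empty set is null only if a Haar measure exists, the mapping itself provides one.\<close>
  then have "({} :: 'a set) \<in> haar_null_sets" using MN[of "{}"] by simp
  then obtain \<mu> :: "'a measure" where "haar_measure \<mu>" by (auto simp: haar_null_sets_def)
  then interpret haar_group \<mu> using assms(1) by unfold_locales
  obtain X :: "'a set" where X: "X \<in> haar_null_sets"
    "\<forall>Y\<in>haar_null_sets. \<exists>T. finite T \<and> \<not> (\<exists>t. \<forall>s\<in>T. \<forall>x\<in>X. t + s + x \<in> Y)"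
    by (rule null_sets_not_absorbing[OF assms(2), THEN bexE])
  have "F ` X \<in> meager_sets" using X(1) by (rule NM[THEN iffD1])
  then obtain Y where Y: "Y \<in> meager_sets" "\<forall>T. finite T \<longrightarrow> (\<exists>t. \<forall>s\<in>T. \<forall>x\<in>F ` X. t + s + x \<in> Y)"
    by (rule meager_absorbs_translates[OF assms(1), THEN bexE])
  have "F ` (F -` Y) = Y" using \<open>bij F\<close> by (simp add: bij_def surj_image_vimage_eq)
  then have "F -` Y \<in> haar_null_sets" using NM[of "F -` Y"] Y(1) by simp
  with X(2) have "\<exists>T. finite T \<and> \<not> (\<exists>t. \<forall>s\<in>T. \<forall>x\<in>X. t + s + x \<in> F -` Y)" by (rule bspec)
  then obtain T where T: "finite T" "\<not> (\<exists>t. \<forall>s\<in>T. \<forall>x\<in>X. t + s + x \<in> F -` Y)" by (elim exE conjE)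
  obtain t where t: "\<forall>s\<in>F ` T. \<forall>x\<in>F ` X. t + s + x \<in> Y"
    using Y(2)[rule_format, OF finite_imageI[OF T(1)]] by (rule exE)
  obtain t' where "t = F t'" using surjE[OF bij_is_surj[OF \<open>bij F\<close>]] by blast
  then have "\<forall>s\<in>T. \<forall>x\<in>X. t' + s + x \<in> F -` Y" using t by (simp add: add)
  then have "\<exists>t. \<forall>s\<in>T. \<forall>x\<in>X. t + s + x \<in> F -` Y" by (rule exI)
  with T(2) show False by (rule notE)
qed

end
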